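(* Let $p$ be an odd prime, $\mathbb{F}_p$ the field with $p$ elements, $k\ge 2$ an integer, $d=2k+1$, and $A\subset \mathbb{F}_p$. Put $\mathcal{E}=A^d\subset\mathbb{F}_p^d$ and $\varepsilon=d\cdot \frac{2^{k+1}-5}{10(2^{k}-1)}$. There are constants $C,c>0$ (independent of $p$ and $A$) such that if $|\mathcal{E}|\ge C\, p^{\frac{d}{2}-\varepsilon}$, then \[\left\vert \Delta(\mathcal{E})\cdot \Delta(\mathcal{E})\right\vert\ge c\,p.\]
   Context: For $\mathbf{x}=(x_1,\dots,x_d),\mathbf{y}=(y_1,\dots,y_d)\in\mathbb{F}_p^d$, the distance is $\|\mathbf{x}-\mathbf{y}\|=(x_1-y_1)^2+\cdots+(x_d-y_d)^2\in\mathbb{F}_p$. For $\mathcal{E}\subset\mathbb{F}_p^d$, the distance set is $\Delta(\mathcal{E})=\{\|\mathbf{x}-\mathbf{y}\|:\mathbf{x},\mathbf{y}\in\mathcal{E}\}$, and its product set is $\Delta(\mathcal{E})\cdot\Delta(\mathcal{E})=\{ab: a,b\in\Delta(\mathcal{E})\}$. *)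

theory Defs
  imports "HOL-Analysis.Analysis"
begin

text \<open>The prime field F_p is modelled as the residues {0..<p} of int, with arithmetic mod p.
  A point of F_p^d is a function nat => int whose coordinates with index < d are residues
  and whose other coordinates are 0.\<close>

definition Fp :: "int \<Rightarrow> int set" where
  "Fp p = {0..<p}"

definition cube :: "nat \<Rightarrow> int set \<Rightarrow> (nat \<Rightarrow> int) set" where
  "cube d A = {x. (\<forall>i<d. x i \<in> A) \<and> (\<forall>i\<ge>d. x i = 0)}"

definition dist_Fp :: "int \<Rightarrow> nat \<Rightarrow> (nat \<Rightarrow> int) \<Rightarrow> (nat \<Rightarrow> int) \<Rightarrow> int" where
  "dist_Fp p d x y = (\<Sum>i<d. (x i - y i)^2) mod p"

definition distance_set :: "int \<Rightarrow> nat \<Rightarrow> (nat \<Rightarrow> int) set \<Rightarrow> int set" where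
  "distance_set p d E = {dist_Fp p d x y | x y. x \<in> E \<and> y \<in> E}"

definition prod_set_Fp :: "int \<Rightarrow> int set \<Rightarrow> int set" where
  "prod_set_Fp p S = {(a * b) mod p | a b. a \<in> S \<and> b \<in> S}"

end

theory Submission
  imports Defs "Subresultants.Subresultant_Gcd" "Berlekamp_Zassenhaus.Unique_Factorization_Poly"
    "Berlekamp_Zassenhaus.Finite_Field"
begin

text \<open>
  Write \<open>n = |A|\<close> and \<open>\<Delta>\<^sub>j = \<Delta>(A\<^sup>j)\<close>, so that \<open>\<Delta>\<^sub>j\<^sub>+\<^sub>1 = \<Delta>\<^sub>j + (A - A)\<^sup>2\<close>. The collisions of \<open>b + (x - y)\<^sup>2\<close> are
  incidences between points and planes of three-space, and Rudnev's point-plane bound gives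
  \<open>|\<Delta>\<^sub>j\<^sub>+\<^sub>1| \<ge> c n |\<Delta>\<^sub>j|\<^sup>1\<^sup>/\<^sup>2\<close>. Hence \<open>|\<Delta>\<^sub>k| \<ge> c n\<^bsup>2 - 2/2^k\<^esup>\<close>, which is at least a large multiple of \<open>p\<^sup>3\<^sup>/\<^sup>5\<close>. For a set \<open>B\<close>
  of that size, the same bound controls the lines rich in points of \<open>B \<times> B\<close>, hence the ratios \<open>r\<close> for which
  \<open>b\<^sub>1 - b\<^sub>2 = r (b\<^sub>3 - b\<^sub>4)\<close> has many solutions, hence the multiplicative energy of \<open>B + B\<close>; so \<open>(B + B)(B + B)\<close>
  has at least \<open>p/80\<close> elements. Apply this to \<open>B = \<Delta>\<^sub>k\<close>.

  The point-plane bound is proved by the polynomial method. The lines through a point, resp. in a plane, that meet a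
  fixed generic line turn points and planes into lines \<open>{z = z\<^sub>i, t = \<alpha>\<^sub>i w + \<beta>\<^sub>i}\<close> and \<open>{w = w\<^sub>j, t = \<gamma>\<^sub>j z + \<delta>\<^sub>j}\<close> with
  distinct \<open>z\<^sub>i\<close> and distinct \<open>w\<^sub>j\<close>, and incidences into intersections. If there are too many intersections, most of
  these lines lie on a surface \<open>F(w, z, t) = 0\<close> of low degree. An irreducible component of it that contains many lines
  of both kinds is flat in the \<open>w\<close>- and in the \<open>z\<close>-direction (otherwise a resultant bounds the number of
  lines), hence it is the graph of a bilinear function; such graphs correspond to collinear points.
\<close>

hide_const (open) up_ring.coeff up_ring.monom Module.smult Coset.order

section \<open>Polynomials in three variables\<close>

text \<open>The value 3/5 comes from the second moment, over ratios r, of the additive energies of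
  \<open>B\<close> and \<open>r B\<close>. With N = |B|, typical ratios contribute about N^8/p and
  exceptional ones about N^3 p^2; the former dominates once N^5 exceeds a multiple of p^3. The
  exponent \<alpha> of |A| is then fixed by \<alpha> (2 - 2/2^k) = 3/5, and d \<alpha> is the d/2 -
  \<epsilon> of the theorem. Two obstacles shape the incidence bound. In positive characteristic,
  tests by derivatives fail once degrees reach p. A surface through s lines can be chosen of degree
  about the square root of s, so the degrees stay below p as long as the smaller family has at most
  p^2 members; this is the origin of the size conditions. Moreover F_p has too few elements for
  generic choices and for identifying polynomials with the functions they define, so the geometry
  takes place in an infinite field of characteristic p containing F_p.\<close>

definition degree_fun :: "('r::idom \<Rightarrow> nat) \<Rightarrow> bool" where
  "degree_fun \<delta> \<longleftrightarrow> \<delta> 0 = 0 \<and> (\<forall>a b. a \<noteq> 0 \<longrightarrow> b \<noteq> 0 \<longrightarrow> \<delta> (a * b) = \<delta> a + \<delta> b) \<and>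
     (\<forall>a b. \<delta> (a + b) \<le> max (\<delta> a) (\<delta> b))"

lemma degree_fun_0: "degree_fun \<delta> \<Longrightarrow> \<delta> 0 = 0"
  and degree_fun_mult: "degree_fun \<delta> \<Longrightarrow> a \<noteq> 0 \<Longrightarrow> b \<noteq> 0 \<Longrightarrow> \<delta> (a * b) = \<delta> a + \<delta> b"
  and degree_fun_add: "degree_fun \<delta> \<Longrightarrow> \<delta> (a + b) \<le> max (\<delta> a) (\<delta> b)"
  by (auto simp: degree_fun_def)

lemma degree_fun_mult_le: "degree_fun \<delta> \<Longrightarrow> \<delta> (a * b) \<le> \<delta> a + \<delta> b"
  by (cases "a = 0 \<or> b = 0") (auto simp: degree_fun_0 degree_fun_mult)

lemma degree_fun_1:
  assumes "degree_fun \<delta>" shows "\<delta> 1 = 0" "\<delta> (- 1) = 0"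
proof -
  show 1: "\<delta> 1 = 0" using degree_fun_mult[OF assms, of 1 1] by simp
  show "\<delta> (- 1) = 0" using degree_fun_mult[OF assms, of "-1" "-1"] 1 by simp
qed

lemma degree_fun_uminus:
  assumes "degree_fun \<delta>" shows "\<delta> (- a) = \<delta> a"
proof (cases "a = 0")
  case False
  then show ?thesis using degree_fun_mult[OF assms, of "-1" a] degree_fun_1[OF assms] by simp
qed simp

lemma degree_fun_diff: "degree_fun \<delta> \<Longrightarrow> \<delta> (a - b) \<le> max (\<delta> a) (\<delta> b)"
  using degree_fun_add[of \<delta> a "- b"] degree_fun_uminus[of \<delta> b] by simp

lemma degree_fun_sum_le:
  assumes "degree_fun \<delta>" "\<And>i. i \<in> S \<Longrightarrow> f i \<noteq> 0 \<Longrightarrow> \<delta> (f i) \<le> N"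
  shows "\<delta> (sum f S) \<le> N"
proof (cases "finite S")
  case True
  then show ?thesis using assms(2)
  proof (induction S rule: finite_induct)
    case empty
    then show ?case using degree_fun_0[OF assms(1)] by simp
  next
    case (insert x S)
    have "\<delta> (f x) \<le> N" using insert(4)[of x] degree_fun_0[OF assms(1)] by (cases "f x = 0") auto
    moreover have "\<delta> (sum f S) \<le> N" using insert by blast
    ultimately show ?case
      using degree_fun_add[OF assms(1), of "f x" "sum f S"] insert by simp
  qed
qed (use degree_fun_0[OF assms(1)] in simp)

lemma degree_fun_sum_less:
  assumes "degree_fun \<delta>" "\<And>i. i \<in> S \<Longrightarrow> f i \<noteq> 0 \<Longrightarrow> \<delta> (f i) < N"
  shows "sum f S = 0 \<or> \<delta> (sum f S) < N"
proof (cases "N = 0")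
  case True
  then have "\<And>i. i \<in> S \<Longrightarrow> f i = 0" using assms(2) by auto
  then show ?thesis by simp
next
  case False
  have "\<delta> (sum f S) \<le> N - 1"
    using assms(2) False by (intro degree_fun_sum_le[OF assms(1)]) force
  then show ?thesis using False by auto
qed

lemma degree_fun_prod_le:
  assumes "degree_fun \<delta>" "finite S" "\<And>i. i \<in> S \<Longrightarrow> \<delta> (f i) \<le> N"
  shows "\<delta> (prod f S) \<le> card S * N"
  using assms(2,3)
proof (induction S rule: finite_induct)
  case empty
  then show ?case using degree_fun_1[OF assms(1)] by simp
next
  case (insert x S)
  have "\<delta> (f x * prod f S) \<le> \<delta> (f x) + \<delta> (prod f S)" by (rule degree_fun_mult_le[OF assms(1)])
  also have "\<dots> \<le> N + card S * N" using insert by (intro add_mono) auto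
  finally show ?case using insert by simp
qed

text \<open>This turns a degree function on the coefficients into one on polynomials. Started from
  the zero function on a field and applied three times, it yields the ordinary total degree in three
  variables.\<close>

definition total_deg :: "('r::idom \<Rightarrow> nat) \<Rightarrow> 'r poly \<Rightarrow> nat" where
  "total_deg \<delta> F = Max ((\<lambda>i. if coeff F i = 0 then 0 else \<delta> (coeff F i) + i) ` {..degree F})"

lemma total_deg_le_iff: "total_deg \<delta> F \<le> n \<longleftrightarrow> (\<forall>i. coeff F i \<noteq> 0 \<longrightarrow> \<delta> (coeff F i) + i \<le> n)"
proof -
  have "total_deg \<delta> F \<le> n \<longleftrightarrow> (\<forall>i\<le>degree F. coeff F i \<noteq> 0 \<longrightarrow> \<delta> (coeff F i) + i \<le> n)"
    unfolding total_deg_def by (subst Max_le_iff) auto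
  also have "\<dots> \<longleftrightarrow> (\<forall>i. coeff F i \<noteq> 0 \<longrightarrow> \<delta> (coeff F i) + i \<le> n)"
    using le_degree by blast
  finally show ?thesis .
qed

lemma total_deg_ge: "coeff F i \<noteq> 0 \<Longrightarrow> \<delta> (coeff F i) + i \<le> total_deg \<delta> F"
  using total_deg_le_iff[of \<delta> F "total_deg \<delta> F"] by simp

lemma total_deg_coeff_le:
  assumes "degree_fun \<delta>" shows "\<delta> (coeff F i) \<le> total_deg \<delta> F"
  using total_deg_ge[of F i \<delta>] degree_fun_0[OF assms] by (cases "coeff F i = 0") auto

lemma degree_le_total_deg: "degree F \<le> total_deg \<delta> F"
proof (cases "F = 0")
  case False
  then show ?thesis using total_deg_ge[of F "degree F" \<delta>] by simp
qed simp

lemma total_deg_attained: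
  assumes "F \<noteq> 0" obtains i where "coeff F i \<noteq> 0" "\<delta> (coeff F i) + i = total_deg \<delta> F"
proof (cases "total_deg \<delta> F = 0")
  case True
  have nz: "coeff F (degree F) \<noteq> 0" using assms by simp
  moreover have "\<delta> (coeff F (degree F)) + degree F = total_deg \<delta> F"
    using total_deg_ge[OF nz, of \<delta>] True by linarith
  ultimately show ?thesis by (rule that)
next
  case False
  have "total_deg \<delta> F \<in> (\<lambda>i. if coeff F i = 0 then 0 else \<delta> (coeff F i) + i) ` {..degree F}"
    unfolding total_deg_def by (rule Max_in) auto
  with False that show ?thesis by (auto split: if_splits)
qed

lemma total_deg_add:
  assumes "degree_fun \<delta>" shows "total_deg \<delta> (F + G) \<le> max (total_deg \<delta> F) (total_deg \<delta> G)"
  unfolding total_deg_le_iff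
proof (intro allI impI)
  fix i assume "coeff (F + G) i \<noteq> 0"
  have F: "coeff F i \<noteq> 0 \<Longrightarrow> \<delta> (coeff F i) + i \<le> total_deg \<delta> F"
   and G: "coeff G i \<noteq> 0 \<Longrightarrow> \<delta> (coeff G i) + i \<le> total_deg \<delta> G" by (simp_all add: total_deg_ge)
  have "\<delta> (coeff (F + G) i) \<le> max (\<delta> (coeff F i)) (\<delta> (coeff G i))"
    using degree_fun_add[OF assms] by simp
  with F G \<open>coeff (F + G) i \<noteq> 0\<close>
  show "\<delta> (coeff (F + G) i) + i \<le> max (total_deg \<delta> F) (total_deg \<delta> G)"
    by (cases "coeff F i = 0"; cases "coeff G i = 0") (auto simp: max_def split: if_splits)
qed

text \<open>Among the terms of full total degree, take those with the largest exponents i and j of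
  the outer variable. Every other product that contributes to coefficient i + j has smaller degree,
  so \<open>coeff F i * coeff G j\<close> cannot be cancelled.\<close>

lemma total_deg_mult:
  assumes \<delta>: "degree_fun \<delta>" and "F \<noteq> 0" "G \<noteq> 0"
  shows "total_deg \<delta> (F * G) = total_deg \<delta> F + total_deg \<delta> G"
proof (rule antisym)
  let ?m = "total_deg \<delta> F" and ?n = "total_deg \<delta> G"
  show "total_deg \<delta> (F * G) \<le> ?m + ?n"
    unfolding total_deg_le_iff
  proof (intro allI impI)
    fix l assume nz: "coeff (F * G) l \<noteq> 0"
    have t: "\<delta> (coeff F i * coeff G (l - i)) + l \<le> ?m + ?n"
      if "i \<le> l" "coeff F i * coeff G (l - i) \<noteq> 0" for i
      using total_deg_ge[of F i \<delta>] total_deg_ge[of G "l - i" \<delta>] that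
      by (simp add: degree_fun_mult[OF \<delta>])
    have "\<exists>i\<le>l. coeff F i * coeff G (l - i) \<noteq> 0"
      using nz unfolding coeff_mult by (meson atMost_iff sum.neutral)
    then have l: "l \<le> ?m + ?n" using t by fastforce
    have "\<delta> (coeff (F * G) l) \<le> ?m + ?n - l"
      unfolding coeff_mult using t by (intro degree_fun_sum_le[OF \<delta>]) fastforce
    then show "\<delta> (coeff (F * G) l) + l \<le> ?m + ?n" using l by linarith
  qed
  define top where "top = (\<lambda>H. {i. coeff H i \<noteq> 0 \<and> \<delta> (coeff H i) + i = total_deg \<delta> H})"
  have fin: "finite (top H)" for H
    by (rule finite_subset[of _ "{..degree H}"]) (auto simp: top_def le_degree)
  have ne: "H \<noteq> 0 \<Longrightarrow> top H \<noteq> {}" for H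
    unfolding top_def by (rule total_deg_attained[of H \<delta>]) blast+
  define i where "i = Max (top F)"
  define j where "j = Max (top G)"
  have i: "i \<in> top F" and j: "j \<in> top G"
    unfolding i_def j_def using Max_in[OF fin ne[OF assms(2)]] Max_in[OF fin ne[OF assms(3)]] .
  have imax: "\<delta> (coeff F a) + a < ?m" if "a > i" "coeff F a \<noteq> 0" for a
  proof -
    have "a \<notin> top F" using that(1) Max_ge[OF fin, of a F] unfolding i_def by auto
    then show ?thesis using total_deg_ge[of F a \<delta>] that by (auto simp: top_def)
  qed
  have jmax: "\<delta> (coeff G a) + a < ?n" if "a > j" "coeff G a \<noteq> 0" for a
  proof -
    have "a \<notin> top G" using that(1) Max_ge[OF fin, of a G] unfolding j_def by auto
    then show ?thesis using total_deg_ge[of G a \<delta>] that by (auto simp: top_def)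
  qed
  define x where "x = coeff F i * coeff G j"
  define r where "r = (\<Sum>a\<in>{..i+j} - {i}. coeff F a * coeff G (i + j - a))"
  have nx: "x \<noteq> 0" and dx: "\<delta> x + (i + j) = ?m + ?n"
    using i j by (auto simp: x_def top_def degree_fun_mult[OF \<delta>])
  have "coeff (F * G) (i + j) = x + r"
    unfolding coeff_mult x_def r_def by (subst sum.remove[of _ i]) auto
  have r: "r = 0 \<or> \<delta> r < \<delta> x"
    unfolding r_def
  proof (rule degree_fun_sum_less[OF \<delta>])
    fix a assume a: "a \<in> {..i+j} - {i}" and nz: "coeff F a * coeff G (i + j - a) \<noteq> 0"
    have le: "\<delta> (coeff F a) + a \<le> ?m" "\<delta> (coeff G (i+j-a)) + (i+j-a) \<le> ?n"
      using nz total_deg_ge by auto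
    have "\<delta> (coeff F a) + a < ?m \<or> \<delta> (coeff G (i+j-a)) + (i+j-a) < ?n"
      using imax[of a] jmax[of "i+j-a"] a nz by (cases "a > i") auto
    then show "\<delta> (coeff F a * coeff G (i + j - a)) < \<delta> x"
      using le dx a nz by (auto simp: degree_fun_mult[OF \<delta>])
  qed
  have "x + r \<noteq> 0"
  proof
    assume "x + r = 0"
    then have "x = - r" by (simp add: eq_neg_iff_add_eq_0)
    then show False using r nx degree_fun_uminus[OF \<delta>, of r] by auto
  qed
  moreover have "\<delta> x \<le> \<delta> (x + r)"
    using degree_fun_diff[OF \<delta>, of "x + r" r] r by (auto simp: max_def split: if_splits)
  ultimately have "\<delta> x + (i + j) \<le> total_deg \<delta> (F * G)"
    using total_deg_ge[of "F * G" "i + j" \<delta>] \<open>coeff (F * G) (i + j) = x + r\<close> by simp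
  then show "?m + ?n \<le> total_deg \<delta> (F * G)" using dx by simp
qed

lemma degree_fun_total_deg: "degree_fun \<delta> \<Longrightarrow> degree_fun (total_deg \<delta>)"
proof -
  assume \<delta>: "degree_fun \<delta>"
  have "total_deg \<delta> 0 = 0" by (simp add: total_deg_def)
  then show ?thesis
    unfolding degree_fun_def[of "total_deg \<delta>"] using total_deg_mult[OF \<delta>] total_deg_add[OF \<delta>] by blast
qed

abbreviation deg1 :: "'k::field poly \<Rightarrow> nat" where "deg1 \<equiv> total_deg (\<lambda>_. 0)"
abbreviation deg2 :: "'k::field poly poly \<Rightarrow> nat" where "deg2 \<equiv> total_deg deg1"
abbreviation deg3 :: "'k::field poly poly poly \<Rightarrow> nat" where "deg3 \<equiv> total_deg deg2"

lemma degree_fun_deg1 [simp]: "degree_fun deg1"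
  by (rule degree_fun_total_deg) (simp add: degree_fun_def)
lemma degree_fun_deg2 [simp]: "degree_fun deg2"
  by (rule degree_fun_total_deg) simp
lemma degree_fun_deg3 [simp]: "degree_fun deg3"
  by (rule degree_fun_total_deg) simp

lemma total_deg_pderiv_le:
  assumes \<delta>: "degree_fun \<delta>"
  shows "total_deg \<delta> (pderiv F) \<le> total_deg \<delta> F"
  unfolding total_deg_le_iff
proof (intro allI impI)
  fix i assume "coeff (pderiv F) i \<noteq> 0"
  then have nz: "(of_nat (Suc i) :: 'a) \<noteq> 0" "coeff F (Suc i) \<noteq> 0" by (auto simp: coeff_pderiv)
  have "\<delta> (of_nat n) = 0" for n
  proof (induction n)
    case (Suc n)
    then show ?case using degree_fun_add[OF \<delta>, of 1 "of_nat n"] degree_fun_1[OF \<delta>] by simp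
  qed (simp add: degree_fun_0[OF \<delta>])
  then have "\<delta> (coeff (pderiv F) i) = \<delta> (coeff F (Suc i))"
    using nz unfolding coeff_pderiv by (subst degree_fun_mult[OF \<delta>]) (auto simp del: of_nat_Suc)
  then show "\<delta> (coeff (pderiv F) i) + i \<le> total_deg \<delta> F"
    using total_deg_ge[of F "Suc i" \<delta>] nz by simp
qed

lemma total_deg_map_poly_le:
  assumes "\<And>c. \<delta> (f c) \<le> \<delta> c" "f 0 = 0"
  shows "total_deg \<delta> (map_poly f F) \<le> total_deg \<delta> F"
  unfolding total_deg_le_iff
proof (intro allI impI)
  fix i assume "coeff (map_poly f F) i \<noteq> 0"
  then have "coeff F i \<noteq> 0" using assms by (auto simp: coeff_map_poly)
  then show "\<delta> (coeff (map_poly f F) i) + i \<le> total_deg \<delta> F"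
    using total_deg_ge[of F i \<delta>] assms(1)[of "coeff F i"] by (simp add: coeff_map_poly assms(2))
qed

section \<open>Partial derivatives and restriction to curves\<close>

abbreviation (input) D\<^sub>t :: "'k::field poly poly poly \<Rightarrow> 'k poly poly poly" where "D\<^sub>t \<equiv> pderiv"
definition D\<^sub>z :: "'k::field poly poly poly \<Rightarrow> 'k poly poly poly" where "D\<^sub>z = map_poly pderiv"
definition D\<^sub>w :: "'k::field poly poly poly \<Rightarrow> 'k poly poly poly" where "D\<^sub>w = map_poly (map_poly pderiv)"

lemma deg3_deriv_le: "deg3 (D\<^sub>w F) \<le> deg3 F" "deg3 (D\<^sub>z F) \<le> deg3 F" "deg3 (D\<^sub>t F) \<le> deg3 F"
proof -
  have 1: "deg1 (pderiv d) \<le> deg1 d" for d :: "'a poly"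
    by (rule total_deg_pderiv_le) (simp add: degree_fun_def)
  have 2: "deg2 (map_poly pderiv c) \<le> deg2 c" "deg2 (pderiv c) \<le> deg2 c" for c :: "'a poly poly"
    using 1 by (auto intro: total_deg_map_poly_le total_deg_pderiv_le)
  show "deg3 (D\<^sub>w F) \<le> deg3 F" "deg3 (D\<^sub>z F) \<le> deg3 F" "deg3 (D\<^sub>t F) \<le> deg3 F"
    unfolding D\<^sub>w_def D\<^sub>z_def
    using 2 by (auto intro: total_deg_map_poly_le total_deg_pderiv_le)
qed

lemma comm_ring_hom_poly_eval:
  assumes "comm_ring_hom h" shows "comm_ring_hom (\<lambda>F. poly (map_poly h F) T)"
proof -
  interpret h: comm_ring_hom h by fact
  interpret mh: map_poly_comm_ring_hom h ..
  show ?thesis by unfold_locales (auto simp: mh.hom_add mh.hom_mult)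
qed

lemma comm_ring_hom_pcompose: "comm_ring_hom (\<lambda>d. pcompose d (W :: 'k::comm_ring_1 poly))"
  by unfold_locales (auto simp: pcompose_add pcompose_mult pcompose_1)

lemma comm_ring_hom_poly: "comm_ring_hom (\<lambda>d. poly d (w :: 'k::comm_ring_1))"
  by unfold_locales auto

text \<open>The innermost variable is w, then z, then t. \<open>ev\<close> restricts a polynomial to
  the parametrised curve (W, Z, T), and \<open>pev\<close> takes its value at a single point. Both
  are ring homomorphisms, which is what carries divisibility and vanishing of resultants over to
  lines and points.\<close>

definition ev2 :: "'k::field poly \<Rightarrow> 'k poly \<Rightarrow> 'k poly poly \<Rightarrow> 'k poly" where
  "ev2 W Z c = poly (map_poly (\<lambda>d. pcompose d W) c) Z"
definition ev :: "'k::field poly \<Rightarrow> 'k poly \<Rightarrow> 'k poly \<Rightarrow> 'k poly poly poly \<Rightarrow> 'k poly" where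
  "ev W Z T F = poly (map_poly (ev2 W Z) F) T"
definition pev2 :: "'k::field \<Rightarrow> 'k \<Rightarrow> 'k poly poly \<Rightarrow> 'k" where
  "pev2 w z c = poly (map_poly (\<lambda>d. poly d w) c) z"
definition pev :: "'k::field \<Rightarrow> 'k \<Rightarrow> 'k \<Rightarrow> 'k poly poly poly \<Rightarrow> 'k" where
  "pev w z t F = poly (map_poly (pev2 w z) F) t"

lemma ev2_pCons: "ev2 W Z (pCons d c) = pcompose d W + Z * ev2 W Z c"
  unfolding ev2_def by (cases "d = 0 \<and> c = 0") (auto simp: map_poly_pCons ev2_def pev2_def)
lemma ev_pCons: "ev W Z T (pCons c F) = ev2 W Z c + T * ev W Z T F"
  unfolding ev_def by (cases "c = 0 \<and> F = 0") (auto simp: map_poly_pCons ev2_def pev2_def)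
lemma pev2_pCons: "pev2 w z (pCons d c) = poly d w + z * pev2 w z c"
  unfolding pev2_def by (cases "d = 0 \<and> c = 0") (auto simp: map_poly_pCons ev2_def pev2_def)
lemma pev_pCons: "pev w z t (pCons c F) = pev2 w z c + t * pev w z t F"
  unfolding pev_def by (cases "c = 0 \<and> F = 0") (auto simp: map_poly_pCons ev2_def pev2_def)

lemma comm_ring_hom_ev2: "comm_ring_hom (ev2 W Z)"
  unfolding ev2_def by (intro comm_ring_hom_poly_eval comm_ring_hom_pcompose)
lemma comm_ring_hom_pev2: "comm_ring_hom (pev2 w z)"
  unfolding pev2_def by (intro comm_ring_hom_poly_eval comm_ring_hom_poly)
lemma comm_ring_hom_ev: "comm_ring_hom (ev W Z T)"
  unfolding ev_def by (intro comm_ring_hom_poly_eval comm_ring_hom_ev2)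
lemma comm_ring_hom_pev: "comm_ring_hom (pev w z t)"
  unfolding pev_def by (intro comm_ring_hom_poly_eval comm_ring_hom_pev2)

interpretation ev2: comm_ring_hom "ev2 W Z" for W Z by (rule comm_ring_hom_ev2)
interpretation pev2: comm_ring_hom "pev2 w z" for w z by (rule comm_ring_hom_pev2)
interpretation ev: comm_ring_hom "ev W Z T" for W Z T by (rule comm_ring_hom_ev)
interpretation pev: comm_ring_hom "pev w z t" for w z t by (rule comm_ring_hom_pev)

lemma poly_ev2: "poly (ev2 W Z c) u = pev2 (poly W u) (poly Z u) c"
  by (induction c) (auto simp: ev2_pCons pev2_pCons poly_pcompose)
lemma poly_ev: "poly (ev W Z T F) u = pev (poly W u) (poly Z u) (poly T u) F"
  by (induction F) (auto simp: ev_pCons pev_pCons poly_ev2)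

lemma pderiv_ev2:
  "pderiv (ev2 W Z c) = ev2 W Z (map_poly pderiv c) * pderiv W + ev2 W Z (pderiv c) * pderiv Z"
proof (induction c)
  case (pCons d c)
  have 1: "map_poly pderiv (pCons d c) = pCons (pderiv d) (map_poly pderiv c)"
    by (rule map_poly_pCons) (use pCons(1) in auto)
  have 2: "ev2 W Z (pderiv (pCons d c)) = ev2 W Z c + Z * ev2 W Z (pderiv c)"
    by (simp only: pderiv_pCons ev2.hom_add ev2_pCons pcompose_0 add_0)
  show ?case
    unfolding 1 2 by (simp only: ev2_pCons pderiv_add pderiv_mult pderiv_pcompose pCons.IH) (simp add: algebra_simps)
qed simp

lemma pderiv_ev:
  "pderiv (ev W Z T F) = ev W Z T (D\<^sub>w F) * pderiv W + ev W Z T (D\<^sub>z F) * pderiv Z + ev W Z T (D\<^sub>t F) * pderiv T"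
proof (induction F)
  case (pCons c F)
  have 1: "D\<^sub>w (pCons c F) = pCons (map_poly pderiv c) (D\<^sub>w F)" "D\<^sub>z (pCons c F) = pCons (pderiv c) (D\<^sub>z F)"
    unfolding D\<^sub>w_def D\<^sub>z_def by (rule map_poly_pCons; use pCons(1) in auto)+
  have 2: "ev W Z T (D\<^sub>t (pCons c F)) = ev W Z T F + T * ev W Z T (D\<^sub>t F)"
    by (simp only: pderiv_pCons ev.hom_add ev_pCons ev2.hom_zero add_0)
  show ?case
    unfolding 1 2 by (simp only: ev_pCons pderiv_add pderiv_mult pderiv_ev2 pCons.IH) (simp add: algebra_simps)
qed (simp add: D\<^sub>w_def D\<^sub>z_def)

lemma degree_poly_eval_le:
  fixes h :: "'r::idom \<Rightarrow> 's::comm_ring_1 poly"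
  assumes "\<And>c. degree (h c) \<le> \<delta> c" "h 0 = 0" "degree T \<le> 1" "degree_fun \<delta>"
  shows "degree (poly (map_poly h F) T) \<le> total_deg \<delta> F"
proof -
  have "poly (map_poly h F) T = (\<Sum>i\<le>degree F. h (coeff F i) * T ^ i)"
  proof -
    have "poly (map_poly h F) T = (\<Sum>i\<le>degree (map_poly h F). h (coeff F i) * T ^ i)"
      by (simp add: poly_altdef coeff_map_poly assms(2))
    also have "\<dots> = (\<Sum>i\<le>degree F. h (coeff F i) * T ^ i)"
    proof (rule sum.mono_neutral_left)
      show "\<forall>i\<in>{..degree F} - {..degree (map_poly h F)}. h (coeff F i) * T ^ i = 0"
        using coeff_eq_0[of "map_poly h F"] by (auto simp: coeff_map_poly assms(2) not_le)
    qed (use degree_map_poly_le[of h F] in auto)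
    finally show ?thesis .
  qed
  also have "degree \<dots> \<le> total_deg \<delta> F"
  proof (rule degree_sum_le)
    fix i assume "i \<in> {..degree F}"
    show "degree (h (coeff F i) * T ^ i) \<le> total_deg \<delta> F"
    proof (cases "coeff F i = 0")
      case False
      have "degree (h (coeff F i) * T ^ i) \<le> degree (h (coeff F i)) + degree (T ^ i)"
        by (rule degree_mult_le)
      also have "\<dots> \<le> \<delta> (coeff F i) + 1 * i"
        using assms(1)[of "coeff F i"] degree_power_le[of T i] mult_le_mono1[OF assms(3), of i]
        by linarith
      also have "\<dots> \<le> total_deg \<delta> F" using total_deg_ge[OF False] by simp
      finally show ?thesis .
    qed (simp add: assms)
  qed simp
  finally show ?thesis .
qed

lemma degree_ev_le:
  assumes "degree W \<le> 1" "degree Z \<le> 1" "degree T \<le> 1"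
  shows "degree (ev W Z T F) \<le> deg3 F"
proof -
  have 1: "degree (pcompose d W) \<le> deg1 d" for d :: "'a poly"
  proof -
    have "degree (pcompose d W) \<le> degree d * degree W" by (rule degree_pcompose_le)
    also have "\<dots> \<le> degree d * 1" using assms by (intro mult_le_mono) auto
    finally show ?thesis using degree_le_total_deg[of d "\<lambda>_. 0"] by linarith
  qed
  have 2: "degree (ev2 W Z c) \<le> deg2 c" for c
    unfolding ev2_def using 1 assms by (intro degree_poly_eval_le) auto
  show ?thesis unfolding ev_def using 2 assms by (intro degree_poly_eval_le) auto
qed

text \<open>
  \<open>- curv D F / (D\<^sub>t F)\<^sup>3\<close> is the second \<open>D\<close>-derivative of the function \<open>t\<close> defined implicitly by \<open>F = 0\<close>,
  so it vanishes along straight lines contained in the surface.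
\<close>

definition curv :: "('k::field poly poly poly \<Rightarrow> 'k poly poly poly) \<Rightarrow> 'k poly poly poly \<Rightarrow> 'k poly poly poly" where
  "curv D F = D (D F) * (D\<^sub>t F)\<^sup>2 - (D (D\<^sub>t F) + D\<^sub>t (D F)) * (D F * D\<^sub>t F) + D\<^sub>t (D\<^sub>t F) * (D F)\<^sup>2"

lemma deg3_curv_le:
  assumes D: "\<And>G. deg3 (D G) \<le> deg3 G"
  shows "deg3 (curv D F) \<le> 3 * deg3 F"
proof -
  note mult = degree_fun_mult_le[OF degree_fun_deg3] and add = degree_fun_add[OF degree_fun_deg3]
    and diff = degree_fun_diff[OF degree_fun_deg3] and Dt = deg3_deriv_le(3)
  have "deg3 (D (D F)) \<le> deg3 F" "deg3 (D (D\<^sub>t F)) \<le> deg3 F" "deg3 (D\<^sub>t (D F)) \<le> deg3 F"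
    "deg3 (D\<^sub>t (D\<^sub>t F)) \<le> deg3 F" "deg3 (D F) \<le> deg3 F" "deg3 (D\<^sub>t F) \<le> deg3 F"
    using D Dt order_trans by blast+
  note h = this
  have "deg3 (D (D F) * (D\<^sub>t F)\<^sup>2) \<le> 3 * deg3 F"
    using mult[of "D (D F)" "(D\<^sub>t F)\<^sup>2"] mult[of "D\<^sub>t F" "D\<^sub>t F"] h by (simp add: power2_eq_square)
  moreover have "deg3 ((D (D\<^sub>t F) + D\<^sub>t (D F)) * (D F * D\<^sub>t F)) \<le> 3 * deg3 F"
    using mult[of "D (D\<^sub>t F) + D\<^sub>t (D F)" "D F * D\<^sub>t F"] mult[of "D F" "D\<^sub>t F"] add[of "D (D\<^sub>t F)" "D\<^sub>t (D F)"] h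
    by (auto simp: max_def split: if_splits)
  moreover have "deg3 (D\<^sub>t (D\<^sub>t F) * (D F)\<^sup>2) \<le> 3 * deg3 F"
    using mult[of "D\<^sub>t (D\<^sub>t F)" "(D F)\<^sup>2"] mult[of "D F" "D F"] h by (simp add: power2_eq_square)
  ultimately show ?thesis
    unfolding curv_def
    using add[of "D (D F) * (D\<^sub>t F)\<^sup>2 - (D (D\<^sub>t F) + D\<^sub>t (D F)) * (D F * D\<^sub>t F)" "D\<^sub>t (D\<^sub>t F) * (D F)\<^sup>2"]
      diff[of "D (D F) * (D\<^sub>t F)\<^sup>2" "(D (D\<^sub>t F) + D\<^sub>t (D F)) * (D F * D\<^sub>t F)"]
    by (auto simp: max_def split: if_splits)
qed

text \<open>Write g for the restriction of F to the line and a for that of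
  \<open>D\<^sub>t F\<close>. The chain rule expresses the restriction of \<open>D F\<close> as g' -
  \<sigma> a and that of \<open>D (D F)\<close> through g'' and the other second derivatives. After
  substitution, every term other than a^2 g'' either cancels or has the factor g'.\<close>

lemma ev_curv:
  assumes chain: "\<And>G. pderiv (ev W Z T G) = ev W Z T (D G) + [:\<sigma>:] * ev W Z T (D\<^sub>t G)"
  shows "\<exists>q. ev W Z T (curv D F) = (ev W Z T (D\<^sub>t F))\<^sup>2 * pderiv (pderiv (ev W Z T F)) + pderiv (ev W Z T F) * q"
proof -
  let ?e = "ev W Z T"
  define g a where "g = pderiv (?e F)" and "a = ?e (D\<^sub>t F)"
  have b: "?e (D F) = g - [:\<sigma>:] * a" unfolding g_def a_def chain by simp
  have "pderiv g = ?e (D (D F)) + [:\<sigma>:] * ?e (D\<^sub>t (D F)) + [:\<sigma>:] * (?e (D (D\<^sub>t F)) + [:\<sigma>:] * ?e (D\<^sub>t (D\<^sub>t F)))"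
  proof -
    have "pderiv g = pderiv (?e (D F)) + [:\<sigma>:] * pderiv (?e (D\<^sub>t F))"
      unfolding g_def chain[of F] by (simp add: pderiv_add pderiv_smult)
    then show ?thesis unfolding chain[of "D F"] chain[of "D\<^sub>t F"] .
  qed
  then have c: "?e (D (D F)) = pderiv g - [:\<sigma>:] * ?e (D\<^sub>t (D F)) - [:\<sigma>:] * (?e (D (D\<^sub>t F)) + [:\<sigma>:] * ?e (D\<^sub>t (D\<^sub>t F)))"
    by (simp only: diff_eq_eq eq_diff_eq add_ac)
  define x y s where "x = ?e (D (D\<^sub>t F)) + ?e (D\<^sub>t (D F))" and "y = ?e (D\<^sub>t (D\<^sub>t F))" and "s = [:\<sigma>:]"
  have c': "?e (D (D F)) = pderiv g - s * x - s * (s * y)"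
    unfolding c x_def y_def s_def by (simp only: algebra_simps)
  have "?e (curv D F) = ?e (D (D F)) * a\<^sup>2 - x * (?e (D F) * a) + y * (?e (D F))\<^sup>2"
    unfolding curv_def x_def y_def a_def
    by (simp only: ev.hom_add ev.hom_minus ev.hom_mult ev.hom_power)
  also have "\<dots> = a\<^sup>2 * pderiv g + g * (y * (g - 2 * s * a) - x * a)"
    unfolding c' b s_def[symmetric] by (simp only: power2_eq_square algebra_simps) simp
  finally show ?thesis unfolding g_def a_def by blast
qed

lemma ev_curv_eq_0:
  assumes "\<And>G. pderiv (ev W Z T G) = ev W Z T (D G) + [:\<sigma>:] * ev W Z T (D\<^sub>t G)" "ev W Z T F = 0"
  shows "ev W Z T (curv D F) = 0"
  using ev_curv[of W Z T D \<sigma> F, OF assms(1)] assms(2) by auto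

text \<open>The third condition on the point makes the line tangent to the surface, so a nonzero
  restriction g vanishes at 0 to some order r \<ge> 2. Then a^2 g'' has order exactly r - 2, since
  a(0) and r (r - 1) are nonzero in the field. But it is the difference of the restriction of
  \<open>curv D F\<close>, a multiple of g, and a multiple of g', both of order at least r - 1.
  Hence tangency forces containment.\<close>

lemma flat_line:
  assumes chain: "\<And>G. pderiv (ev W Z T G) = ev W Z T (D G) + [:\<sigma>:] * ev W Z T (D\<^sub>t G)"
    and dvd: "F dvd curv D F"
    and pt: "poly (ev W Z T F) 0 = 0" "poly (ev W Z T (D\<^sub>t F)) 0 \<noteq> 0"
       "poly (ev W Z T (D F)) 0 + \<sigma> * poly (ev W Z T (D\<^sub>t F)) 0 = 0"
    and char: "\<And>n. 0 < n \<Longrightarrow> n \<le> degree (ev W Z T F) \<Longrightarrow> (of_nat n :: 'k::field) \<noteq> 0"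
  shows "ev W Z T (F :: 'k poly poly poly) = 0"
proof (rule ccontr)
  define g where "g = ev W Z T F"
  assume "ev W Z T F \<noteq> 0"
  then have g0: "g \<noteq> 0" by (simp add: g_def)
  define r where "r = (LEAST i. coeff g i \<noteq> 0)"
  have r: "coeff g r \<noteq> 0" unfolding r_def
    by (rule LeastI[of "\<lambda>i. coeff g i \<noteq> 0" "degree g"]) (use g0 in simp)
  have below: "coeff g i = 0" if "i < r" for i using not_less_Least[of i "\<lambda>i. coeff g i \<noteq> 0"] that r_def by auto
  have c0: "coeff g 0 = 0" using pt(1) by (simp add: g_def poly_0_coeff_0)
  have "poly (pderiv g) 0 = 0" using pt(3) unfolding g_def chain by simp
  then have c1: "coeff g 1 = 0" by (simp add: poly_0_coeff_0 coeff_pderiv)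
  have r2: "r \<ge> 2" using r c0 c1 by (cases r; cases "r - 1") auto
  have "r \<le> degree g" using r le_degree by blast
  define a where "a = ev W Z T (D\<^sub>t F)"
  obtain q where q: "ev W Z T (curv D F) = a\<^sup>2 * pderiv (pderiv g) + pderiv g * q"
    using ev_curv[of W Z T D \<sigma> F, OF chain] unfolding g_def a_def by blast
  have "g dvd ev W Z T (curv D F)" unfolding g_def using dvd by (rule ev.hom_dvd)
  moreover have "monom 1 (r - 1) dvd g" by (simp add: monom_1_dvd_iff' below)
  ultimately have 1: "monom 1 (r - 1) dvd ev W Z T (curv D F)" by (rule dvd_trans[rotated])
  have "monom 1 (r - 1) dvd pderiv g" by (auto simp: monom_1_dvd_iff' below coeff_pderiv)
  then have "monom 1 (r - 1) dvd pderiv g * q" by simp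
  with 1 have "monom 1 (r - 1) dvd a\<^sup>2 * pderiv (pderiv g)" unfolding q by (simp add: dvd_add_left_iff)
  then have 2: "coeff (a\<^sup>2 * pderiv (pderiv g)) (r - 2) = 0" using r2 by (auto simp: monom_1_dvd_iff')
  have "monom 1 (r - 2) dvd pderiv (pderiv g)" by (auto simp: monom_1_dvd_iff' below coeff_pderiv)
  then obtain h where h: "pderiv (pderiv g) = monom 1 (r - 2) * h" by (rule dvdE)
  have "coeff (a\<^sup>2 * pderiv (pderiv g)) (r - 2) = coeff (monom 1 (r - 2) * (a\<^sup>2 * h)) (r - 2)"
    unfolding h by (simp add: algebra_simps)
  also have "\<dots> = (coeff a 0)\<^sup>2 * coeff h 0"
    by (simp add: coeff_monom_mult coeff_mult_0 power2_eq_square)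
  also have "coeff h 0 = coeff (pderiv (pderiv g)) (r - 2)" unfolding h by (simp add: coeff_monom_mult)
  also have "\<dots> = of_nat (r - 1) * (of_nat r * coeff g r)"
    using r2 by (simp add: coeff_pderiv Suc_diff_Suc numeral_2_eq_2 del: of_nat_Suc)
  finally have "(coeff a 0)\<^sup>2 * (of_nat (r - 1) * (of_nat r * coeff g r)) = 0" using 2 by simp
  moreover have "coeff a 0 \<noteq> 0" using pt(2) by (simp add: a_def poly_0_coeff_0)
  moreover have "(of_nat (r - 1) :: 'k) \<noteq> 0" "(of_nat r :: 'k) \<noteq> 0"
    using char[of "r - 1"] char[of r] \<open>r \<le> degree g\<close> r2 unfolding g_def by linarith+
  ultimately show False using r by simp
qed

subsection \<open>Lines common to two surfaces\<close>

text \<open>Leading coefficients may vanish under \<open>h\<close>, so the resultant of the images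
  need not be the image of the resultant. Instead the Sylvester matrix itself is mapped: the vector
  of powers of \<open>T\<close> lies in its kernel, and is nonzero because its last entry is
  1.\<close>

lemma hom_resultant_eq_0:
  fixes F H :: "'r::comm_ring_1 poly" and h :: "'r \<Rightarrow> 's::idom"
  assumes "comm_ring_hom h" "degree F > 0" "poly (map_poly h F) T = 0" "poly (map_poly h H) T = 0"
  shows "h (resultant F H) = 0"
proof -
  interpret h: comm_ring_hom h by fact
  interpret mh: map_poly_comm_ring_hom h ..
  define n where "n = degree F + degree H"
  define S where "S = sylvester_mat F H"
  define v where "v = Matrix.vec n (\<lambda>j. T ^ (n - 1 - j))"
  have S: "S \<in> carrier_mat n n" unfolding S_def n_def by (rule sylvester_carrier_mat)
  have n: "n > 0" using assms(2) by (simp add: n_def)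
  have v0: "v \<noteq> 0\<^sub>v n"
  proof
    assume "v = 0\<^sub>v n"
    then have "vec_index v (n - 1) = vec_index (0\<^sub>v n) (n - 1)" by simp
    then show False using n by (simp add: v_def)
  qed
  have sum0: "(\<Sum>j<n. h (coeff q (n - 1 - j)) * T ^ (n - 1 - j)) = 0"
    if "q = monom 1 k * G" "degree q < n" "poly (map_poly h G) T = 0" for q k G
  proof -
    have "(\<Sum>j<n. h (coeff q (n - 1 - j)) * T ^ (n - 1 - j)) = (\<Sum>j<n. h (coeff q j) * T ^ j)"
      using sum.nat_diff_reindex[of "\<lambda>l. h (coeff q l) * T ^ l" n] by simp
    also have "\<dots> = (\<Sum>j\<le>degree (map_poly h q). h (coeff q j) * T ^ j)"
    proof (rule sum.mono_neutral_right)
      show "{..degree (map_poly h q)} \<subseteq> {..<n}" using that(2) degree_map_poly_le[of h q] by auto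
      show "\<forall>i\<in>{..<n} - {..degree (map_poly h q)}. h (coeff q i) * T ^ i = 0"
        using coeff_eq_0[of "map_poly h q"] by (auto simp: not_le)
    qed simp
    also have "\<dots> = poly (map_poly h q) T" by (simp add: poly_altdef)
    also have "\<dots> = 0" unfolding that(1) using that(3) by (simp add: mh.hom_mult)
    finally show ?thesis .
  qed
  have deg: "degree (monom 1 k * G) \<le> k + degree G" for k and G :: "'r poly"
    using degree_mult_le[of "monom 1 k" G] degree_monom_le[of "1::'r" k] by linarith
  have "map_mat h S *\<^sub>v v = 0\<^sub>v n"
  proof (rule eq_vecI)
    fix i assume "i < dim_vec (0\<^sub>v n :: 's Matrix.vec)"
    then have i: "i < n" by simp
    have eq: "vec_index (map_mat h S *\<^sub>v v) i = (\<Sum>j<n. h (S $$ (i,j)) * T ^ (n - 1 - j))"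
      using i S by (simp add: v_def scalar_prod_def atLeast0LessThan row_def)
    have "(\<Sum>j<n. h (S $$ (i,j)) * T ^ (n - 1 - j)) = 0"
    proof (cases "i < degree H")
      case True
      have "S $$ (i,j) = coeff (monom 1 (degree H - i - 1) * F) (n - 1 - j)" if "j < n" for j
        unfolding S_def using i that True
        by (subst sylvester_index_mat2) (auto simp: n_def coeff_monom_mult intro!: arg_cong[of _ _ "coeff F"])
      then have "(\<Sum>j<n. h (S $$ (i,j)) * T ^ (n - 1 - j)) =
         (\<Sum>j<n. h (coeff (monom 1 (degree H - i - 1) * F) (n - 1 - j)) * T ^ (n - 1 - j))" by simp
      also have "\<dots> = 0"
        using deg[of "degree H - i - 1" F] True assms(3) by (intro sum0[OF refl]) (auto simp: n_def)
      finally show ?thesis .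
    next
      case False
      have "S $$ (i,j) = coeff (monom 1 (n - i - 1) * H) (n - 1 - j)" if "j < n" for j
        unfolding S_def using i that False
        by (subst sylvester_index_mat2) (auto simp: n_def coeff_monom_mult intro!: arg_cong[of _ _ "coeff H"])
      then have "(\<Sum>j<n. h (S $$ (i,j)) * T ^ (n - 1 - j)) =
         (\<Sum>j<n. h (coeff (monom 1 (n - i - 1) * H) (n - 1 - j)) * T ^ (n - 1 - j))" by simp
      also have "\<dots> = 0"
        using deg[of "n - i - 1" H] False i assms(4) by (intro sum0[OF refl]) (auto simp: n_def)
      finally show ?thesis .
    qed
    with eq i show "vec_index (map_mat h S *\<^sub>v v) i = vec_index (0\<^sub>v n) i" by simp
  qed (use S in simp)
  then have "Determinant.det (map_mat h S) = 0"
  proof -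
    have "v \<in> carrier_vec n" by (simp add: v_def)
    moreover have "map_mat h S \<in> carrier_mat n n" using S by simp
    ultimately show ?thesis
      using det_0_iff_vec_prod_zero[of "map_mat h S" n] \<open>map_mat h S *\<^sub>v v = 0\<^sub>v n\<close> v0 by blast
  qed
  then show ?thesis unfolding resultant_def S_def[symmetric] by simp
qed

lemma degree_fun_det_le:
  assumes \<delta>: "degree_fun \<delta>" and A: "A \<in> carrier_mat n n" "\<And>i j. i < n \<Longrightarrow> j < n \<Longrightarrow> \<delta> (A $$ (i,j)) \<le> N"
  shows "\<delta> (Determinant.det A) \<le> n * N"
  unfolding det_def'[OF A(1)]
proof (rule degree_fun_sum_le[OF \<delta>])
  fix p assume "p \<in> {p. p permutes {0..<n}}"
  then have p: "p permutes {0..<n}" by simp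
  have "\<delta> (signof p) = 0" using degree_fun_1[OF \<delta>] by (auto simp: sign_def)
  moreover have "\<delta> (\<Prod>i = 0..<n. A $$ (i, p i)) \<le> card {0..<n} * N"
    using p A(2) permutes_in_image[OF p] by (intro degree_fun_prod_le[OF \<delta>]) auto
  ultimately show "\<delta> (signof p * (\<Prod>i = 0..<n. A $$ (i, p i))) \<le> n * N"
    using degree_fun_mult_le[OF \<delta>, of "signof p" "\<Prod>i = 0..<n. A $$ (i, p i)"] by simp
qed

lemma degree_fun_resultant_le:
  assumes \<delta>: "degree_fun \<delta>" and "total_deg \<delta> F \<le> N" "total_deg \<delta> H \<le> N"
  shows "\<delta> (resultant F H) \<le> (degree F + degree H) * N"
  unfolding resultant_def
proof (rule degree_fun_det_le[OF \<delta> sylvester_carrier_mat])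
  fix i j assume "i < degree F + degree H" "j < degree F + degree H"
  moreover have "\<delta> (coeff F l) \<le> N" "\<delta> (coeff H l) \<le> N" for l
    using total_deg_coeff_le[OF \<delta>] assms(2,3) order_trans by blast+
  ultimately show "\<delta> (sylvester_mat F H $$ (i, j)) \<le> N"
    by (subst sylvester_index_mat) (auto simp: degree_fun_0[OF \<delta>])
qed

lemma resultant_neq_0:
  fixes F H :: "'r::{factorial_ring_gcd,semiring_gcd_mult_normalize} poly"
  assumes "irreducible F" "degree F > 0" "\<not> F dvd H"
  shows "resultant F H \<noteq> 0"
proof
  assume "resultant F H = 0"
  then have "degree (gcd F H) \<noteq> 0" by (simp add: resultant_0_gcd)
  then have "\<not> is_unit (gcd F H)" by (auto simp: is_unit_poly_iff)
  moreover obtain G where G: "F = gcd F H * G" using gcd_dvd1[of F H] by (elim dvdE)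
  ultimately have "is_unit G" using assms(1) irreducibleD by blast
  then have "F dvd gcd F H" using G by (metis dvd_mult_unit_iff dvd_refl)
  then show False using assms(3) by simp
qed

lemma poly_eq_0_if_infinite:
  fixes p :: "'k::idom poly"
  assumes "infinite U" "\<And>u. u \<in> U \<Longrightarrow> poly p u = 0" shows "p = 0"
proof (rule ccontr)
  assume "p \<noteq> 0"
  then have "finite {u. poly p u = 0}" by (rule poly_roots_finite)
  moreover have "U \<subseteq> {u. poly p u = 0}" using assms by auto
  ultimately show False using assms(1) finite_subset by blast
qed

definition rowev :: "'k::field \<times> 'k \<times> 'k \<Rightarrow> 'k poly poly poly \<Rightarrow> 'k poly" where
  "rowev = (\<lambda>(z, \<alpha>, \<beta>). ev [:0, 1:] [:z:] [:\<beta>, \<alpha>:])"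
definition colev :: "'k::field \<times> 'k \<times> 'k \<Rightarrow> 'k poly poly poly \<Rightarrow> 'k poly" where
  "colev = (\<lambda>(w, \<gamma>, \<delta>). ev [:w:] [:0, 1:] [:\<delta>, \<gamma>:])"

lemma comm_ring_hom_rowev: "comm_ring_hom (rowev q)"
  unfolding rowev_def by (cases q) (simp add: comm_ring_hom_ev)
lemma comm_ring_hom_colev: "comm_ring_hom (colev q)"
  unfolding colev_def by (cases q) (simp add: comm_ring_hom_ev)

interpretation rowev: comm_ring_hom "rowev q" for q by (rule comm_ring_hom_rowev)
interpretation colev: comm_ring_hom "colev q" for q by (rule comm_ring_hom_colev)

lemma degree_rowev_le: "degree (rowev q F) \<le> deg3 F"
  unfolding rowev_def by (cases q) (auto intro!: degree_ev_le)
lemma degree_colev_le: "degree (colev q F) \<le> deg3 F"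
  unfolding colev_def by (cases q) (auto intro!: degree_ev_le)

lemma poly_rowev: "poly (rowev (z, \<alpha>, \<beta>) F) w = pev w z (\<alpha> * w + \<beta>) F"
  by (simp add: rowev_def poly_ev algebra_simps)
lemma poly_colev: "poly (colev (w, \<gamma>, \<delta>) F) z = pev w z (\<gamma> * z + \<delta>) F"
  by (simp add: colev_def poly_ev algebra_simps)

lemma rowev_curv: "rowev q F = 0 \<Longrightarrow> rowev q (curv D\<^sub>w F) = 0"
proof (cases q)
  case (fields z \<alpha> \<beta>)
  assume "rowev q F = 0"
  then show ?thesis unfolding fields rowev_def prod.case
    by (intro ev_curv_eq_0[where \<sigma> = \<alpha>]) (auto simp: pderiv_ev pderiv_pCons)
qed
lemma colev_curv: "colev q F = 0 \<Longrightarrow> colev q (curv D\<^sub>z F) = 0"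
proof (cases q)
  case (fields z \<alpha> \<beta>)
  assume "colev q F = 0"
  then show ?thesis unfolding fields colev_def prod.case
    by (intro ev_curv_eq_0[where \<sigma> = \<alpha>]) (auto simp: pderiv_ev pderiv_pCons)
qed

lemma card_row_zeros_le:
  fixes \<rho> :: "'k::field poly poly"
  assumes "\<rho> \<noteq> 0" "finite X" "inj_on fst X"
  shows "card {q \<in> X. ev2 [:0, 1:] [:fst q:] \<rho> = 0} \<le> deg2 \<rho>"
proof -
  let ?S = "{q \<in> X. ev2 [:0, 1:] [:fst q:] \<rho> = 0}"
  have ev: "ev2 [:0, 1:] [:z:] \<rho> = poly \<rho> [:z:]" for z
    unfolding ev2_def by (simp only: pcompose_idR map_poly_idI)
  have "card ?S = card ((\<lambda>q. [:fst q:]) ` ?S)"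
    using assms(3) by (intro card_image[symmetric]) (auto simp: inj_on_def)
  also have "\<dots> \<le> card {x. poly \<rho> x = 0}"
    unfolding ev using assms by (intro card_mono poly_roots_finite) auto
  also have "\<dots> \<le> degree \<rho>" using assms(1) by (rule card_poly_roots_bound)
  also have "\<dots> \<le> deg2 \<rho>" by (rule degree_le_total_deg)
  finally show ?thesis .
qed

text \<open>A polynomial in w and z that vanishes on a whole line of constant w has all its
  z-coefficients vanishing there. The leading one is a nonzero polynomial in w, and its roots bound
  the number of columns.\<close>

lemma card_col_zeros_le:
  fixes \<rho> :: "'k::field poly poly"
  assumes inf: "infinite (UNIV :: 'k set)" and "\<rho> \<noteq> 0" "finite X" "inj_on fst X"
  shows "card {q \<in> X. ev2 [:fst q:] [:0, 1:] \<rho> = 0} \<le> deg2 \<rho>"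
proof -
  let ?S = "{q \<in> X. ev2 [:fst q:] [:0, 1:] \<rho> = 0}"
  define d where "d = lead_coeff \<rho>"
  have d: "d \<noteq> 0" using assms by (simp add: d_def)
  have ev: "poly d w = 0" if "ev2 [:w:] [:0, 1:] \<rho> = 0" for w
  proof -
    have "map_poly (\<lambda>d. poly d w) \<rho> = 0"
    proof (rule poly_eq_0_if_infinite[OF inf])
      fix u
      show "poly (map_poly (\<lambda>d. poly d w) \<rho>) u = 0"
        using poly_ev2[of "[:w:]" "[:0,1:]" \<rho> u] that by (simp add: pev2_def)
    qed
    then have "coeff (map_poly (\<lambda>d. poly d w) \<rho>) (degree \<rho>) = 0" by simp
    then show ?thesis by (simp add: coeff_map_poly d_def)
  qed
  have "card ?S = card (fst ` ?S)"
    using assms(4) by (intro card_image[symmetric]) (auto simp: inj_on_def)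
  also have "\<dots> \<le> card {x. poly d x = 0}"
    by (intro card_mono poly_roots_finite d) (blast intro: ev)
  also have "\<dots> \<le> degree d" using d by (rule card_poly_roots_bound)
  also have "\<dots> \<le> deg1 d" by (rule degree_le_total_deg)
  also have "\<dots> \<le> deg2 \<rho>" unfolding d_def by (rule total_deg_coeff_le) simp
  finally show ?thesis .
qed

text \<open>Eliminating t projects the common lines into a plane curve. The factor 12 is 4 * 3: the
  Sylvester matrix has at most 4 \<open>deg3 F\<close> rows, with entries of degree at most 3
  \<open>deg3 F\<close>. The bound on \<open>H\<close> is chosen so that \<open>curv\<close> fits,
  which is cubic in the derivatives of \<open>F\<close>.\<close>

lemma common_lines_resultant:
  fixes F H :: "'k::field_gcd poly poly poly"
  assumes F: "irreducible F" "degree F > 0" "\<not> F dvd H" and H: "deg3 H \<le> 3 * deg3 F"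
  obtains \<rho> where "\<rho> \<noteq> 0" "deg2 \<rho> \<le> 12 * (deg3 F)\<^sup>2"
    "\<And>W Z T. ev W Z T F = 0 \<Longrightarrow> ev W Z T H = 0 \<Longrightarrow> ev2 W Z \<rho> = 0"
proof
  show "resultant F H \<noteq> 0" using F by (rule resultant_neq_0)
  have "deg2 (resultant F H) \<le> (degree F + degree H) * (3 * deg3 F)"
    using H by (intro degree_fun_resultant_le) auto
  also have "\<dots> \<le> (4 * deg3 F) * (3 * deg3 F)"
    using degree_le_total_deg[of F deg2] degree_le_total_deg[of H deg2] H by (intro mult_right_mono) auto
  finally show "deg2 (resultant F H) \<le> 12 * (deg3 F)\<^sup>2" by (simp add: power2_eq_square)
  show "ev2 W Z (resultant F H) = 0" if "ev W Z T F = 0" "ev W Z T H = 0" for W Z T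
    using hom_resultant_eq_0[OF comm_ring_hom_ev2 F(2)] that unfolding ev_def by blast
qed

lemma card_rows_le:
  fixes F H :: "'k::field_gcd poly poly poly"
  assumes "irreducible F" "degree F > 0" "\<not> F dvd H" "deg3 H \<le> 3 * deg3 F" "finite X" "inj_on fst X"
  shows "card {q \<in> X. rowev q F = 0 \<and> rowev q H = 0} \<le> 12 * (deg3 F)\<^sup>2"
proof -
  obtain \<rho> where \<rho>: "\<rho> \<noteq> 0" "deg2 \<rho> \<le> 12 * (deg3 F)\<^sup>2"
    "\<And>W Z T. ev W Z T F = 0 \<Longrightarrow> ev W Z T H = 0 \<Longrightarrow> ev2 W Z \<rho> = 0"
    using common_lines_resultant assms(1-4) by metis
  have "card {q \<in> X. rowev q F = 0 \<and> rowev q H = 0} \<le> card {q \<in> X. ev2 [:0, 1:] [:fst q:] \<rho> = 0}"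
    using assms(5) by (intro card_mono) (auto simp: rowev_def intro: \<rho>(3))
  also have "\<dots> \<le> deg2 \<rho>" by (rule card_row_zeros_le) (use \<rho> assms in auto)
  finally show ?thesis using \<rho>(2) by simp
qed

lemma card_cols_le:
  fixes F H :: "'k::field_gcd poly poly poly"
  assumes "infinite (UNIV :: 'k set)"
    "irreducible F" "degree F > 0" "\<not> F dvd H" "deg3 H \<le> 3 * deg3 F" "finite X" "inj_on fst X"
  shows "card {q \<in> X. colev q F = 0 \<and> colev q H = 0} \<le> 12 * (deg3 F)\<^sup>2"
proof -
  obtain \<rho> where \<rho>: "\<rho> \<noteq> 0" "deg2 \<rho> \<le> 12 * (deg3 F)\<^sup>2"
    "\<And>W Z T. ev W Z T F = 0 \<Longrightarrow> ev W Z T H = 0 \<Longrightarrow> ev2 W Z \<rho> = 0"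
    using common_lines_resultant assms(2-5) by metis
  have "card {q \<in> X. colev q F = 0 \<and> colev q H = 0} \<le> card {q \<in> X. ev2 [:fst q:] [:0, 1:] \<rho> = 0}"
    using assms(6) by (intro card_mono) (auto simp: colev_def intro: \<rho>(3))
  also have "\<dots> \<le> deg2 \<rho>" by (rule card_col_zeros_le) (use \<rho> assms in auto)
  finally show ?thesis using \<rho>(2) by simp
qed

subsection \<open>Surfaces that are flat in both directions\<close>

lemma flat_row_through_point:
  fixes F :: "'k::field poly poly poly"
  assumes "F dvd curv D\<^sub>w F" "pev w0 z0 t0 F = 0" "pev w0 z0 t0 (D\<^sub>t F) \<noteq> 0"
    and char: "\<And>n. 0 < n \<Longrightarrow> n \<le> deg3 F \<Longrightarrow> (of_nat n :: 'k) \<noteq> 0"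
  shows "pev w z0 (t0 - pev w0 z0 t0 (D\<^sub>w F) / pev w0 z0 t0 (D\<^sub>t F) * (w - w0)) F = 0"
proof -
  define b where "b = - pev w0 z0 t0 (D\<^sub>w F) / pev w0 z0 t0 (D\<^sub>t F)"
  have "ev [:w0, 1:] [:z0:] [:t0, b:] F = 0"
  proof (rule flat_line[where D = D\<^sub>w and \<sigma> = b])
    show "pderiv (ev [:w0, 1:] [:z0:] [:t0, b:] G) =
       ev [:w0, 1:] [:z0:] [:t0, b:] (D\<^sub>w G) + [:b:] * ev [:w0, 1:] [:z0:] [:t0, b:] (D\<^sub>t G)" for G
      by (simp add: pderiv_ev pderiv_pCons)
    have "degree (ev [:w0, 1:] [:z0:] [:t0, b:] F) \<le> deg3 F" by (rule degree_ev_le) auto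
    then show "(of_nat n :: 'k) \<noteq> 0" if "0 < n" "n \<le> degree (ev [:w0, 1:] [:z0:] [:t0, b:] F)" for n
      using char that by simp
  qed (use assms in \<open>auto simp: poly_ev b_def\<close>)
  then have "poly (ev [:w0, 1:] [:z0:] [:t0, b:] F) (w - w0) = 0" by simp
  then show ?thesis by (simp add: poly_ev b_def mult.commute)
qed

lemma flat_col_through_point:
  fixes F :: "'k::field poly poly poly"
  assumes "F dvd curv D\<^sub>z F" "pev w0 z0 t0 F = 0" "pev w0 z0 t0 (D\<^sub>t F) \<noteq> 0"
    and char: "\<And>n. 0 < n \<Longrightarrow> n \<le> deg3 F \<Longrightarrow> (of_nat n :: 'k) \<noteq> 0"
  shows "pev w0 z (t0 - pev w0 z0 t0 (D\<^sub>z F) / pev w0 z0 t0 (D\<^sub>t F) * (z - z0)) F = 0"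
proof -
  define b where "b = - pev w0 z0 t0 (D\<^sub>z F) / pev w0 z0 t0 (D\<^sub>t F)"
  have "ev [:w0:] [:z0, 1:] [:t0, b:] F = 0"
  proof (rule flat_line[where D = D\<^sub>z and \<sigma> = b])
    show "pderiv (ev [:w0:] [:z0, 1:] [:t0, b:] G) =
       ev [:w0:] [:z0, 1:] [:t0, b:] (D\<^sub>z G) + [:b:] * ev [:w0:] [:z0, 1:] [:t0, b:] (D\<^sub>t G)" for G
      by (simp add: pderiv_ev pderiv_pCons)
    have "degree (ev [:w0:] [:z0, 1:] [:t0, b:] F) \<le> deg3 F" by (rule degree_ev_le) auto
    then show "(of_nat n :: 'k) \<noteq> 0" if "0 < n" "n \<le> degree (ev [:w0:] [:z0, 1:] [:t0, b:] F)" for n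
      using char that by simp
  qed (use assms in \<open>auto simp: poly_ev b_def\<close>)
  then have "poly (ev [:w0:] [:z0, 1:] [:t0, b:] F) (z - z0) = 0" by simp
  then show ?thesis by (simp add: poly_ev b_def mult.commute)
qed

text \<open>The tangent row at the given point lies in the surface, and so does the tangent column
  through each regular point of that row. These columns sweep out a surface whose equation has
  degree 1 in t and in z; irreducibility makes \<open>F\<close> a factor of it. Flatness of the rows
  then gives degree 1 in w.\<close>

lemma flat_surface_bilinear:
  fixes F :: "'k::field_gcd poly poly poly"
  assumes inf: "infinite (UNIV :: 'k set)" and irr: "irreducible F"
    and flat: "F dvd curv D\<^sub>w F" "F dvd curv D\<^sub>z F"
    and pt: "pev w0 z0 t0 F = 0" "pev w0 z0 t0 (D\<^sub>t F) \<noteq> 0"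
    and char: "\<And>n. 0 < n \<Longrightarrow> n \<le> deg3 F \<Longrightarrow> (of_nat n :: 'k) \<noteq> 0"
  obtains \<kappa> a b c d where "\<kappa> \<noteq> 0" "F = [:[:[:\<kappa>:]:]:] * [: - [:[:a, b:], [:c, d:]:], 1:]"
proof -
  note row = flat_row_through_point[OF flat(1) _ _ char] and col = flat_col_through_point[OF flat(2) _ _ char]
  have degF: "degree F > 0" using pt(2) by (cases "degree F = 0") (auto elim!: degree_eq_zeroE simp: pderiv_pCons)
  define b0 where "b0 = - pev w0 z0 t0 (D\<^sub>w F) / pev w0 z0 t0 (D\<^sub>t F)"
  define T where "T = [:t0 - b0 * w0, b0:]"
  define Q where "Q = ev [:0, 1:] [:z0:] T (D\<^sub>t F)"
  define P where "P = - ev [:0, 1:] [:z0:] T (D\<^sub>z F)"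
  have T: "poly T w = t0 + b0 * (w - w0)" for w by (simp add: T_def algebra_simps)
  have Fr: "pev w z0 (poly T w) F = 0" for w
    using row[OF pt, of w] unfolding T b0_def by simp
  have Qw: "poly Q w = pev w z0 (poly T w) (D\<^sub>t F)" and Pw: "poly P w = - pev w z0 (poly T w) (D\<^sub>z F)" for w
    by (simp_all add: Q_def P_def poly_ev)
  have "poly Q w0 \<noteq> 0" using pt(2) by (simp add: Qw T)
  then have Q0: "Q \<noteq> 0" by auto
  have infQ: "infinite {w. poly Q w \<noteq> 0}"
  proof
    assume "finite {w. poly Q w \<noteq> 0}"
    then have "finite ({w. poly Q w \<noteq> 0} \<union> {w. poly Q w = 0})" using poly_roots_finite[OF Q0] by blast
    moreover have "{w. poly Q w \<noteq> 0} \<union> {w. poly Q w = 0} = UNIV" by auto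
    ultimately show False using inf by simp
  qed
  have sec: "pev w z (poly T w + poly P w / poly Q w * (z - z0)) F = 0" if "poly Q w \<noteq> 0" for w z
    using col[OF Fr, of w z] that unfolding Qw Pw by simp
  \<comment> \<open>The column over w has slope P(w)/Q(w) and starts on the row at height T(w).
    \<open>G\<close> is its equation Q (t - T) - P (z - z0), with the denominator cleared.\<close>
  define G where "G = [: - [: Q * T - P * [:z0:], P :], [:Q:] :]"
  have pevG: "pev w z t G = poly Q w * (t - poly T w) - poly P w * (z - z0)" for w z t
    by (simp add: G_def pev_pCons pev2_pCons pev2.hom_uminus algebra_simps del: minus_pCons)
  have "F dvd G"
  proof (rule ccontr)
    assume "\<not> F dvd G"
    \<comment> \<open>The columns give common zeros of \<open>F\<close> and \<open>G\<close> over
      all (w, z) with Q(w) nonzero. Over an infinite field this forces the resultant to vanish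
      identically.\<close>
    define \<rho> where "\<rho> = resultant F G"
    have "\<rho> \<noteq> 0" unfolding \<rho>_def using irr degF \<open>\<not> F dvd G\<close> by (rule resultant_neq_0)
    have z: "pev2 w z \<rho> = 0" if "poly Q w \<noteq> 0" for w z
      unfolding \<rho>_def
      by (rule hom_resultant_eq_0[OF comm_ring_hom_pev2 degF, where T = "poly T w + poly P w / poly Q w * (z - z0)"])
         (use sec[OF that] pevG that in \<open>auto simp: pev_def\<close>)
    have z': "poly (coeff \<rho> i) w = 0" if "poly Q w \<noteq> 0" for w i
    proof -
      have "map_poly (\<lambda>d. poly d w) \<rho> = 0"
        by (rule poly_eq_0_if_infinite[OF inf]) (use z[OF that] in \<open>simp add: pev2_def\<close>)
      then have "coeff (map_poly (\<lambda>d. poly d w) \<rho>) i = 0" by simp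
      then show ?thesis by (simp add: coeff_map_poly)
    qed
    have "coeff \<rho> i = 0" for i
      by (rule poly_eq_0_if_infinite[OF infQ]) (use z' in auto)
    then have "\<rho> = 0" by (simp add: poly_eq_iff)
    with \<open>\<rho> \<noteq> 0\<close> show False by simp
  qed
  then obtain k where k: "G = F * k" by (rule dvdE)
  have "degree G = 1" using Q0 by (simp add: G_def)
  moreover have "G \<noteq> 0" using Q0 by (simp add: G_def)
  ultimately have "degree F + degree k = 1" using degree_mult_eq[of F k] k by auto
  then have dF: "degree F = 1" and "degree k = 0" using degF by auto
  then obtain k1 where k1: "k = [:k1:]" by (auto elim: degree_eq_zeroE)
  obtain f0 f1 where F: "F = [:f0, f1:]" using dF
    by (metis One_nat_def degree_eq_zeroE degree_pCons_eq_if nat.inject pCons_cases zero_neq_one degree_0)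
  have f1: "f1 * k1 = [:Q:]" and f0: "f0 * k1 = - [: Q * T - P * [:z0:], P :]"
    using k unfolding G_def F k1 by (auto simp: mult.commute)
  have k10: "k1 \<noteq> 0" and f10: "f1 \<noteq> 0" using f1 Q0 by auto
  have "degree f1 + degree k1 = 0" using degree_mult_eq[OF f10 k10] f1 by simp
  then obtain g where g: "f1 = [:g:]" by (auto elim: degree_eq_zeroE)
  have g0: "g \<noteq> 0" using f10 g by simp
  have "degree f0 \<le> 1"
  proof (cases "f0 = 0")
    case False
    have "degree f0 + degree k1 = degree (- [: Q * T - P * [:z0:], P :])"
      using degree_mult_eq[OF False k10] f0 by simp
    also have "\<dots> = degree [: Q * T - P * [:z0:], P :]" by (rule degree_minus)
    also have "\<dots> \<le> 1" by simp
    finally show ?thesis by simp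
  qed simp
  then obtain e0 e1 where f0e: "f0 = [:e0, e1:]"
    by (metis One_nat_def degree_eq_zeroE degree_pCons_eq_if le_Suc_eq le_zero_eq nat.inject pCons_cases pCons_0_0)
  have pevF: "pev w z t F = poly e0 w + z * poly e1 w + t * poly g w" for w z t
    by (simp add: F f0e g pev_pCons pev2_pCons)
  have pevFt: "pev w z t (D\<^sub>t F) = poly g w" for w z t
    by (simp add: F g pev_pCons pev2_pCons pderiv_pCons)
  obtain w1 where w1: "poly g w1 \<noteq> 0" using poly_eq_0_if_infinite[OF inf, of g] g0 by blast
  \<comment> \<open>Now F = e0 + z e1 + t g with e0, e1, g in k[w]. For each z the surface contains
    a full row, through the point over w1, whose height is affine in w. Hence g divides e0 + z e1
    with a quotient of degree at most 1, and the values z = 0 and z = 1 settle both e0 and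
    e1.\<close>
  have lin: "\<exists>l0 l1. e0 + smult z e1 = - ([:l0, l1:] * g)" for z
  proof -
    define t1 where "t1 = - (poly e0 w1 + z * poly e1 w1) / poly g w1"
    have "pev w1 z t1 F = 0" using w1 by (simp add: pevF t1_def)
    moreover have "pev w1 z t1 (D\<^sub>t F) \<noteq> 0" using w1 by (simp add: pevFt)
    ultimately have r: "pev w z (t1 - pev w1 z t1 (D\<^sub>w F) / pev w1 z t1 (D\<^sub>t F) * (w - w1)) F = 0" for w
      by (rule row)
    define l1 where "l1 = - pev w1 z t1 (D\<^sub>w F) / pev w1 z t1 (D\<^sub>t F)"
    have r': "pev w z (t1 - l1 * w1 + l1 * w) F = 0" for w
      using r[of w] by (simp add: l1_def algebra_simps diff_divide_distrib)
    have "e0 + smult z e1 + [:t1 - l1 * w1, l1:] * g = 0"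
    proof (rule poly_eq_0_if_infinite[OF inf])
      fix w
      show "poly (e0 + smult z e1 + [:t1 - l1 * w1, l1:] * g) w = 0"
        using r'[of w] unfolding pevF by (simp add: algebra_simps)
    qed
    then show ?thesis using eq_neg_iff_add_eq_0 by blast
  qed
  obtain a b where ab: "e0 = - ([:a, b:] * g)" using lin[of 0] by auto
  obtain a' b' where ab': "e0 + e1 = - ([:a', b':] * g)" using lin[of 1] by auto
  define c d where "c = a' - a" and "d = b' - b"
  have "e1 = - ([:a', b':] * g) - e0" using ab' by (simp add: eq_diff_eq add.commute)
  also have "\<dots> = - (([:a', b':] - [:a, b:]) * g)" unfolding ab left_diff_distrib
    by (simp only: diff_minus_eq_add minus_diff_eq uminus_add_conv_diff)
  also have "[:a', b':] - [:a, b:] = [:c, d:]" by (simp add: c_def d_def)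
  finally have e1: "e1 = - ([:c, d:] * g)" .
  have Feq: "F = [:[:g:]:] * [: - [:[:a, b:], [:c, d:]:], 1:]"
    unfolding F f0e g ab e1 by (simp add: mult.commute)
  \<comment> \<open>The factor g splits off from \<open>F\<close>, so irreducibility makes it a
    constant.\<close>
  have "\<not> is_unit [: - [:[:a, b:], [:c, d:]:], 1:]"
    by (auto simp: is_unit_poly_iff)
  then have "is_unit [:[:g:]:]" using irreducibleD[OF irr Feq] by blast
  then have "degree g = 0" by (auto simp: is_unit_poly_iff is_unit_const_poly_iff)
  then obtain \<kappa> where "g = [:\<kappa>:]" by (rule degree_eq_zeroE)
  moreover then have "\<kappa> \<noteq> 0" using g0 by simp
  ultimately show ?thesis using that Feq by blast
qed

text \<open>Every row inside the surface also lies on \<open>curv D\<^sub>w F = 0\<close>, and every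
  column on \<open>curv D\<^sub>z F = 0\<close>. If \<open>F\<close> does not divide one of these,
  the resultant bounds the lines of that kind; otherwise the surface is flat in both directions. A
  polynomial without t is a cylinder, treated directly.\<close>

lemma irreducible_surface_cases:
  fixes F :: "'k::field_gcd poly poly poly"
  assumes inf: "infinite (UNIV :: 'k set)" and irr: "irreducible F"
    and char: "\<And>n. 0 < n \<Longrightarrow> n \<le> deg3 F \<Longrightarrow> (of_nat n :: 'k) \<noteq> 0"
    and X: "finite X" "inj_on fst X" and Y: "finite Y" "inj_on fst Y"
  obtains (rows) "card {q \<in> X. rowev q F = 0} \<le> 12 * (deg3 F)\<^sup>2"
    | (cols) "card {q \<in> Y. colev q F = 0} \<le> 12 * (deg3 F)\<^sup>2"
    | (bilinear) \<kappa> a b c d where "\<kappa> \<noteq> 0" "F = [:[:[:\<kappa>:]:]:] * [: - [:[:a, b:], [:c, d:]:], 1:]"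
proof (cases "degree F = 0")
  case True
  then obtain \<rho> where \<rho>: "F = [:\<rho>:]" by (rule degree_eq_zeroE)
  have "\<rho> \<noteq> 0" using irr \<rho> by auto
  have "card {q \<in> X. rowev q F = 0} \<le> card {q \<in> X. ev2 [:0, 1:] [:fst q:] \<rho> = 0}"
    using X by (intro card_mono) (auto simp: rowev_def \<rho> ev_pCons)
  also have "\<dots> \<le> deg2 \<rho>" by (rule card_row_zeros_le[OF \<open>\<rho> \<noteq> 0\<close> X])
  also have "\<dots> \<le> deg3 F" using total_deg_coeff_le[of deg2 F 0] \<rho> by simp
  also have "\<dots> \<le> 12 * (deg3 F)\<^sup>2" by (simp add: power2_eq_square)
  finally show ?thesis by (rule rows)
next
  case False
  then have degF: "degree F > 0" by simp
  have "D\<^sub>t F \<noteq> 0"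
  proof
    assume "D\<^sub>t F = 0"
    then have "coeff (D\<^sub>t F) (degree F - 1) = 0" by simp
    then have "of_nat (degree F) * lead_coeff F = 0" using degF by (simp add: coeff_pderiv del: of_nat_Suc)
    moreover have "(of_nat (degree F) :: 'k) \<noteq> 0" using char degF degree_le_total_deg by blast
    then have "(of_nat (degree F) :: 'k poly poly) \<noteq> 0"
      by (simp add: of_nat_poly)
    ultimately show False using irr by auto
  qed
  then have nd: "\<not> F dvd D\<^sub>t F" using degF degree_pderiv_le[of F] dvd_imp_degree_le[of F "D\<^sub>t F"] by force
  show ?thesis
  proof (cases "F dvd curv D\<^sub>w F")
    case False
    have "card {q \<in> X. rowev q F = 0 \<and> rowev q (curv D\<^sub>w F) = 0} \<le> 12 * (deg3 F)\<^sup>2"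
      using irr degF False deg3_curv_le[OF deg3_deriv_le(1)] X by (rule card_rows_le)
    moreover have "{q \<in> X. rowev q F = 0 \<and> rowev q (curv D\<^sub>w F) = 0} = {q \<in> X. rowev q F = 0}"
      using rowev_curv by blast
    ultimately show ?thesis by (intro rows) simp
  next
    case dw: True
    show ?thesis
    proof (cases "F dvd curv D\<^sub>z F")
      case False
      have "card {q \<in> Y. colev q F = 0 \<and> colev q (curv D\<^sub>z F) = 0} \<le> 12 * (deg3 F)\<^sup>2"
        using inf irr degF False deg3_curv_le[OF deg3_deriv_le(2)] Y by (rule card_cols_le)
      moreover have "{q \<in> Y. colev q F = 0 \<and> colev q (curv D\<^sub>z F) = 0} = {q \<in> Y. colev q F = 0}"
        using colev_curv by blast
      ultimately show ?thesis by (intro cols) simp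
    next
      case dz: True
      show ?thesis
      \<comment> \<open>Flatness needs a starting point with nonzero t-derivative. If no row
        supplies one, all rows lie on both \<open>F\<close> and \<open>D\<^sub>t F\<close>, and the
        resultant bounds their number.\<close>
      proof (cases "\<forall>q\<in>X. rowev q F = 0 \<longrightarrow> rowev q (D\<^sub>t F) = 0")
        case True
        have "deg3 (D\<^sub>t F) \<le> 3 * deg3 F" using deg3_deriv_le(3)[of F] by simp
        then have "card {q \<in> X. rowev q F = 0 \<and> rowev q (D\<^sub>t F) = 0} \<le> 12 * (deg3 F)\<^sup>2"
          using irr degF nd X by (intro card_rows_le)
        moreover have "{q \<in> X. rowev q F = 0 \<and> rowev q (D\<^sub>t F) = 0} = {q \<in> X. rowev q F = 0}"
          using True by blast
        ultimately show ?thesis by (intro rows) simp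
      next
        case False
        then obtain z \<alpha> \<beta> where q: "rowev (z, \<alpha>, \<beta>) F = 0" "rowev (z, \<alpha>, \<beta>) (D\<^sub>t F) \<noteq> 0" by auto
        then obtain w where "poly (rowev (z, \<alpha>, \<beta>) (D\<^sub>t F)) w \<noteq> 0"
          using poly_eq_0_if_infinite[OF inf] by blast
        then have "pev w z (\<alpha> * w + \<beta>) F = 0" "pev w z (\<alpha> * w + \<beta>) (D\<^sub>t F) \<noteq> 0"
          using q by (auto simp flip: poly_rowev)
        then show ?thesis using flat_surface_bilinear[OF inf irr dw dz _ _ char] bilinear by metis
      qed
    qed
  qed
qed

section \<open>Incidences between points and planes\<close>

lemma linear_system_nontrivial:
  fixes A :: "'e \<Rightarrow> 's \<Rightarrow> 'k::field"
  assumes "finite E" "finite S" "card E < card S"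
  shows "\<exists>x. (\<exists>s\<in>S. x s \<noteq> 0) \<and> (\<forall>e\<in>E. (\<Sum>s\<in>S. A e s * x s) = 0)"
  using assms
proof (induction E arbitrary: S A rule: finite_induct)
  case empty
  then obtain s where "s \<in> S" by fastforce
  then show ?case by (intro exI[of _ "\<lambda>_. 1"]) auto
next
  case (insert e E)
  show ?case
  proof (cases "\<forall>s\<in>S. A e s = 0")
    case True
    have "card E < card S" using insert by simp
    then obtain x where "\<exists>s\<in>S. x s \<noteq> 0" "\<forall>e\<in>E. (\<Sum>s\<in>S. A e s * x s) = 0"
      using insert.IH[of S A] insert.prems by blast
    then show ?thesis using True by (intro exI[of _ x]) auto
  next
    case False
    then obtain s0 where s0: "s0 \<in> S" "A e s0 \<noteq> 0" by auto
    define S' where "S' = S - {s0}"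
    define A' where "A' = (\<lambda>e' s. A e' s - A e' s0 * A e s / A e s0)"
    have "finite S'" "card E < card S'" using insert s0 by (auto simp: S'_def)
    then obtain x where x: "\<exists>s\<in>S'. x s \<noteq> 0" "\<And>e'. e' \<in> E \<Longrightarrow> (\<Sum>s\<in>S'. A' e' s * x s) = 0"
      using insert.IH[of S' A'] by blast
    define y where "y = (\<Sum>s\<in>S'. A e s * x s)"
    define x' where "x' = x(s0 := - y / A e s0)"
    have split: "(\<Sum>s\<in>S. A e' s * x' s) = (\<Sum>s\<in>S'. A e' s * x s) - A e' s0 * y / A e s0" for e'
    proof -
      have "(\<Sum>s\<in>S. A e' s * x' s) = A e' s0 * x' s0 + (\<Sum>s\<in>S'. A e' s * x' s)"
        unfolding S'_def using s0 insert.prems by (intro sum.remove) auto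
      also have "(\<Sum>s\<in>S'. A e' s * x' s) = (\<Sum>s\<in>S'. A e' s * x s)"
        by (rule sum.cong) (auto simp: x'_def S'_def)
      finally show ?thesis by (simp add: x'_def)
    qed
    have "(\<Sum>s\<in>S. A e' s * x' s) = 0" if "e' \<in> E" for e'
    proof -
      have "0 = (\<Sum>s\<in>S'. A e' s * x s - A e' s0 / A e s0 * (A e s * x s))"
        using x(2)[OF that] by (simp add: A'_def algebra_simps)
      also have "\<dots> = (\<Sum>s\<in>S'. A e' s * x s) - A e' s0 * y / A e s0"
        by (simp add: sum_subtractf sum_distrib_left sum_divide_distrib y_def mult.assoc)
      finally show ?thesis unfolding split ..
    qed
    moreover have "(\<Sum>s\<in>S. A e s * x' s) = 0" unfolding split using s0 by (simp add: y_def)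
    moreover have "\<exists>s\<in>S. x' s \<noteq> 0" using x(1) by (auto simp: x'_def S'_def)
    ultimately show ?thesis by (intro exI[of _ x']) auto
  qed
qed

lemma total_deg_monom_le: "total_deg \<delta> (monom c n) \<le> \<delta> c + n"
  unfolding total_deg_le_iff by (auto split: if_splits)

text \<open>Polynomials of degree at most D in each variable have (D + 1)^3 coefficients and total
  degree at most 3 D. Vanishing on one column therefore amounts to 3 D + 1 linear
  conditions.\<close>

lemma surface_through_columns:
  fixes Y :: "('k::field \<times> 'k \<times> 'k) set"
  assumes "finite Y" "card Y * (3 * D + 1) < (D + 1) ^ 3"
  obtains F where "F \<noteq> 0" "deg3 F \<le> 3 * D" "\<And>m. m \<in> Y \<Longrightarrow> colev m F = 0"
proof -
  define S where "S = {..D} \<times> {..D} \<times> {..D}"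
  define E where "E = Y \<times> {..3 * D}"
  define mon :: "'k \<Rightarrow> nat \<times> nat \<times> nat \<Rightarrow> 'k poly poly poly" where
    "mon = (\<lambda>c (i, j, l). monom (monom (monom c l) j) i)"
  have mon: "mon c s = [:[:[:c:]:]:] * mon 1 s" for c s
    by (cases s) (simp add: mon_def smult_monom)
  have "card E < card S" using assms(2)
    by (simp add: E_def S_def card_cartesian_product eval_nat_numeral algebra_simps)
  moreover have "finite E" "finite S" using assms by (auto simp: E_def S_def)
  ultimately obtain x where x: "\<exists>s\<in>S. x s \<noteq> 0"
    "\<And>e. e \<in> E \<Longrightarrow> (\<Sum>s\<in>S. coeff (colev (fst e) (mon 1 s)) (snd e) * x s) = 0"
    using linear_system_nontrivial[of E S "\<lambda>e s. coeff (colev (fst e) (mon 1 s)) (snd e)"] by blast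
  define F where "F = (\<Sum>s\<in>S. mon (x s) s)"
  show ?thesis
  proof
    show deg: "deg3 F \<le> 3 * D" unfolding F_def
    proof (rule degree_fun_sum_le[OF degree_fun_deg3])
      fix s assume s: "s \<in> S"
      obtain i j l where ijl: "s = (i, j, l)" by (cases s)
      have "deg3 (mon (x s) s) \<le> deg2 (monom (monom (x s) l) j) + i"
        unfolding ijl mon_def by (simp add: total_deg_monom_le)
      also have "deg2 (monom (monom (x s) l) j) \<le> deg1 (monom (x s) l) + j" by (rule total_deg_monom_le)
      also have "deg1 (monom (x s) l) \<le> 0 + l" by (rule total_deg_monom_le)
      finally show "deg3 (mon (x s) s) \<le> 3 * D" using s by (auto simp: ijl S_def)
    qed
    obtain i j l where ijl: "(i, j, l) \<in> S" "x (i, j, l) \<noteq> 0" using x(1) by auto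
    have "coeff (coeff (coeff F i) j) l = (\<Sum>s\<in>S. coeff (coeff (coeff (mon (x s) s) i) j) l)"
      unfolding F_def by (simp add: coeff_sum)
    also have "\<dots> = (\<Sum>s\<in>S. if s = (i, j, l) then x s else 0)"
      by (rule sum.cong) (auto simp: mon_def split: if_splits)
    also have "\<dots> = x (i, j, l)" using ijl \<open>finite S\<close> by simp
    finally show "F \<noteq> 0" using ijl by auto
    fix m assume m: "m \<in> Y"
    have const: "colev m [:[:[:c:]:]:] = [:c:]" for c
      by (cases m) (simp add: colev_def ev_pCons ev2_pCons)
    have "colev m F = (\<Sum>s\<in>S. [:x s:] * colev m (mon 1 s))"
      unfolding F_def colev.hom_sum
      by (rule sum.cong[OF refl]) (subst mon, simp only: colev.hom_mult const)
    then have "coeff (colev m F) n = (\<Sum>s\<in>S. coeff (colev m (mon 1 s)) n * x s)" for n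
      by (simp add: coeff_sum mult.commute)
    then have "coeff (colev m F) n = 0" if "n \<le> 3 * D" for n
      using x(2)[of "(m, n)"] m that by (simp add: E_def)
    moreover have "coeff (colev m F) n = 0" if "n > 3 * D" for n
      using that degree_colev_le[of m F] deg by (intro coeff_eq_0) linarith
    ultimately show "colev m F = 0" by (metis leading_coeff_0_iff not_le)
  qed
qed

lemma card_pairs_le_snd:
  assumes "finite Y" "S \<subseteq> X \<times> Y" "\<And>r. r \<in> Y \<Longrightarrow> card {q. (q, r) \<in> S} \<le> k" "finite X"
  shows "card S \<le> k * card Y"
proof -
  have S: "S = (\<Union>r\<in>Y. (\<lambda>q. (q, r)) ` {q. (q, r) \<in> S})" using assms(2) by auto
  have "card S \<le> (\<Sum>r\<in>Y. card ((\<lambda>q. (q, r)) ` {q. (q, r) \<in> S}))"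
    by (subst S) (rule card_UN_le[OF assms(1)])
  also have "\<dots> \<le> (\<Sum>r\<in>Y. k)"
  proof (rule sum_mono)
    fix r assume "r \<in> Y"
    have "finite {q. (q, r) \<in> S}" by (rule finite_subset[OF _ assms(4)]) (use assms(2) in auto)
    then show "card ((\<lambda>q. (q, r)) ` {q. (q, r) \<in> S}) \<le> k"
      using card_image_le assms(3)[OF \<open>r \<in> Y\<close>] le_trans by blast
  qed
  finally show ?thesis by (simp add: mult.commute)
qed

lemma card_pairs_le_fst:
  assumes "finite X" "S \<subseteq> X \<times> Y" "\<And>q. q \<in> X \<Longrightarrow> card {r. (q, r) \<in> S} \<le> k" "finite Y"
  shows "card S \<le> k * card X"
proof -
  have "card S = card (prod.swap ` S)" by (rule card_image[symmetric]) (force simp: inj_on_def)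
  also have "\<dots> \<le> k * card X"
  proof (rule card_pairs_le_snd)
    show "prod.swap ` S \<subseteq> Y \<times> X" using assms(2) by auto
    show "card {r. (r, q) \<in> prod.swap ` S} \<le> k" if "q \<in> X" for q
    proof -
      have "{r. (r, q) \<in> prod.swap ` S} = {r. (q, r) \<in> S}" by force
      then show ?thesis using assms(3)[OF that] by simp
    qed
  qed (use assms in auto)
  finally show ?thesis .
qed

text \<open>A deterministic substitute for random sampling: a few elements of \<open>Y\<close>
  suffice to hit all but \<theta> elements of \<open>X\<close> more than \<open>T\<close> times. The
  potential \<Phi> counts hits, truncated at T + 1. While more than \<theta> elements are bad,
  averaging finds a new m that meets at least \<theta> (\<mu> - T) / |Y| bad ones, and adding it
  raises \<Phi> by that much. As \<Phi> never exceeds |X| (T + 1), s rounds suffice.\<close>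

lemma greedy_hitting:
  fixes adj :: "'a \<Rightarrow> 'b \<Rightarrow> bool"
  assumes fin: "finite X" "finite Y"
    and deg: "\<And>q. q \<in> X \<Longrightarrow> \<mu> \<le> real (card {m \<in> Y. adj q m})"
    and \<mu>: "real T \<le> \<mu>" and \<theta>: "0 \<le> \<theta>"
    and s: "real (card X) * real (T + 1) * real (card Y) < real s * (\<theta> * (\<mu> - real T))"
  obtains Y' where "Y' \<subseteq> Y" "card Y' \<le> s" "real (card {q \<in> X. card {m \<in> Y'. adj q m} \<le> T}) \<le> \<theta>"
proof -
  define bad where "bad = (\<lambda>Y'. {q \<in> X. card {m \<in> Y'. adj q m} \<le> T})"
  define \<Phi> where "\<Phi> = (\<lambda>Y'. \<Sum>q\<in>X. min (T + 1) (card {m \<in> Y'. adj q m}))"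
  have "\<exists>Y'\<subseteq>Y. card Y' \<le> s \<and> (real (card (bad Y')) \<le> \<theta> \<or> real s * (\<theta> * (\<mu> - real T)) \<le> real (\<Phi> Y') * real (card Y))" for s
  proof (induction s)
    case 0
    show ?case by (intro exI[of _ "{}"]) simp
  next
    case (Suc s)
    then obtain Y' where Y': "Y' \<subseteq> Y" "card Y' \<le> s"
      "real (card (bad Y')) \<le> \<theta> \<or> real s * (\<theta> * (\<mu> - real T)) \<le> real (\<Phi> Y') * real (card Y)" by blast
    show ?case
    proof (cases "real (card (bad Y')) \<le> \<theta>")
      case True
      then show ?thesis using Y' by (intro exI[of _ Y']) auto
    next
      case False
      have fY': "finite Y'" using Y'(1) fin(2) finite_subset by blast
      have fb: "finite (bad Y')" using fin by (simp add: bad_def)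
      have "\<theta> * (\<mu> - real T) \<le> real (card (bad Y')) * (\<mu> - real T)"
        using False \<mu> by (intro mult_right_mono) auto
      also have "\<dots> = (\<Sum>q\<in>bad Y'. \<mu> - real T)" by simp
      also have "\<dots> \<le> (\<Sum>q\<in>bad Y'. real (card {m \<in> Y - Y'. adj q m}))"
      proof (rule sum_mono)
        fix q assume q: "q \<in> bad Y'"
        have "card {m \<in> Y. adj q m} = card ({m \<in> Y'. adj q m} \<union> {m \<in> Y - Y'. adj q m})"
          by (rule arg_cong[of _ _ card]) (use Y'(1) in auto)
        also have "\<dots> \<le> card {m \<in> Y'. adj q m} + card {m \<in> Y - Y'. adj q m}" by (rule card_Un_le)
        finally show "\<mu> - real T \<le> real (card {m \<in> Y - Y'. adj q m})"
          using deg[of q] q by (simp add: bad_def)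
      qed
      also have "\<dots> = real (\<Sum>m\<in>Y - Y'. card {q \<in> bad Y'. adj q m})"
      proof -
        have "(\<Sum>q\<in>bad Y'. card {m \<in> Y - Y'. adj q m}) = (\<Sum>m\<in>Y - Y'. card {q \<in> bad Y'. adj q m})"
          using sum_multicount_gen[of "bad Y'" "Y - Y'" adj "\<lambda>m. card {q \<in> bad Y'. adj q m}"] fb fin
          by simp
        then show ?thesis by (simp flip: of_nat_sum)
      qed
      finally have tot: "\<theta> * (\<mu> - real T) \<le> real (\<Sum>m\<in>Y - Y'. card {q \<in> bad Y'. adj q m})" .
      \<comment> \<open>If the required gain is not positive, the current \<open>Y'\<close> already
        serves for the next round and no new element has to exist.\<close>
      have "\<exists>m. (m \<in> Y - Y' \<or> \<theta> * (\<mu> - real T) \<le> 0) \<and> \<theta> * (\<mu> - real T) \<le> real (card {q \<in> bad Y'. adj q m}) * real (card Y)"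
      proof (rule ccontr)
        assume no: "\<not> ?thesis"
        have pos: "\<theta> * (\<mu> - real T) > 0"
        proof (rule ccontr)
          assume "\<not> \<theta> * (\<mu> - real T) > 0"
          then have le: "\<theta> * (\<mu> - real T) \<le> 0" by simp
          have "0 \<le> real (card {q \<in> bad Y'. adj q undefined}) * real (card Y)" by simp
          with le have "\<theta> * (\<mu> - real T) \<le> real (card {q \<in> bad Y'. adj q undefined}) * real (card Y)"
            by (rule order_trans)
          with le no show False by blast
        qed
        have lt: "real (card {q \<in> bad Y'. adj q m}) * real (card Y) < \<theta> * (\<mu> - real T)" if "m \<in> Y - Y'" for m
          using no that by auto
        have "Y - Y' \<noteq> {}"
        proof
          assume e: "Y - Y' = {}"
          show False using tot pos unfolding e by simp
        qed
        then have Y0: "card Y > 0" using fin by (auto simp: card_gt_0_iff)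
        have "real (\<Sum>m\<in>Y - Y'. card {q \<in> bad Y'. adj q m}) * real (card Y)
            = (\<Sum>m\<in>Y - Y'. real (card {q \<in> bad Y'. adj q m}) * real (card Y))"
          by (simp add: sum_distrib_right)
        also have "\<dots> < (\<Sum>m\<in>Y - Y'. \<theta> * (\<mu> - real T))"
          using lt fin \<open>Y - Y' \<noteq> {}\<close> by (intro sum_strict_mono) auto
        also have "\<dots> = real (card (Y - Y')) * (\<theta> * (\<mu> - real T))" by simp
        also have "\<dots> \<le> real (card Y) * (\<theta> * (\<mu> - real T))"
          using pos fin by (intro mult_right_mono) (auto intro: card_mono)
        finally show False using tot Y0 by (simp add: mult.commute)
      qed
      then obtain m where m: "m \<in> Y - Y' \<or> \<theta> * (\<mu> - real T) \<le> 0"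
        "\<theta> * (\<mu> - real T) \<le> real (card {q \<in> bad Y'. adj q m}) * real (card Y)" by blast
      show ?thesis
      proof (cases "m \<in> Y - Y'")
        case False
        then have "\<theta> * (\<mu> - real T) \<le> 0" using m by blast
        then have "real (Suc s) * (\<theta> * (\<mu> - real T)) \<le> 0" by (simp add: mult_nonneg_nonpos del: of_nat_Suc)
        also have "0 \<le> real (\<Phi> Y') * real (card Y)" by simp
        finally show ?thesis using Y' by (intro exI[of _ Y']) auto
      next
        case True
        define Z where "Z = insert m Y'"
        have "\<Phi> Y' + card {q \<in> bad Y'. adj q m} = (\<Sum>q\<in>X. min (T + 1) (card {m \<in> Y'. adj q m}) + (if q \<in> bad Y' \<and> adj q m then 1 else 0))"
        proof -
          have "{q \<in> X. q \<in> bad Y' \<and> adj q m} = {q \<in> bad Y'. adj q m}" by (auto simp: bad_def)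
          then show ?thesis unfolding \<Phi>_def sum.distrib using fin(1)
            by (simp add: sum.If_cases Int_def)
        qed
        also have "\<dots> \<le> \<Phi> Z" unfolding \<Phi>_def
        proof (rule sum_mono)
          fix q assume "q \<in> X"
          show "min (T + 1) (card {m \<in> Y'. adj q m}) + (if q \<in> bad Y' \<and> adj q m then 1 else 0) \<le> min (T + 1) (card {m \<in> Z. adj q m})"
          proof (cases "adj q m")
            case True
            have "{m \<in> Z. adj q m} = insert m {m \<in> Y'. adj q m}" using True by (auto simp: Z_def)
            then have "card {m \<in> Z. adj q m} = Suc (card {m \<in> Y'. adj q m})"
              using \<open>m \<in> Y - Y'\<close> fY' by simp
            then show ?thesis by (auto simp: bad_def)
          next
            case False
            then have "{m \<in> Z. adj q m} = {m \<in> Y'. adj q m}" by (auto simp: Z_def)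
            then show ?thesis using False by simp
          qed
        qed
        finally have "real (\<Phi> Y') + real (card {q \<in> bad Y'. adj q m}) \<le> real (\<Phi> Z)" by linarith
        then have "real (\<Phi> Y') * real (card Y) + real (card {q \<in> bad Y'. adj q m}) * real (card Y) \<le> real (\<Phi> Z) * real (card Y)"
          by (metis distrib_right mult_right_mono of_nat_0_le_iff)
        moreover have "real s * (\<theta> * (\<mu> - real T)) \<le> real (\<Phi> Y') * real (card Y)" using Y'(3) \<open>\<not> real (card (bad Y')) \<le> \<theta>\<close> by blast
        ultimately have "real (Suc s) * (\<theta> * (\<mu> - real T)) \<le> real (\<Phi> Z) * real (card Y)"
          using m(2) by (simp add: distrib_right)
        moreover have "Z \<subseteq> Y" "card Z \<le> Suc s" using Y' True fY' by (auto simp: Z_def)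
        ultimately show ?thesis by blast
      qed
    qed
  qed
  then obtain Y' where Y': "Y' \<subseteq> Y" "card Y' \<le> s"
    "real (card (bad Y')) \<le> \<theta> \<or> real s * (\<theta> * (\<mu> - real T)) \<le> real (\<Phi> Y') * real (card Y)" by blast
  have "\<Phi> Y' \<le> (\<Sum>q\<in>X. T + 1)" unfolding \<Phi>_def by (rule sum_mono) simp
  then have "\<Phi> Y' \<le> card X * (T + 1)" by simp
  then have "real (\<Phi> Y') \<le> real (card X) * real (T + 1)"
    by (simp only: of_nat_mult[symmetric] of_nat_le_iff)
  then have "real (\<Phi> Y') * real (card Y) \<le> real (card X) * real (T + 1) * real (card Y)"
    by (intro mult_right_mono) auto
  then have "real (card (bad Y')) \<le> \<theta>" using Y'(3) s by linarith
  then show ?thesis using that Y' unfolding bad_def by blast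
qed

section \<open>Incidences between rows and columns\<close>

definition incid :: "'k::field \<times> 'k \<times> 'k \<Rightarrow> 'k \<times> 'k \<times> 'k \<Rightarrow> bool" where
  "incid = (\<lambda>(z, \<alpha>, \<beta>) (w, \<gamma>, \<delta>). \<alpha> * w + \<beta> = \<gamma> * z + \<delta>)"

definition inc :: "('k::field \<times> 'k \<times> 'k) set \<Rightarrow> ('k \<times> 'k \<times> 'k) set \<Rightarrow> (('k \<times> 'k \<times> 'k) \<times> ('k \<times> 'k \<times> 'k)) set" where
  "inc X Y = {(q, r). q \<in> X \<and> r \<in> Y \<and> incid q r}"

text \<open>The row (z, \<alpha>, \<beta>) lies on the bilinear graph t = a + b w + c z + d w z
  exactly if \<alpha> = b + d z and \<beta> = a + c z. So this bounds the rows on any bilinear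
  graph, and such rows are collinear when regarded as points of three-space.\<close>

definition collinear_le :: "nat \<Rightarrow> ('k::field \<times> 'k \<times> 'k) set \<Rightarrow> bool" where
  "collinear_le k X \<longleftrightarrow> (\<forall>a b c d. card {q \<in> X. fst (snd q) = b + d * fst q \<and> snd (snd q) = a + c * fst q} \<le> k)"

lemma incid_eval:
  "incid q r \<Longrightarrow> poly (rowev q F) (fst r) = poly (colev r F) (fst q)"
  by (cases q; cases r) (auto simp: incid_def poly_rowev poly_colev)

lemma card_fst_roots_le:
  assumes "p \<noteq> 0" "inj_on fst X" "S \<subseteq> X" "\<And>q. q \<in> S \<Longrightarrow> poly p (fst q) = 0"
  shows "card S \<le> degree (p :: 'k::field poly)"
proof -
  have "card S = card (fst ` S)"
    using assms(2,3) by (intro card_image[symmetric]) (auto simp: inj_on_def)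
  also have "\<dots> \<le> card {x. poly p x = 0}" using assms by (intro card_mono poly_roots_finite) auto
  also have "\<dots> \<le> degree p" using assms(1) by (rule card_poly_roots_bound)
  finally show ?thesis .
qed

text \<open>Discard the rows on components that carry few rows, and the columns on components that
  carry few columns; squares of the degrees sum to at most T^2. Three kinds of incidences remain. A
  column outside the surface meets it in at most \<open>T\<close> points. A row meets the components
  that do not contain it in at most \<open>T\<close> points altogether. If row and column share the
  chosen component, it is bilinear and carries at most \<open>k\<close> rows.\<close>

lemma component_decomposition:
  fixes X Y :: "('k::field_gcd \<times> 'k \<times> 'k) set"
  assumes inf: "infinite (UNIV :: 'k set)" and F: "F \<noteq> 0" "deg3 F \<le> T"
    and char: "\<And>n. 0 < n \<Longrightarrow> n \<le> T \<Longrightarrow> (of_nat n :: 'k) \<noteq> 0"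
    and X: "finite X" "inj_on fst X" "collinear_le k X" and Y: "finite Y" "inj_on fst Y"
    and XF: "\<And>q. q \<in> X \<Longrightarrow> rowev q F = 0"
  obtains X' Y' where "X' \<subseteq> X" "Y' \<subseteq> Y" "card X' \<le> 12 * T\<^sup>2" "card Y' \<le> 12 * T\<^sup>2"
    "card (inc (X - X') (Y - Y')) \<le> T * card X + T * card Y + k * card Y"
proof -
  define \<F> where "\<F> = prime_factors F"
  have fin: "finite \<F>" by (simp add: \<F>_def)
  have pr: "prime f" "f dvd F" if "f \<in> \<F>" for f using that F by (auto simp: \<F>_def in_prime_factors_iff)
  have nz: "f \<noteq> 0" if "f \<in> \<F>" for f using pr(1)[OF that] by auto
  have sub: "deg3 (\<Prod>\<G>) = (\<Sum>f\<in>\<G>. deg3 f)" "\<Prod>\<G> \<noteq> 0" if "\<G> \<subseteq> \<F>" for \<G>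
  proof -
    have "finite \<G>" using that fin finite_subset by blast
    then show nzp: "\<Prod>\<G> \<noteq> 0" using that nz by auto
    show "deg3 (\<Prod>\<G>) = (\<Sum>f\<in>\<G>. deg3 f)" using \<open>finite \<G>\<close> that
    proof (induction \<G> rule: finite_induct)
      case empty
      then show ?case using degree_fun_1[OF degree_fun_deg3] by simp
    next
      case (insert f \<G>)
      then have "f \<noteq> 0" "\<Prod>\<G> \<noteq> 0" using nz by auto
      then show ?case using insert by (simp add: degree_fun_mult[OF degree_fun_deg3])
    qed
  qed
  have "\<Prod>\<F> dvd F" 
  proof -
    have "\<Prod>\<F> = prod_mset (mset_set \<F>)" by (simp add: prod_unfold_prod_mset)
    also have "\<dots> dvd prod_mset (prime_factorization F)"
      unfolding \<F>_def by (intro prod_mset_subset_imp_dvd mset_set_set_mset_msubset)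
    also have "\<dots> dvd F" by (rule associatedD1[OF prod_mset_prime_factorization_weak[OF F(1)]])
    finally show ?thesis .
  qed
  then obtain G where G: "F = \<Prod>\<F> * G" by (rule dvdE)
  then have "G \<noteq> 0" using F by auto
  then have "deg3 F = deg3 (\<Prod>\<F>) + deg3 G"
    using degree_fun_mult[OF degree_fun_deg3 sub(2)[OF subset_refl], of G] G by simp
  then have sumT: "(\<Sum>f\<in>\<F>. deg3 f) \<le> T" using F sub(1)[OF subset_refl] by simp
  have degf: "deg3 f \<le> T" if "f \<in> \<F>" for f
    using member_le_sum[OF that, of deg3] fin sumT by fastforce
  have hom_factor: "\<exists>f\<in>\<F>. h f = 0" if h: "comm_ring_hom h" "h F = 0" for h :: "'k poly poly poly \<Rightarrow> 'k poly"
  proof -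
    interpret h: comm_ring_hom h by fact
    have "F dvd prod_mset (prime_factorization F)"
      by (rule associatedD2[OF prod_mset_prime_factorization_weak[OF F(1)]])
    then obtain g where "prod_mset (prime_factorization F) = F * g" by (rule dvdE)
    then have "h (prod_mset (prime_factorization F)) = 0" using h.hom_mult h(2) by simp
    moreover have "h (prod_mset M) = prod_mset (image_mset h M)" for M
      by (induction M) (auto simp: h.hom_mult)
    ultimately have "0 \<in># image_mset h (prime_factorization F)" by (metis prod_mset_zero_iff)
    then have "0 \<in> h ` \<F>" unfolding \<F>_def set_image_mset .
    then obtain f where "0 = h f" "f \<in> \<F>" by (rule imageE)
    then show ?thesis by metis
  qed
  define row where "row = (\<lambda>f. card {q \<in> X. rowev q f = 0} \<le> 12 * (deg3 f)\<^sup>2)"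
  define col where "col = (\<lambda>f. card {q \<in> Y. colev q f = 0} \<le> 12 * (deg3 f)\<^sup>2)"
  define X' where "X' = (\<Union>f\<in>{f\<in>\<F>. row f}. {q \<in> X. rowev q f = 0})"
  define Y' where "Y' = (\<Union>f\<in>{f\<in>\<F>. col f}. {q \<in> Y. colev q f = 0})"
  have sq: "(\<Sum>f\<in>\<F>. 12 * (deg3 f)\<^sup>2) \<le> 12 * T\<^sup>2"
  proof -
    have "(\<Sum>f\<in>\<F>. (deg3 f)\<^sup>2) \<le> (\<Sum>f\<in>\<F>. deg3 f * T)"
      unfolding power2_eq_square by (intro sum_mono mult_left_mono) (auto intro: degf)
    also have "\<dots> \<le> T * T" using sumT by (simp flip: sum_distrib_right)
    finally show ?thesis by (simp add: power2_eq_square flip: sum_distrib_left)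
  qed
  have "card X' \<le> (\<Sum>f\<in>{f\<in>\<F>. row f}. card {q \<in> X. rowev q f = 0})"
    unfolding X'_def using fin by (intro card_UN_le) auto
  also have "\<dots> \<le> (\<Sum>f\<in>{f\<in>\<F>. row f}. 12 * (deg3 f)\<^sup>2)" by (rule sum_mono) (simp add: row_def)
  also have "\<dots> \<le> (\<Sum>f\<in>\<F>. 12 * (deg3 f)\<^sup>2)" using fin by (intro sum_mono2) auto
  finally have cX: "card X' \<le> 12 * T\<^sup>2" using sq by simp
  have "card Y' \<le> (\<Sum>f\<in>{f\<in>\<F>. col f}. card {q \<in> Y. colev q f = 0})"
    unfolding Y'_def using fin by (intro card_UN_le) auto
  also have "\<dots> \<le> (\<Sum>f\<in>{f\<in>\<F>. col f}. 12 * (deg3 f)\<^sup>2)" by (rule sum_mono) (simp add: col_def)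
  also have "\<dots> \<le> (\<Sum>f\<in>\<F>. 12 * (deg3 f)\<^sup>2)" using fin by (intro sum_mono2) auto
  finally have cY: "card Y' \<le> 12 * T\<^sup>2" using sq by simp
  have bil: "card {q \<in> X. rowev q f = 0} \<le> k" if f: "f \<in> \<F>" "\<not> row f" "\<not> col f" for f
  proof -
    have "irreducible f" by (intro prime_elem_imp_irreducible prime_imp_prime_elem pr(1) f(1))
    moreover have "(of_nat n :: 'k) \<noteq> 0" if "0 < n" "n \<le> deg3 f" for n
      using char that degf[OF f(1)] by simp
    ultimately show ?thesis
    proof (rule irreducible_surface_cases[OF inf _ _ X(1,2) Y])
      fix \<kappa> a b c d assume "\<kappa> \<noteq> 0" and feq: "f = [:[:[:\<kappa>:]:]:] * [: - [:[:a, b:], [:c, d:]:], 1:]"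
      have "\<alpha> = b + d * z \<and> \<beta> = a + c * z" if "rowev (z, \<alpha>, \<beta>) f = 0" for z \<alpha> \<beta>
      proof -
        have "rowev (z, \<alpha>, \<beta>) f = [:\<kappa>:] * ([:\<beta>, \<alpha>:] - ([:a, b:] + [:z:] * [:c, d:]))"
          unfolding feq rowev_def prod.case ev.hom_mult
          by (simp only: ev_pCons ev2_pCons ev2.hom_uminus ev.hom_zero ev2.hom_zero ev2.hom_one
              pcompose_const mult_zero_right add_0_right pcompose_idR mult_1_right)
             (simp add: algebra_simps)
        then have "[:\<beta>, \<alpha>:] = [:a, b:] + [:z:] * [:c, d:]" using that \<open>\<kappa> \<noteq> 0\<close> by simp
        then show ?thesis by (simp add: mult.commute)
      qed
      then have "card {q \<in> X. rowev q f = 0} \<le> card {q \<in> X. fst (snd q) = b + d * fst q \<and> snd (snd q) = a + c * fst q}"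
        using X(1) by (intro card_mono) auto
      also have "\<dots> \<le> k" using X(3) by (simp add: collinear_le_def)
      finally show ?thesis .
    qed (use f in \<open>auto simp: row_def col_def\<close>)
  qed
  define cmp where "cmp = (\<lambda>r. SOME f. f \<in> \<F> \<and> colev r f = 0)"
  have cmp: "cmp r \<in> \<F> \<and> colev r (cmp r) = 0" if "colev r F = 0" for r
    unfolding cmp_def by (rule someI_ex) (use hom_factor[OF comm_ring_hom_colev that] in blast)
  define I where "I = inc (X - X') (Y - Y')"
  define I1 where "I1 = {(q, r) \<in> I. colev r F \<noteq> 0}"
  define I2 where "I2 = {(q, r) \<in> I. colev r F = 0 \<and> rowev q (cmp r) \<noteq> 0}"
  define I3 where "I3 = {(q, r) \<in> I. colev r F = 0 \<and> rowev q (cmp r) = 0}"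
  have IXY: "I \<subseteq> X \<times> Y" by (auto simp: I_def inc_def)
  have finI: "finite I" using IXY X(1) Y(1) finite_subset by blast
  have incI: "incid q r" if "(q, r) \<in> I" for q r using that by (auto simp: I_def inc_def)
  have "card I1 \<le> T * card Y"
  proof (rule card_pairs_le_snd[OF Y(1) _ _ X(1)])
    show "I1 \<subseteq> X \<times> Y" using IXY by (auto simp: I1_def)
    fix r assume "r \<in> Y"
    show "card {q. (q, r) \<in> I1} \<le> T"
    proof (cases "colev r F = 0")
      case False
      have "card {q. (q, r) \<in> I1} \<le> degree (colev r F)"
      proof (rule card_fst_roots_le[OF False X(2)])
        show "{q. (q, r) \<in> I1} \<subseteq> X" using IXY by (auto simp: I1_def)
        fix q assume "q \<in> {q. (q, r) \<in> I1}"
        then have "incid q r" "q \<in> X" using incI IXY by (auto simp: I1_def)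
        then show "poly (colev r F) (fst q) = 0" using incid_eval[of q r F] XF by simp
      qed
      also have "\<dots> \<le> T" using degree_colev_le[of r F] F by simp
      finally show ?thesis .
    qed (simp add: I1_def)
  qed
  moreover have "card I2 \<le> T * card X"
  proof (rule card_pairs_le_fst[OF X(1) _ _ Y(1)])
    show "I2 \<subseteq> X \<times> Y" using IXY by (auto simp: I2_def)
    fix q assume "q \<in> X"
    \<comment> \<open>The product of all components not containing the row q restricts to one
      nonzero polynomial on q. It vanishes at each of the incidences counted here, and its degree is
      at most the sum of all component degrees.\<close>
    define \<G> where "\<G> = {f \<in> \<F>. rowev q f \<noteq> 0}"
    have \<G>: "\<G> \<subseteq> \<F>" "finite \<G>" using fin by (auto simp: \<G>_def)
    have prod: "rowev q (\<Prod>\<G>) = (\<Prod>f\<in>\<G>. rowev q f)" by (rule rowev.hom_prod)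
    have "card {r. (q, r) \<in> I2} \<le> degree (rowev q (\<Prod>\<G>))"
    proof (rule card_fst_roots_le[OF _ Y(2)])
      show "rowev q (\<Prod>\<G>) \<noteq> 0" unfolding prod using \<G> by (auto simp: \<G>_def)
      show "{r. (q, r) \<in> I2} \<subseteq> Y" using IXY by (auto simp: I2_def)
      fix r assume "r \<in> {r. (q, r) \<in> I2}"
      then have r: "(q, r) \<in> I" "colev r F = 0" "rowev q (cmp r) \<noteq> 0" by (auto simp: I2_def)
      then have "cmp r \<in> \<G>" using cmp[of r] by (auto simp: \<G>_def)
      moreover have "poly (rowev q (cmp r)) (fst r) = 0"
        using incid_eval[OF incI[OF r(1)], of "cmp r"] cmp[OF r(2)] by simp
      ultimately show "poly (rowev q (\<Prod>\<G>)) (fst r) = 0"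
        unfolding prod poly_prod using \<G>(2) by auto
    qed
    also have "\<dots> \<le> deg3 (\<Prod>\<G>)" by (rule degree_rowev_le)
    also have "\<dots> = (\<Sum>f\<in>\<G>. deg3 f)" by (rule sub(1)[OF \<G>(1)])
    also have "\<dots> \<le> (\<Sum>f\<in>\<F>. deg3 f)" using \<G>(1) fin by (intro sum_mono2) auto
    finally show "card {r. (q, r) \<in> I2} \<le> T" using sumT by simp
  qed
  moreover have "card I3 \<le> k * card Y"
  proof (rule card_pairs_le_snd[OF Y(1) _ _ X(1)])
    show "I3 \<subseteq> X \<times> Y" using IXY by (auto simp: I3_def)
    fix r assume "r \<in> Y"
    show "card {q. (q, r) \<in> I3} \<le> k"
    proof (cases "{q. (q, r) \<in> I3} = {}")
      case False
      then obtain q where q: "(q, r) \<in> I3" by auto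
      then have h: "q \<in> X" "q \<notin> X'" "r \<in> Y" "r \<notin> Y'" "colev r F = 0" "rowev q (cmp r) = 0"
        by (auto simp: I3_def I_def inc_def)
      have c: "cmp r \<in> \<F>" "colev r (cmp r) = 0" using cmp[OF h(5)] by auto
      have "\<not> row (cmp r)" "\<not> col (cmp r)" using h c by (auto simp: X'_def Y'_def)
      then have "card {q \<in> X. rowev q (cmp r) = 0} \<le> k" using bil c by blast
      moreover have "card {q. (q, r) \<in> I3} \<le> card {q \<in> X. rowev q (cmp r) = 0}"
        using X(1) IXY by (intro card_mono) (auto simp: I3_def)
      ultimately show ?thesis by linarith
    qed (metis card.empty le0)
  qed
  moreover have "card I \<le> card I1 + card (I2 \<union> I3)"
  proof -
    have "I = I1 \<union> (I2 \<union> I3)" by (auto simp: I1_def I2_def I3_def)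
    then show ?thesis using card_Un_le[of I1 "I2 \<union> I3"] by simp
  qed
  moreover have "card (I2 \<union> I3) \<le> card I2 + card I3" by (rule card_Un_le)
  ultimately have "card I \<le> T * card X + T * card Y + k * card Y" by linarith
  moreover have "X' \<subseteq> X" "Y' \<subseteq> Y" by (auto simp: X'_def Y'_def)
  ultimately show ?thesis using that cX cY unfolding I_def by blast
qed

definition config :: "nat \<Rightarrow> nat \<Rightarrow> ('k::field \<times> 'k \<times> 'k) set \<Rightarrow> ('k \<times> 'k \<times> 'k) set \<Rightarrow> bool" where
  "config P k X Y \<longleftrightarrow> finite X \<and> finite Y \<and> inj_on fst X \<and> inj_on fst Y \<and>
     collinear_le k X \<and> collinear_le k Y \<and> min (card X) (card Y) \<le> P\<^sup>2"

text \<open>A symmetric form of Rudnev's bound. It drops to a quarter when one argument shrinks by a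
  factor 16 and the other does not grow, which pays for the recursion.\<close>

definition incbound :: "real \<Rightarrow> real \<Rightarrow> real \<Rightarrow> real" where
  "incbound k x y = x * sqrt y + y * sqrt x + k * sqrt (x * y)"

lemma collinear_le_subset:
  assumes "collinear_le k X" "finite X" "X' \<subseteq> X" shows "collinear_le k X'"
  unfolding collinear_le_def
proof (intro allI)
  fix a b c d
  have "card {q \<in> X'. fst (snd q) = b + d * fst q \<and> snd (snd q) = a + c * fst q}
      \<le> card {q \<in> X. fst (snd q) = b + d * fst q \<and> snd (snd q) = a + c * fst q}"
    using assms by (intro card_mono) auto
  also have "\<dots> \<le> k" using assms(1) by (simp add: collinear_le_def)
  finally show "card {q \<in> X'. fst (snd q) = b + d * fst q \<and> snd (snd q) = a + c * fst q} \<le> k" .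
qed

lemma config_subset:
  assumes "config P k X Y" "X' \<subseteq> X" "Y' \<subseteq> Y" shows "config P k X' Y'"
proof -
  have "finite X'" "finite Y'" using assms finite_subset by (auto simp: config_def)
  moreover have "card X' \<le> card X" "card Y' \<le> card Y" using assms card_mono by (auto simp: config_def)
  ultimately show ?thesis using assms collinear_le_subset inj_on_subset unfolding config_def
    by (metis (no_types, lifting) min.mono order_trans)
qed

lemma config_swap: "config P k X Y \<Longrightarrow> config P k Y X" by (auto simp: config_def min.commute)

lemma incbound_swap: "incbound k x y = incbound k y x" by (simp add: incbound_def mult.commute)

lemma card_inc_swap: "card (inc X Y) = card (inc Y X)"
proof -
  have "inc Y X = prod.swap ` inc X Y"
    by (auto simp: inc_def incid_def image_iff eq_commute split: prod.splits)
  then show ?thesis using card_image[of prod.swap "inc X Y"] by (force simp: inj_on_def)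
qed

lemma finite_inc: "finite X \<Longrightarrow> finite Y \<Longrightarrow> finite (inc X Y)"
  by (rule finite_subset[of _ "X \<times> Y"]) (auto simp: inc_def)

text \<open>Rows with few incidences are counted trivially. A surface of low degree through a sample
  of columns contains most of the remaining rows, because they meet the sample more often than the
  degree allows. Outside the exceptional rows and columns, its components bound the incidences. Each
  exceptional family is small enough for the induction hypothesis to cost a quarter of the
  claim.\<close>

lemma incidence_bound_step:
  fixes X Y :: "('k::field_gcd \<times> 'k \<times> 'k) set"
  assumes inf: "infinite (UNIV :: 'k set)"
    and char: "\<And>n. 0 < n \<Longrightarrow> n < P \<Longrightarrow> (of_nat n :: 'k) \<noteq> 0"
    and cfg: "config P k X Y" and le: "card Y \<le> card X"
    and IH: "\<And>X' Y'. X' \<subseteq> X \<Longrightarrow> Y' \<subseteq> Y \<Longrightarrow> card X' + card Y' < card X + card Y \<Longrightarrow>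
      real (card (inc X' Y')) \<le> 10 ^ 7 * incbound k (card X') (card Y')"
  shows "real (card (inc X Y)) \<le> 10 ^ 7 * incbound k (card X) (card Y)"
proof -
  define x y u where "x = real (card X)" and "y = real (card Y)" and "u = sqrt y"
  have fin: "finite X" "finite Y" using cfg by (auto simp: config_def)
  have u0: "u \<ge> 0" and uu: "u * u = y" and yx: "y \<le> x" and y0: "0 \<le> y"
    using le by (auto simp: u_def x_def y_def)
  have f0: "incbound k x y \<ge> x * u" using yx y0 by (simp add: incbound_def u_def)
  have "0 \<le> x * u" using yx y0 u0 by simp
  then have f00: "incbound k x y \<ge> 0" using f0 by linarith
  show ?thesis
  proof (cases "u \<le> 10 ^ 4")
    case True
    have "card (inc X Y) \<le> card (X \<times> Y)" using fin by (intro card_mono) (auto simp: inc_def)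
    then have "real (card (inc X Y)) \<le> x * y"
      by (simp add: card_cartesian_product x_def y_def flip: of_nat_mult)
    also have "\<dots> = x * u * u" using uu by simp
    also have "\<dots> \<le> x * u * 10 ^ 4" using True yx y0 u0 by (intro mult_left_mono) auto
    also have "\<dots> \<le> incbound k x y * 10 ^ 7" using f0 f00 by (intro mult_mono) auto
    finally show ?thesis by (simp add: x_def y_def mult.commute)
  next
    case False
    then have ubig: "u > 10 ^ 4" by simp
    have ypos: "y > 0" using ubig uu by (smt (verit) mult_pos_pos zero_less_power)
    have xpos: "x > 0" using ypos yx by simp
    \<comment> \<open>The degree is a small multiple of the square root of |Y|: small enough that 12
      T^2 is at most y/32, large enough that a surface can contain s columns with s proportional to
      y.\<close>
    define D where "D = nat \<lceil>u * (16 / 10000)\<rceil>"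
    have ubig': "u > 10000" using ubig by simp
    have "real D = of_int \<lceil>u * (16 / 10000)\<rceil>" unfolding D_def using u0 by simp
    then have D1: "u * (16 / 10000) \<le> real D" and D2: "real D \<le> u * (17 / 10000)"
      using of_int_ceiling_le_add_one[of "u * (16 / 10000)"] ubig' by linarith+
    define T where "T = 3 * D"
    \<comment> \<open>The number of columns that parameter counting allows, since s (3 D + 1) < (D +
      1)^3.\<close>
    define s where "s = D\<^sup>2 div 3"
    \<comment> \<open>The threshold for rich rows. It must be large enough for a sample of s columns
      to hit all but x/32 of them more than T times, and small enough that \<mu> x uses only a tenth
      of the bound.\<close>
    define \<mu> where "\<mu> = 10 ^ 6 * u"
    have T2: "real T \<le> u * (51 / 10000)" using D2 by (simp add: T_def)
    define X1 where "X1 = {q \<in> X. \<mu> \<le> real (card {m \<in> Y. incid q m})}"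
    have X1: "finite X1" "X1 \<subseteq> X" using fin by (auto simp: X1_def)
    have cX1: "real (card X1) \<le> x" using card_mono[OF fin(1) X1(2)] by (simp add: x_def)
    have D16: "real D \<ge> 16" using D1 ubig by simp
    have s_ge: "real s \<ge> y * (4 / 10000000)"
    proof -
      have "n < 3 * (n div 3) + 3" for n :: nat by presburger
      then have "D\<^sup>2 < 3 * s + 3" unfolding s_def .
      then have "real (D\<^sup>2) < real (3 * s + 3)" by (simp only: of_nat_less_iff)
      then have "real (D\<^sup>2) / 3 - 1 \<le> real s" by simp
      moreover have "real (D\<^sup>2) \<ge> 256" using power_mono[OF D16, of 2] by simp
      moreover have "real (D\<^sup>2) \<ge> y * (256 / 100000000)"
        using power_mono[OF D1, of 2] u0 uu by (simp add: power2_eq_square algebra_simps)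
      ultimately show ?thesis by simp
    qed
    have ineq: "real (card X1) * real (T + 1) * real (card Y) < real s * (x / 32 * (\<mu> - real T))"
    proof -
      have "real (card X1) * real (T + 1) * real (card Y) \<le> x * (u * (52 / 10000)) * y"
        using cX1 T2 ubig y0 xpos unfolding y_def[symmetric] by (intro mult_mono) auto
      also have "\<dots> < (y * (4 / 10000000)) * (x / 32 * (999999 * u))"
        using xpos ypos ubig by (simp add: field_simps)
      also have "\<dots> \<le> real s * (x / 32 * (\<mu> - real T))"
        using s_ge T2 u0 xpos y0 unfolding \<mu>_def by (intro mult_mono) auto
      finally show ?thesis .
    qed
    have T\<mu>: "real T \<le> \<mu>" using T2 u0 by (simp add: \<mu>_def)
    have dg: "\<mu> \<le> real (card {m \<in> Y. incid q m})" if "q \<in> X1" for q using that by (simp add: X1_def)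
    have th: "0 \<le> x / 32" using xpos by simp
    obtain Y' where Y': "Y' \<subseteq> Y" "card Y' \<le> s"
      "real (card {q \<in> X1. card {m \<in> Y'. incid q m} \<le> T}) \<le> x / 32"
      by (rule greedy_hitting[of X1 Y \<mu> incid T "x / 32" s, OF X1(1) fin(2) dg T\<mu> th ineq]) (assumption | rule that)+
    have fY': "finite Y'" using Y'(1) fin finite_subset by blast
    have "card Y' * (3 * D + 1) < (D + 1) ^ 3"
    proof -
      have "3 * (card Y' * (3 * D + 1)) \<le> 3 * (s * (3 * D + 1))"
        by (intro mult_le_mono2 mult_le_mono1 Y'(2))
      also have "\<dots> = (3 * s) * (3 * D + 1)" by (simp only: mult.assoc)
      also have "\<dots> \<le> D\<^sup>2 * (3 * D + 1)" unfolding s_def by (intro mult_le_mono1) simp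
      also have "\<dots> < 3 * (D + 1) ^ 3" by (simp add: eval_nat_numeral algebra_simps)
      finally show ?thesis by simp
    qed
    then obtain F where F: "F \<noteq> 0" "deg3 F \<le> T" "\<And>m. m \<in> Y' \<Longrightarrow> colev m F = 0"
      using surface_through_columns[OF fY'] unfolding T_def by blast
    define X2 where "X2 = {q \<in> X1. T < card {m \<in> Y'. incid q m}}"
    have X2: "X2 \<subseteq> X1" "X2 \<subseteq> X" "finite X2" using X1 by (auto simp: X2_def)
    have bad: "real (card (X1 - X2)) \<le> x / 32"
    proof -
      have "X1 - X2 = {q \<in> X1. card {m \<in> Y'. incid q m} \<le> T}" by (auto simp: X2_def)
      then show ?thesis using Y'(3) by simp
    qed
    have injX: "inj_on fst X" and injY: "inj_on fst Y" using cfg by (auto simp: config_def)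
    have XF: "rowev q F = 0" if "q \<in> X2" for q
    proof (rule ccontr)
      assume "rowev q F \<noteq> 0"
      then have "card {m \<in> Y'. incid q m} \<le> degree (rowev q F)"
      proof (rule card_fst_roots_le)
        show "inj_on fst Y'" using injY Y'(1) inj_on_subset by blast
        show "poly (rowev q F) (fst m) = 0" if "m \<in> {m \<in> Y'. incid q m}" for m
          using that incid_eval[of q m F] F(3)[of m] by simp
      qed auto
      also have "\<dots> \<le> T" using degree_rowev_le[of q F] F(2) by simp
      finally show False using \<open>q \<in> X2\<close> by (simp add: X2_def)
    qed
    \<comment> \<open>Here the size condition enters: y is the smaller cardinality, so its square
      root is at most P and the degree of the surface stays below P.\<close>
    have "real T < real P"
    proof -
      have "y \<le> (real P)\<^sup>2"
        using cfg le unfolding config_def y_def by (simp add: min_def flip: of_nat_power split: if_splits)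
      then have "u \<le> real P" unfolding u_def by (rule real_le_lsqrt[rotated]) simp
      then show ?thesis using T2 ubig' by linarith
    qed
    then have "T < P" by simp
    then have char': "(of_nat n :: 'k) \<noteq> 0" if "0 < n" "n \<le> T" for n using char that by simp
    have X2k: "collinear_le k X2" using cfg X2 fin collinear_le_subset unfolding config_def by blast
    have injX2: "inj_on fst X2" using injX X2 inj_on_subset by blast
    obtain Xp Yp where p: "Xp \<subseteq> X2" "Yp \<subseteq> Y" "card Xp \<le> 12 * T\<^sup>2" "card Yp \<le> 12 * T\<^sup>2"
      "card (inc (X2 - Xp) (Y - Yp)) \<le> T * card X2 + T * card Y + k * card Y"
      using component_decomposition[OF inf F(1,2) char' X2(3) injX2 X2k fin(2) injY XF] by blast
    have "real (12 * T\<^sup>2) \<le> y / 32"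
    proof -
      have "real T * real T \<le> u * (51 / 10000) * (u * (51 / 10000))" using T2 u0 by (intro mult_mono) auto
      also have "\<dots> = y * (2601 / 100000000)" using uu by simp
      finally show ?thesis using ypos by (simp add: power2_eq_square)
    qed
    then have cXp: "real (card Xp) \<le> y / 32" and cYp: "real (card Yp) \<le> y / 32"
      using p(3,4) by (meson of_nat_mono order_trans)+
    \<comment> \<open>The exceptional rows: those missed by the surface, at most x/32, and those on
      its row-poor components, at most y/32 \<le> x/32.\<close>
    define B where "B = (X1 - X2) \<union> Xp"
    have BX: "B \<subseteq> X" using X1 X2 p by (auto simp: B_def)
    have "card B \<le> card (X1 - X2) + card Xp" unfolding B_def by (rule card_Un_le)
    then have cB: "real (card B) \<le> x / 16" using bad cXp yx by linarith
    have mono: "incbound k a b \<le> incbound k x y / 4"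
      if "0 \<le> a" "0 \<le> b" "(a \<le> x / 16 \<and> b \<le> y) \<or> (a \<le> x \<and> b \<le> y / 16)" for a b
    proof -
      have sq: "sqrt (v / 16) = sqrt v / 4" for v :: real by (simp add: real_sqrt_divide)
      have sq4: "sqrt v \<le> sqrt w / 4" if "v \<le> w / 16" for v w
        using real_sqrt_le_mono[OF that] unfolding sq .
      have "a * b \<le> x * y / 16"
        using that mult_mono[of a "x/16" b y] mult_mono[of a x b "y/16"] xpos ypos by auto
      then have "sqrt (a * b) \<le> sqrt (x * y) / 4"
        by (rule sq4)
      moreover have "a * sqrt b \<le> x * sqrt y / 4"
      proof (cases "a \<le> x / 16 \<and> b \<le> y")
        case True
        then have "a * sqrt b \<le> (x / 16) * sqrt y" using that xpos by (intro mult_mono) auto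
        also have "\<dots> \<le> x * sqrt y / 4" using xpos ypos by simp
        finally show ?thesis .
      next
        case False
        then have "a * sqrt b \<le> x * (sqrt y / 4)"
          using that xpos by (intro mult_mono sq4) auto
        then show ?thesis by simp
      qed
      moreover have "b * sqrt a \<le> y * sqrt x / 4"
      proof (cases "a \<le> x / 16 \<and> b \<le> y")
        case True
        then have "b * sqrt a \<le> y * (sqrt x / 4)"
          using that ypos by (intro mult_mono sq4) auto
        then show ?thesis by simp
      next
        case False
        then have "b * sqrt a \<le> (y / 16) * sqrt x" using that ypos by (intro mult_mono) auto
        also have "\<dots> \<le> y * sqrt x / 4" using xpos ypos by simp
        finally show ?thesis .
      qed
      moreover have "real k * sqrt (a * b) \<le> real k * (sqrt (x * y) / 4)"
        using calculation(1) by (intro mult_left_mono) auto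
      ultimately show ?thesis unfolding incbound_def by simp
    qed
    have "real (card (inc B Y)) \<le> 10 ^ 7 * incbound k (card B) (card Y)"
    proof (rule IH[OF BX subset_refl])
      have "real (card B) < real (card X)" using cB xpos unfolding x_def by linarith
      then show "card B + card Y < card X + card Y" by simp
    qed
    also have "\<dots> \<le> 10 ^ 7 * (incbound k x y / 4)" using cB by (intro mult_left_mono mono) (auto simp: y_def)
    finally have e1: "real (card (inc B Y)) \<le> 10 ^ 7 * (incbound k x y / 4)" .
    have "real (card (inc X Yp)) \<le> 10 ^ 7 * incbound k (card X) (card Yp)"
    proof (rule IH[OF subset_refl p(2)])
      have "real (card Yp) < real (card Y)" using cYp ypos unfolding y_def by linarith
      then show "card X + card Yp < card X + card Y" by simp
    qed
    also have "\<dots> \<le> 10 ^ 7 * (incbound k x y / 4)" using cYp ypos by (intro mult_left_mono mono) (auto simp: x_def)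
    finally have e2: "real (card (inc X Yp)) \<le> 10 ^ 7 * (incbound k x y / 4)" .
    have e3: "real (card (inc (X - X1) Y)) \<le> \<mu> * x"
    proof -
      have "card (inc (X - X1) Y) \<le> nat \<lfloor>\<mu>\<rfloor> * card X"
      proof (rule card_pairs_le_fst[OF fin(1) _ _ fin(2)])
        show "inc (X - X1) Y \<subseteq> X \<times> Y" by (auto simp: inc_def)
        fix q assume "q \<in> X"
        show "card {r. (q, r) \<in> inc (X - X1) Y} \<le> nat \<lfloor>\<mu>\<rfloor>"
        proof (cases "q \<in> X1")
          case False
          have "{r. (q, r) \<in> inc (X - X1) Y} = {m \<in> Y. incid q m}" using False \<open>q \<in> X\<close> by (auto simp: inc_def)
          moreover have "real (card {m \<in> Y. incid q m}) < \<mu>" using False \<open>q \<in> X\<close> by (auto simp: X1_def)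
          ultimately show ?thesis by (simp add: le_nat_floor)
        qed (auto simp: inc_def)
      qed
      then have "real (card (inc (X - X1) Y)) \<le> real (nat \<lfloor>\<mu>\<rfloor>) * x"
        unfolding x_def by (simp flip: of_nat_mult)
      also have "\<dots> \<le> \<mu> * x" using u0 xpos by (intro mult_right_mono) (auto simp: \<mu>_def)
      finally show ?thesis .
    qed
    have e4: "real (card (inc (X2 - Xp) (Y - Yp))) \<le> x * u + real k * sqrt (x * y)"
    proof -
      have "real (card (inc (X2 - Xp) (Y - Yp))) \<le> real T * real (card X2) + real T * y + real k * y"
        using p(5) unfolding y_def by (simp flip: of_nat_mult of_nat_add)
      also have "real T * real (card X2) \<le> real T * x"
        using card_mono[OF fin(1) X2(2)] by (intro mult_left_mono) (auto simp: x_def)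
      also have "real T * y \<le> real T * x" using yx by (intro mult_left_mono) auto
      also have "real T * x \<le> 51 / 10000 * (x * u)"
        using mult_right_mono[OF T2, of x] xpos by (simp add: algebra_simps)
      also have "real k * y \<le> real k * sqrt (x * y)"
      proof (intro mult_left_mono)
        have "y = sqrt (y * y)" using y0 by simp
        also have "\<dots> \<le> sqrt (x * y)" using yx y0 by (intro real_sqrt_le_mono mult_right_mono) auto
        finally show "y \<le> sqrt (x * y)" .
      qed simp
      finally show ?thesis using \<open>0 \<le> x * u\<close> by linarith
    qed
    \<comment> \<open>Poor rows, exceptional rows, exceptional columns, and pairs controlled by the
      components.\<close>
    have "inc X Y \<subseteq> (inc (X - X1) Y \<union> inc B Y) \<union> (inc X Yp \<union> inc (X2 - Xp) (Y - Yp))"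
      by (auto simp: inc_def B_def)
    then have "card (inc X Y) \<le> card ((inc (X - X1) Y \<union> inc B Y) \<union> (inc X Yp \<union> inc (X2 - Xp) (Y - Yp)))"
      using fin X1 X2 BX p finite_subset[OF BX] finite_subset[OF p(2)] by (intro card_mono) (auto intro!: finite_inc)
    also have "\<dots> \<le> card (inc (X - X1) Y \<union> inc B Y) + card (inc X Yp \<union> inc (X2 - Xp) (Y - Yp))"
      by (rule card_Un_le)
    also have "\<dots> \<le> (card (inc (X - X1) Y) + card (inc B Y)) + (card (inc X Yp) + card (inc (X2 - Xp) (Y - Yp)))"
      by (intro add_mono card_Un_le)
    finally have "real (card (inc X Y)) \<le> real (card (inc (X - X1) Y)) + real (card (inc B Y)) + (real (card (inc X Yp)) + real (card (inc (X2 - Xp) (Y - Yp))))"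
      by linarith
    also have "\<dots> \<le> \<mu> * x + 10 ^ 7 * (incbound k x y / 4) + (10 ^ 7 * (incbound k x y / 4) + (x * u + real k * sqrt (x * y)))"
      using e1 e2 e3 e4 by linarith
    \<comment> \<open>The two recursive terms take half of 10^7; in the other half, 10^6 goes to the
      poor rows and a negligible amount to the surface.\<close>
    also have "\<dots> \<le> 10 ^ 7 * incbound k x y"
    proof -
      have "0 \<le> x * u" "0 \<le> y * sqrt x" "0 \<le> real k * sqrt (x * y)" using xpos ypos u0 by auto
      then have "\<mu> * x + x * u + real k * sqrt (x * y) \<le> 10 ^ 7 * (incbound k x y / 2)"
        unfolding \<mu>_def incbound_def u_def[symmetric] by (simp add: algebra_simps)
      then show ?thesis by simp
    qed
    finally show ?thesis by (simp add: x_def y_def)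
  qed
qed

theorem incidence_bound:
  fixes X Y :: "('k::field_gcd \<times> 'k \<times> 'k) set"
  assumes inf: "infinite (UNIV :: 'k set)"
    and char: "\<And>n. 0 < n \<Longrightarrow> n < P \<Longrightarrow> (of_nat n :: 'k) \<noteq> 0"
    and cfg: "config P k X Y"
  shows "real (card (inc X Y)) \<le> 10 ^ 7 * incbound k (card X) (card Y)"
  using cfg
proof (induction "card X + card Y" arbitrary: X Y rule: less_induct)
  case less
  show ?case
  proof (cases "card Y \<le> card X")
    case True
    show ?thesis
      by (rule incidence_bound_step[OF inf char less.prems True])
         (use less.hyps config_subset[OF less.prems] in blast)+
  next
    case False
    have "real (card (inc Y X)) \<le> 10 ^ 7 * incbound k (card Y) (card X)"
    proof (rule incidence_bound_step[OF inf char config_swap[OF less.prems]])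
      show "card X \<le> card Y" using False by simp
      fix X' Y' assume "X' \<subseteq> Y" "Y' \<subseteq> X" "card X' + card Y' < card Y + card X"
      then have "real (card (inc Y' X')) \<le> 10 ^ 7 * incbound k (card Y') (card X')"
        using config_subset[OF less.prems] by (intro less.hyps) auto
      then show "real (card (inc X' Y')) \<le> 10 ^ 7 * incbound k (card X') (card Y')"
        by (simp add: card_inc_swap[of X'] incbound_swap[of _ "real (card X')"])
    qed
    then show ?thesis by (simp add: card_inc_swap[of X] incbound_swap[of _ "real (card X)"])
  qed
qed

section \<open>From points and planes to rows and columns\<close>

definition line_le :: "nat \<Rightarrow> ('k::field \<times> 'k \<times> 'k) set \<Rightarrow> bool" where
  "line_le k Q \<longleftrightarrow> (\<forall>a1 a2 a3 v1 v2 v3. (v1, v2, v3) \<noteq> (0, 0, 0) \<longrightarrow>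
     card {q \<in> Q. \<exists>t. q = (a1 + t * v1, a2 + t * v2, a3 + t * v3)} \<le> k)"

text \<open>The second triple stands for the plane with normal vector (a, -c', 1), so points and
  planes have the same shape. Collinear plane triples form a pencil of planes, through a common line
  or parallel, and \<open>line_le\<close> on planes bounds these.\<close>

definition planar :: "'k::field \<times> 'k \<times> 'k \<Rightarrow> 'k \<times> 'k \<times> 'k \<Rightarrow> bool" where
  "planar = (\<lambda>(c, a', e) (a, c', e'). c * a + e = c' * a' + e')"

lemma exists_common_nonroot:
  fixes \<P> :: "'k::field poly set"
  assumes "infinite (UNIV :: 'k set)" "finite \<P>" "0 \<notin> \<P>"
  obtains \<xi> where "\<And>p. p \<in> \<P> \<Longrightarrow> poly p \<xi> \<noteq> 0"
proof -
  have "finite (\<Union>p\<in>\<P>. {x. poly p x = 0})" using assms by (intro finite_UN_I poly_roots_finite) auto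
  then obtain \<xi> where "\<xi> \<notin> (\<Union>p\<in>\<P>. {x. poly p x = 0})" using assms(1) ex_new_if_finite by blast
  then show ?thesis using that by auto
qed

text \<open>
  Lines through a point \<open>q\<close> (resp. inside a plane \<open>r\<close>) that meet a fixed line of \<open>P\<^sup>3\<close> form a pencil.
  If the fixed line has Pluecker coordinates in general position with respect to the given points and planes
  (here: powers of a generic \<open>\<xi>\<close>), the pencils become rows and columns with distinct first coordinates.
\<close>

theorem point_plane_incidences:
  fixes Q R :: "('k::field_gcd \<times> 'k \<times> 'k) set"
  assumes inf: "infinite (UNIV :: 'k set)"
    and char: "\<And>n. 0 < n \<Longrightarrow> n < P \<Longrightarrow> (of_nat n :: 'k) \<noteq> 0"
    and fin: "finite Q" "finite R" and k: "line_le k Q" "line_le k R"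
    and small: "min (card Q) (card R) \<le> P\<^sup>2"
  shows "real (card {(q, r). q \<in> Q \<and> r \<in> R \<and> planar q r}) \<le> 10 ^ 7 * incbound k (card Q) (card R)"
proof -
  \<comment> \<open>Numerators and denominators of the first coordinates, as polynomials in the
    generic parameter. The exponents 1, 2, 3, 7 are chosen so that in a cross product
    \<open>nq q * dq q'\<close> three coefficients arise from a single pair of terms each and
    together reveal the coordinates; hence distinct points (and likewise planes) give nonzero
    differences.\<close>
  define nq dq :: "'k \<times> 'k \<times> 'k \<Rightarrow> 'k poly" where
    "nq = (\<lambda>(q1, q2, q3). [:q2, -1, 0, - q1:])" and "dq = (\<lambda>(q1, q2, q3). [:q3, 0, -1, 0, 0, 0, 0, - q1:])"
  define nr dr :: "'k \<times> 'k \<times> 'k \<Rightarrow> 'k poly" where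
    "nr = (\<lambda>(r1, r2, r3). [:r1, 0, 0, - r2, 0, 0, 0, 1:])" and "dr = (\<lambda>(r1, r2, r3). [:- r3, - r2, 1:])"
  have dq0: "dq q \<noteq> 0" and dr0: "dr q \<noteq> 0" for q by (cases q; simp add: dq_def dr_def)+
  have crq: "nq q * dq q' - nq q' * dq q \<noteq> 0" if "q \<noteq> q'" for q q'
  proof
    obtain q1 q2 q3 where q: "q = (q1, q2, q3)" by (cases q)
    obtain p1 p2 p3 where q': "q' = (p1, p2, p3)" by (cases q')
    assume "nq q * dq q' - nq q' * dq q = 0"
    then have eq: "coeff (nq q * dq q') n = coeff (nq q' * dq q) n" for n by simp
    have c: "coeff (nq (a1, a2, a3) * dq (b1, b2, b3)) (Suc 0) = - b3"
      "coeff (nq (a1, a2, a3) * dq (b1, b2, b3)) (Suc (Suc 0)) = - a2"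
      "coeff (nq (a1, a2, a3) * dq (b1, b2, b3)) (Suc (Suc (Suc (Suc (Suc 0))))) = a1" for a1 a2 a3 b1 b2 b3
      unfolding coeff_mult nq_def dq_def prod.case by (simp_all only: sum.atMost_Suc atMost_0) simp_all
    show False using that eq[of "Suc 0"] eq[of "Suc (Suc 0)"] eq[of "Suc (Suc (Suc (Suc (Suc 0))))"]
      unfolding q q' c by simp
  qed
  have crr: "nr q * dr q' - nr q' * dr q \<noteq> 0" if "q \<noteq> q'" for q q'
  proof
    obtain q1 q2 q3 where q: "q = (q1, q2, q3)" by (cases q)
    obtain p1 p2 p3 where q': "q' = (p1, p2, p3)" by (cases q')
    assume "nr q * dr q' - nr q' * dr q = 0"
    then have eq: "coeff (nr q * dr q') n = coeff (nr q' * dr q) n" for n by simp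
    let ?seven = "Suc (Suc (Suc (Suc (Suc (Suc (Suc 0))))))"
    have c: "coeff (nr (a1, a2, a3) * dr (b1, b2, b3)) (Suc (Suc 0)) = a1"
      "coeff (nr (a1, a2, a3) * dr (b1, b2, b3)) ?seven = - b3"
      "coeff (nr (a1, a2, a3) * dr (b1, b2, b3)) (Suc ?seven) = - b2" for a1 a2 a3 b1 b2 b3
      unfolding coeff_mult nr_def dr_def prod.case by (simp_all only: sum.atMost_Suc atMost_0) simp_all
    show False using that eq[of "Suc (Suc 0)"] eq[of ?seven] eq[of "Suc ?seven"]
      unfolding q q' c by simp
  qed
  define \<P> where "\<P> = dq ` Q \<union> dr ` R \<union> (\<Union>q\<in>Q. \<Union>q'\<in>Q - {q}. {nq q * dq q' - nq q' * dq q})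
     \<union> (\<Union>q\<in>R. \<Union>q'\<in>R - {q}. {nr q * dr q' - nr q' * dr q})"
  have "finite \<P>" unfolding \<P>_def using fin by (intro finite_UnI finite_UN_I finite_imageI) auto
  moreover have "0 \<notin> \<P>"
  proof -
    have n1: "p \<noteq> 0" if "p \<in> dq ` Q" for p using that by (rule imageE) (simp only: dq0 not_False_eq_True)
    have n2: "p \<noteq> 0" if "p \<in> dr ` R" for p using that by (rule imageE) (simp only: dr0 not_False_eq_True)
    have n3: "p \<noteq> 0" if "p \<in> (\<Union>q\<in>Q. \<Union>q'\<in>Q - {q}. {nq q * dq q' - nq q' * dq q})" for p
    proof -
      from that obtain q q' where h: "q' \<in> Q - {q}" and p: "p \<in> {nq q * dq q' - nq q' * dq q}" by (elim UN_E)
      from h have "q \<noteq> q'" by auto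
      from crq[OF this] p show ?thesis by (simp only: singleton_iff not_False_eq_True)
    qed
    have n4: "p \<noteq> 0" if "p \<in> (\<Union>q\<in>R. \<Union>q'\<in>R - {q}. {nr q * dr q' - nr q' * dr q})" for p
    proof -
      from that obtain q q' where h: "q' \<in> R - {q}" and p: "p \<in> {nr q * dr q' - nr q' * dr q}" by (elim UN_E)
      from h have "q \<noteq> q'" by auto
      from crr[OF this] p show ?thesis by (simp only: singleton_iff not_False_eq_True)
    qed
    show ?thesis
    proof
      assume "0 \<in> \<P>"
      then show False unfolding \<P>_def by (elim UnE) (drule n1 n2 n3 n4, erule notE, rule refl)+
    qed
  qed
  ultimately obtain \<xi> where \<xi>: "\<And>p. p \<in> \<P> \<Longrightarrow> poly p \<xi> \<noteq> 0" using exists_common_nonroot[OF inf] by blast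
  have dQ: "poly (dq q) \<xi> \<noteq> 0" if "q \<in> Q" for q using that by (intro \<xi>) (unfold \<P>_def, blast)
  have dR: "poly (dr q) \<xi> \<noteq> 0" if "q \<in> R" for q using that by (intro \<xi>) (unfold \<P>_def, blast)
  define \<phi> where "\<phi> = (\<lambda>q. (poly (nq q) \<xi> / poly (dq q) \<xi>, fst q / poly (dq q) \<xi>, 1 / poly (dq q) \<xi>))"
  define \<psi> where "\<psi> = (\<lambda>r. (poly (nr r) \<xi> / poly (dr r) \<xi>, fst (snd r) / poly (dr r) \<xi>, - 1 / poly (dr r) \<xi>))"
  have inj1: "inj_on (fst \<circ> \<phi>) Q"
  proof (rule inj_onI)
    fix q q' assume h: "q \<in> Q" "q' \<in> Q" "(fst \<circ> \<phi>) q = (fst \<circ> \<phi>) q'"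
    show "q = q'"
    proof (rule ccontr)
      assume "q \<noteq> q'"
      then have "poly (nq q * dq q' - nq q' * dq q) \<xi> \<noteq> 0" using h(1,2) by (intro \<xi>) (unfold \<P>_def, blast)
      then show False using h(3) dQ[OF h(1)] dQ[OF h(2)] by (simp add: \<phi>_def frac_eq_eq)
    qed
  qed
  have inj2: "inj_on (fst \<circ> \<psi>) R"
  proof (rule inj_onI)
    fix q q' assume h: "q \<in> R" "q' \<in> R" "(fst \<circ> \<psi>) q = (fst \<circ> \<psi>) q'"
    show "q = q'"
    proof (rule ccontr)
      assume "q \<noteq> q'"
      then have "poly (nr q * dr q' - nr q' * dr q) \<xi> \<noteq> 0" using h(1,2) by (intro \<xi>) (unfold \<P>_def, blast)
      then show False using h(3) dR[OF h(1)] dR[OF h(2)] by (simp add: \<psi>_def frac_eq_eq)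
    qed
  qed
  have inj\<phi>: "inj_on \<phi> Q" "inj_on fst (\<phi> ` Q)" and inj\<psi>: "inj_on \<psi> R" "inj_on fst (\<psi> ` R)"
    using inj_on_imageI2[OF inj1] inj_on_imageI[OF inj1] inj_on_imageI2[OF inj2] inj_on_imageI[OF inj2] by blast+
  have nqv: "poly (nq (q1, q2, q3)) \<xi> = q2 - \<xi> - \<xi> ^ 3 * q1"
    and dqv: "poly (dq (q1, q2, q3)) \<xi> = q3 - \<xi> ^ 2 - \<xi> ^ 7 * q1" 
    and nrv: "poly (nr (q1, q2, q3)) \<xi> = q1 - \<xi> ^ 3 * q2 + \<xi> ^ 7"
    and drv: "poly (dr (q1, q2, q3)) \<xi> = - q3 - \<xi> * q2 + \<xi> ^ 2" for q1 q2 q3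
    by (simp_all add: nq_def dq_def nr_def dr_def algebra_simps eval_nat_numeral)
  have inc: "incid (\<phi> q) (\<psi> r) \<longleftrightarrow> planar q r" if qr: "q \<in> Q" "r \<in> R" for q r
  proof -
    obtain q1 q2 q3 where q: "q = (q1, q2, q3)" by (cases q)
    obtain r1 r2 r3 where r: "r = (r1, r2, r3)" by (cases r)
    define dx dy where "dx = poly (dq q) \<xi>" and "dy = poly (dr r) \<xi>"
    have nz: "dx \<noteq> 0" "dy \<noteq> 0" using dQ[OF qr(1)] dR[OF qr(2)] by (auto simp: dx_def dy_def)
    have "incid (\<phi> q) (\<psi> r) \<longleftrightarrow> q1 / dx * (poly (nr r) \<xi> / dy) + 1 / dx = r2 / dy * (poly (nq q) \<xi> / dx) + - 1 / dy"
      by (simp only: incid_def \<phi>_def \<psi>_def dx_def dy_def q r prod.case fst_conv snd_conv)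
    also have "\<dots> \<longleftrightarrow> q1 * poly (nr r) \<xi> + dy = r2 * poly (nq q) \<xi> - dx"
      using nz by (simp add: field_simps)
    \<comment> \<open>All terms containing \<xi> occur equally on both sides and cancel.\<close>
    also have "\<dots> \<longleftrightarrow> planar q r"
      unfolding q r dx_def dy_def nqv dqv nrv drv planar_def by (simp add: algebra_simps)
    finally show ?thesis .
  qed
  have "card {(q, r). q \<in> Q \<and> r \<in> R \<and> planar q r} = card ((\<lambda>(q, r). (\<phi> q, \<psi> r)) ` {(q, r). q \<in> Q \<and> r \<in> R \<and> planar q r})"
    using inj\<phi>(1) inj\<psi>(1) by (intro card_image[symmetric]) (auto simp: inj_on_def)
  also have "(\<lambda>(q, r). (\<phi> q, \<psi> r)) ` {(q, r). q \<in> Q \<and> r \<in> R \<and> planar q r} = inc (\<phi> ` Q) (\<psi> ` R)"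
    using inc unfolding inc_def by auto
  finally have card_eq: "card {(q, r). q \<in> Q \<and> r \<in> R \<and> planar q r} = card (inc (\<phi> ` Q) (\<psi> ` R))" .
  have col: "card {q \<in> S. \<exists>t. q = (a1 + t * v1, a2 + t * v2, a3 + t * v3)} \<le> k \<Longrightarrow> T \<subseteq> S \<Longrightarrow> finite S \<Longrightarrow>
     (\<And>q. q \<in> T \<Longrightarrow> \<exists>t. q = (a1 + t * v1, a2 + t * v2, a3 + t * v3)) \<Longrightarrow> card T \<le> k" for S T :: "('k \<times> 'k \<times> 'k) set" and a1 a2 a3 v1 v2 v3
    by (rule order_trans[rotated], assumption, rule card_mono) auto
  have propor: "\<exists>t. s = c * t \<and> n = - a * t" if "a * s + c * n = 0" "(a, c) \<noteq> (0, 0)" for a c s n :: 'k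
  proof (cases "c = 0")
    case True
    then show ?thesis using that by (intro exI[of _ "- n / a"]) auto
  next
    case False
    have "n = - a * (s / c)" using that(1) False by (simp add: field_simps eq_neg_iff_add_eq_0 add.commute)
    then show ?thesis using False by (intro exI[of _ "s / c"]) auto
  qed
  have frac: "x = b * s + d * n" if "x / s = b + d * (n / s)" "s \<noteq> 0" for x s n b d :: 'k
  proof -
    have "x = x / s * s" using that(2) by simp
    also have "\<dots> = b * s + d * n" unfolding that(1) using that(2) by (simp add: distrib_right)
    finally show ?thesis .
  qed
  have k1: "collinear_le k (\<phi> ` Q)"
    unfolding collinear_le_def
  proof (intro allI)
    fix a b c d
    let ?S = "{q \<in> Q. fst (snd (\<phi> q)) = b + d * fst (\<phi> q) \<and> snd (snd (\<phi> q)) = a + c * fst (\<phi> q)}"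
    have "card {q \<in> \<phi> ` Q. fst (snd q) = b + d * fst q \<and> snd (snd q) = a + c * fst q} = card (\<phi> ` ?S)"
      by (rule arg_cong[of _ _ card]) auto
    also have "\<dots> \<le> card ?S" using fin by (intro card_image_le) auto
    also have "\<dots> \<le> k"
    proof (cases "?S = {}")
      case False
      \<comment> \<open>Multiplied by the denominator, the two equations become linear in the
        original coordinates: a collinear family of rows comes from points on one line.\<close>
      have eqs: "q1 = b * (q3 - \<xi> ^ 2 - \<xi> ^ 7 * q1) + d * (q2 - \<xi> - \<xi> ^ 3 * q1)"
        "1 = a * (q3 - \<xi> ^ 2 - \<xi> ^ 7 * q1) + c * (q2 - \<xi> - \<xi> ^ 3 * q1)" if "(q1, q2, q3) \<in> ?S" for q1 q2 q3
      proof -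
        have h: "q1 / poly (dq (q1, q2, q3)) \<xi> = b + d * (poly (nq (q1, q2, q3)) \<xi> / poly (dq (q1, q2, q3)) \<xi>)"
          "1 / poly (dq (q1, q2, q3)) \<xi> = a + c * (poly (nq (q1, q2, q3)) \<xi> / poly (dq (q1, q2, q3)) \<xi>)"
          "poly (dq (q1, q2, q3)) \<xi> \<noteq> 0"
          using that dQ[of "(q1, q2, q3)"] by (simp_all only: \<phi>_def mem_Collect_eq fst_conv snd_conv simp_thms)
        show "q1 = b * (q3 - \<xi> ^ 2 - \<xi> ^ 7 * q1) + d * (q2 - \<xi> - \<xi> ^ 3 * q1)"
          "1 = a * (q3 - \<xi> ^ 2 - \<xi> ^ 7 * q1) + c * (q2 - \<xi> - \<xi> ^ 3 * q1)"
          by (rule frac[OF h(1,3), unfolded nqv dqv], rule frac[OF h(2,3), unfolded nqv dqv])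
      qed
      obtain p1 p2 p3 where p: "(p1, p2, p3) \<in> ?S" using False by auto
      define s0 n0 where "s0 = p3 - \<xi> ^ 2 - \<xi> ^ 7 * p1" and "n0 = p2 - \<xi> - \<xi> ^ 3 * p1"
      have p_eqs: "p1 = b * s0 + d * n0" "1 = a * s0 + c * n0" using eqs[OF p] by (simp_all add: s0_def n0_def)
      then have ac: "(a, c) \<noteq> (0, 0)" by auto
      \<comment> \<open>The direction of that line. Along it s and n change by c t and -a t because
        a s + c n is constant, so q1 changes by (b c - d a) t; undoing the substitution for s and n
        gives the other two components.\<close>
      define v1 where "v1 = b * c - d * a"
      define v2 where "v2 = - a + \<xi> ^ 3 * v1"
      define v3 where "v3 = c + \<xi> ^ 7 * v1"
      have v: "(v1, v2, v3) \<noteq> (0, 0, 0)" using ac by (auto simp: v2_def v3_def)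
      show ?thesis
      proof (rule col)
        show "card {q \<in> Q. \<exists>t. q = (p1 + t * v1, p2 + t * v2, p3 + t * v3)} \<le> k"
          using k(1) v unfolding line_le_def by blast
        fix q assume q: "q \<in> ?S"
        obtain q1 q2 q3 where qq: "q = (q1, q2, q3)" by (cases q)
        define s n where "s = q3 - \<xi> ^ 2 - \<xi> ^ 7 * q1" and "n = q2 - \<xi> - \<xi> ^ 3 * q1"
        have q_eqs: "q1 = b * s + d * n" "1 = a * s + c * n" using eqs[OF q[unfolded qq]] by (simp_all add: s_def n_def)
        have "a * (s - s0) + c * (n - n0) = 0" using q_eqs(2) p_eqs(2) by (simp add: algebra_simps)
        then obtain t where t: "s - s0 = c * t" "n - n0 = - a * t" using propor ac by blast
        have "q1 - p1 = b * (s - s0) + d * (n - n0)"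
          using q_eqs(1) p_eqs(1) by (metis add_diff_add right_diff_distrib')
        then have q1: "q1 = p1 + t * v1" unfolding t v1_def by (simp add: algebra_simps)
        have "q2 - p2 = (n - n0) + \<xi> ^ 3 * (q1 - p1)" by (simp add: n_def n0_def algebra_simps)
        then have q2: "q2 = p2 + t * v2" unfolding t v2_def q1 by (simp add: algebra_simps)
        have "q3 - p3 = (s - s0) + \<xi> ^ 7 * (q1 - p1)" by (simp add: s_def s0_def algebra_simps)
        then have q3: "q3 = p3 + t * v3" unfolding t v3_def q1 by (simp add: algebra_simps)
        show "\<exists>t. q = (p1 + t * v1, p2 + t * v2, p3 + t * v3)" unfolding qq using q1 q2 q3 by blast
      qed (use fin in auto)
    qed (metis card.empty le0)
    finally show "card {q \<in> \<phi> ` Q. fst (snd q) = b + d * fst q \<and> snd (snd q) = a + c * fst q} \<le> k" .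
  qed
  have k2: "collinear_le k (\<psi> ` R)"
    unfolding collinear_le_def
  proof (intro allI)
    fix a b c d
    let ?S = "{q \<in> R. fst (snd (\<psi> q)) = b + d * fst (\<psi> q) \<and> snd (snd (\<psi> q)) = a + c * fst (\<psi> q)}"
    have "card {q \<in> \<psi> ` R. fst (snd q) = b + d * fst q \<and> snd (snd q) = a + c * fst q} = card (\<psi> ` ?S)"
      by (rule arg_cong[of _ _ card]) auto
    also have "\<dots> \<le> card ?S" using fin by (intro card_image_le) auto
    also have "\<dots> \<le> k"
    proof (cases "?S = {}")
      case False
      have eqs: "q2 = b * (- q3 - \<xi> * q2 + \<xi> ^ 2) + d * (q1 - \<xi> ^ 3 * q2 + \<xi> ^ 7)"
        "- 1 = a * (- q3 - \<xi> * q2 + \<xi> ^ 2) + c * (q1 - \<xi> ^ 3 * q2 + \<xi> ^ 7)" if "(q1, q2, q3) \<in> ?S" for q1 q2 q3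
      proof -
        have h: "q2 / poly (dr (q1, q2, q3)) \<xi> = b + d * (poly (nr (q1, q2, q3)) \<xi> / poly (dr (q1, q2, q3)) \<xi>)"
          "- 1 / poly (dr (q1, q2, q3)) \<xi> = a + c * (poly (nr (q1, q2, q3)) \<xi> / poly (dr (q1, q2, q3)) \<xi>)"
          "poly (dr (q1, q2, q3)) \<xi> \<noteq> 0"
          using that dR[of "(q1, q2, q3)"] by (simp_all only: \<psi>_def mem_Collect_eq fst_conv snd_conv simp_thms)
        show "q2 = b * (- q3 - \<xi> * q2 + \<xi> ^ 2) + d * (q1 - \<xi> ^ 3 * q2 + \<xi> ^ 7)"
          "- 1 = a * (- q3 - \<xi> * q2 + \<xi> ^ 2) + c * (q1 - \<xi> ^ 3 * q2 + \<xi> ^ 7)"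
          by (rule frac[OF h(1,3), unfolded nrv drv], rule frac[OF h(2,3), unfolded nrv drv])
      qed
      obtain p1 p2 p3 where p: "(p1, p2, p3) \<in> ?S" using False by auto
      define s0 n0 where "s0 = - p3 - \<xi> * p2 + \<xi> ^ 2" and "n0 = p1 - \<xi> ^ 3 * p2 + \<xi> ^ 7"
      have p_eqs: "p2 = b * s0 + d * n0" "- 1 = a * s0 + c * n0" using eqs[OF p] by (simp_all add: s0_def n0_def)
      then have ac: "(a, c) \<noteq> (0, 0)" by auto
      define v2 where "v2 = b * c - d * a"
      define v1 where "v1 = - a + \<xi> ^ 3 * v2"
      define v3 where "v3 = - c - \<xi> * v2"
      have v: "(v1, v2, v3) \<noteq> (0, 0, 0)" using ac by (auto simp: v1_def v3_def)
      show ?thesis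
      proof (rule col)
        show "card {q \<in> R. \<exists>t. q = (p1 + t * v1, p2 + t * v2, p3 + t * v3)} \<le> k"
          using k(2) v unfolding line_le_def by blast
        fix q assume q: "q \<in> ?S"
        obtain q1 q2 q3 where qq: "q = (q1, q2, q3)" by (cases q)
        define s n where "s = - q3 - \<xi> * q2 + \<xi> ^ 2" and "n = q1 - \<xi> ^ 3 * q2 + \<xi> ^ 7"
        have q_eqs: "q2 = b * s + d * n" "- 1 = a * s + c * n" using eqs[OF q[unfolded qq]] by (simp_all add: s_def n_def)
        have "a * (s - s0) + c * (n - n0) = (a * s + c * n) - (a * s0 + c * n0)" by (simp add: algebra_simps)
        then have "a * (s - s0) + c * (n - n0) = 0" unfolding q_eqs(2)[symmetric] p_eqs(2)[symmetric] by simp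
        then obtain t where t: "s - s0 = c * t" "n - n0 = - a * t" using propor ac by blast
        have "q2 - p2 = b * (s - s0) + d * (n - n0)"
          using q_eqs(1) p_eqs(1) by (metis add_diff_add right_diff_distrib')
        then have q2: "q2 = p2 + t * v2" unfolding t v2_def by (simp add: algebra_simps)
        have "q1 - p1 = (n - n0) + \<xi> ^ 3 * (q2 - p2)" by (simp add: n_def n0_def algebra_simps)
        then have q1: "q1 = p1 + t * v1" unfolding t v1_def q2 by (simp add: algebra_simps)
        have "q3 - p3 = - (s - s0) - \<xi> * (q2 - p2)" by (simp add: s_def s0_def algebra_simps)
        then have q3: "q3 = p3 + t * v3" unfolding t v3_def q2 by (simp add: algebra_simps)
        show "\<exists>t. q = (p1 + t * v1, p2 + t * v2, p3 + t * v3)" unfolding qq using q1 q2 q3 by blast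
      qed (use fin in auto)
    qed (metis card.empty le0)
    finally show "card {q \<in> \<psi> ` R. fst (snd q) = b + d * fst q \<and> snd (snd q) = a + c * fst q} \<le> k" .
  qed
  have cards: "card (\<phi> ` Q) = card Q" "card (\<psi> ` R) = card R" using inj\<phi> inj\<psi> card_image by blast+
  have "config P k (\<phi> ` Q) (\<psi> ` R)"
    unfolding config_def using fin inj\<phi> inj\<psi> k1 k2 small by (simp add: cards)
  from incidence_bound[OF inf char this] show ?thesis by (simp add: card_eq cards)
qed

text \<open>Cauchy-Schwarz applied to the sizes of the fibres of \<open>f\<close>.\<close>

lemma card_squared_le_collisions:
  assumes "finite I"
  shows "(card I)\<^sup>2 \<le> card (f ` I) * card {(i, j). i \<in> I \<and> j \<in> I \<and> f i = f j}"
proof -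
  define c where "c = (\<lambda>s. card {i \<in> I. f i = s})"
  have I: "card I = (\<Sum>s\<in>f ` I. c s)"
    using sum.image_gen[OF assms, of "\<lambda>_. 1 :: nat" f] by (simp add: c_def)
  have "{(i, j). i \<in> I \<and> j \<in> I \<and> f i = f j} = (\<Union>s\<in>f ` I. {i \<in> I. f i = s} \<times> {i \<in> I. f i = s})" by auto
  also have "card \<dots> = (\<Sum>s\<in>f ` I. card ({i \<in> I. f i = s} \<times> {i \<in> I. f i = s}))"
    using assms by (intro card_UN_disjoint) auto
  finally have J: "card {(i, j). i \<in> I \<and> j \<in> I \<and> f i = f j} = (\<Sum>s\<in>f ` I. (c s)\<^sup>2)"
    by (simp add: c_def card_cartesian_product power2_eq_square)
  have "(\<Sum>s\<in>f ` I. real (c s))\<^sup>2 \<le> (\<Sum>s\<in>f ` I. (real (c s))\<^sup>2) * real (card (f ` I))"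
    by (rule sum_squared_le_sum_of_squares)
  then have "real ((\<Sum>s\<in>f ` I. c s)\<^sup>2) \<le> real ((\<Sum>s\<in>f ` I. (c s)\<^sup>2) * card (f ` I))" by simp
  then show ?thesis unfolding I J by (simp only: of_nat_le_iff mult.commute)
qed

section \<open>Growth in fields of positive characteristic\<close>

lemma incbound_mono:
  assumes "0 \<le> k" "0 \<le> a" "a \<le> x" "0 \<le> b" "b \<le> y"
  shows "incbound k a b \<le> incbound k x y"
  unfolding incbound_def using assms by (intro add_mono mult_mono real_sqrt_le_mono) auto

lemma incbound_same: "0 \<le> M \<Longrightarrow> incbound k M M = 2 * (M * sqrt M) + k * M"
  by (simp add: incbound_def)

lemma card_line_le:
  fixes Q :: "('k::field \<times> 'k \<times> 'k) set"
  assumes "finite F" "\<And>q. q \<in> Q \<Longrightarrow> \<pi> q \<in> F" "v \<noteq> 0"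
    "\<And>t. \<pi> (a1 + t * v1, a2 + t * v2, a3 + t * v3) = a + t * v"
  shows "card {q \<in> Q. \<exists>t. q = (a1 + t * v1, a2 + t * v2, a3 + t * v3)} \<le> card F"
proof (rule card_inj_on_le[of \<pi>])
  show "inj_on \<pi> {q \<in> Q. \<exists>t. q = (a1 + t * v1, a2 + t * v2, a3 + t * v3)}"
  proof (rule inj_onI)
    fix q q' assume "q \<in> {q \<in> Q. \<exists>t. q = (a1 + t * v1, a2 + t * v2, a3 + t * v3)}"
      "q' \<in> {q \<in> Q. \<exists>t. q = (a1 + t * v1, a2 + t * v2, a3 + t * v3)}" and eq: "\<pi> q = \<pi> q'"
    then obtain t t' where q: "q = (a1 + t * v1, a2 + t * v2, a3 + t * v3)" "q' = (a1 + t' * v1, a2 + t' * v2, a3 + t' * v3)" by blast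
    have "t = t'" using eq unfolding q assms(4) using assms(3) by simp
    then show "q = q'" using q by simp
  qed
qed (use assms in auto)

text \<open>In b + (x - y)^2 = b' + (x' - y')^2 move x^2 and x'^2 to the opposite sides. What
  results is bilinear in (y, x', b) and (x, y', b'): a point and a plane, each built from both sides
  of the collision. With M = |A|^2 |B| points and planes the bound is about M^(3/2). The condition
  |B| \<le> |A|^2 makes max(|A|, |B|) at most the square root of M, so the term for collinear points
  is harmless.\<close>

theorem sumset_with_squared_differences:
  fixes A B :: "'k::field_gcd set"
  assumes inf: "infinite (UNIV :: 'k set)"
    and char: "\<And>n. 0 < n \<Longrightarrow> n < P \<Longrightarrow> (of_nat n :: 'k) \<noteq> 0" and P: "P > 2"
    and fin: "finite A" "finite B" and sm: "card B \<le> (card A)\<^sup>2" "(card A)\<^sup>2 * card B \<le> P\<^sup>2"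
  shows "real (card A) * sqrt (card B) \<le> 3 * 10 ^ 7 * real (card ((\<lambda>(x, y, b). b + (x - y)\<^sup>2) ` (A \<times> A \<times> B)))"
proof -
  define n m where "n = card A" and "m = card B"
  define I where "I = A \<times> A \<times> B"
  define f :: "'k \<times> 'k \<times> 'k \<Rightarrow> 'k" where "f = (\<lambda>(x, y, b). b + (x - y)\<^sup>2)"
  define E where "E = {(i, j). i \<in> I \<and> j \<in> I \<and> f i = f j}"
  define g h :: "'k \<times> 'k \<times> 'k \<Rightarrow> 'k \<times> 'k \<times> 'k" where
    "g = (\<lambda>(y, x, b). (- 2 * y, x, b + y\<^sup>2 - x\<^sup>2))" and "h = (\<lambda>(x, y, b). (x, - 2 * y, b + y\<^sup>2 - x\<^sup>2))"
  define k where "k = max n m"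
  define M where "M = real (n\<^sup>2 * m)"
  have two: "(2 :: 'k) \<noteq> 0" using char[of 2] P by simp
  have finI: "finite I" and cI: "card I = n\<^sup>2 * m"
    using fin by (auto simp: I_def n_def m_def card_cartesian_product power2_eq_square)
  have img: "card (g ` I) \<le> n\<^sup>2 * m" "card (h ` I) \<le> n\<^sup>2 * m" using card_image_le[OF finI] cI by metis+
  have ck: "card A \<le> k" "card B \<le> k" by (auto simp: k_def n_def m_def)
  have cA2: "card ((\<lambda>y. - 2 * y) ` A) \<le> k" using card_image_le[OF fin(1)] ck(1) le_trans by blast
  have lineg: "line_le k (g ` I)"
    unfolding line_le_def
  proof (intro allI impI)
    fix a1 a2 a3 v1 v2 v3 :: 'k
    let ?L = "{q \<in> g ` I. \<exists>t. q = (a1 + t * v1, a2 + t * v2, a3 + t * v3)}"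
    assume "(v1, v2, v3) \<noteq> (0, 0, 0)"
    then consider "v1 \<noteq> 0" | "v2 \<noteq> 0" | "v1 = 0" "v2 = 0" "v3 \<noteq> 0" by auto
    then show "card ?L \<le> k"
    proof cases
      case 1
      have "card ?L \<le> card ((\<lambda>y. - 2 * y) ` A)"
        by (rule card_line_le[where \<pi> = fst and v = v1 and a = a1]) (use fin 1 in \<open>auto simp: g_def I_def\<close>)
      then show ?thesis using cA2 by simp
    next
      case 2
      have "card ?L \<le> card A"
        by (rule card_line_le[where \<pi> = "fst \<circ> snd" and v = v2 and a = a2]) (use fin 2 in \<open>auto simp: g_def I_def\<close>)
      then show ?thesis using ck by simp
    next
      case 3
      \<comment> \<open>On a vertical line y and x are fixed, since 2 is invertible; only b
        varies.\<close>
      have "card ?L \<le> card ((\<lambda>b. b + (- a1 / 2)\<^sup>2 - a2\<^sup>2) ` B)"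
      proof -
        have "card {q \<in> ?L. \<exists>t. q = (a1 + t * v1, a2 + t * v2, a3 + t * v3)} \<le> card ((\<lambda>b. b + (- a1 / 2)\<^sup>2 - a2\<^sup>2) ` B)"
        proof (rule card_line_le[where \<pi> = "snd \<circ> snd" and v = v3 and a = a3])
          fix q assume "q \<in> ?L"
          then obtain y x b where q: "q = (- 2 * y, x, b + y\<^sup>2 - x\<^sup>2)" "b \<in> B" and "- 2 * y = a1" "x = a2"
            using 3 by (auto simp: g_def I_def)
          then have "y = - a1 / 2" using two by auto
          then show "(snd \<circ> snd) q \<in> (\<lambda>b. b + (- a1 / 2)\<^sup>2 - a2\<^sup>2) ` B" using q \<open>x = a2\<close> by auto
        qed (use fin 3 in auto)
        moreover have "{q \<in> ?L. \<exists>t. q = (a1 + t * v1, a2 + t * v2, a3 + t * v3)} = ?L" by auto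
        ultimately show ?thesis by simp
      qed
      also have "\<dots> \<le> card B" using fin by (intro card_image_le)
      finally show ?thesis using ck by simp
    qed
  qed
  have lineh: "line_le k (h ` I)"
    unfolding line_le_def
  proof (intro allI impI)
    fix a1 a2 a3 v1 v2 v3 :: 'k
    let ?L = "{q \<in> h ` I. \<exists>t. q = (a1 + t * v1, a2 + t * v2, a3 + t * v3)}"
    assume "(v1, v2, v3) \<noteq> (0, 0, 0)"
    then consider "v1 \<noteq> 0" | "v2 \<noteq> 0" | "v1 = 0" "v2 = 0" "v3 \<noteq> 0" by auto
    then show "card ?L \<le> k"
    proof cases
      case 1
      have "card ?L \<le> card A"
        by (rule card_line_le[where \<pi> = fst and v = v1 and a = a1]) (use fin 1 in \<open>auto simp: h_def I_def\<close>)
      then show ?thesis using ck by simp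
    next
      case 2
      have "card ?L \<le> card ((\<lambda>y. - 2 * y) ` A)"
        by (rule card_line_le[where \<pi> = "fst \<circ> snd" and v = v2 and a = a2]) (use fin 2 in \<open>auto simp: h_def I_def\<close>)
      then show ?thesis using cA2 by simp
    next
      case 3
      have "card ?L \<le> card ((\<lambda>b. b + (- a2 / 2)\<^sup>2 - a1\<^sup>2) ` B)"
      proof -
        have "card {q \<in> ?L. \<exists>t. q = (a1 + t * v1, a2 + t * v2, a3 + t * v3)} \<le> card ((\<lambda>b. b + (- a2 / 2)\<^sup>2 - a1\<^sup>2) ` B)"
        proof (rule card_line_le[where \<pi> = "snd \<circ> snd" and v = v3 and a = a3])
          fix q assume "q \<in> ?L"
          then obtain y x b where q: "q = (x, - 2 * y, b + y\<^sup>2 - x\<^sup>2)" "b \<in> B" and "- 2 * y = a2" "x = a1"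
            using 3 by (auto simp: h_def I_def)
          then have "y = - a2 / 2" using two by auto
          then show "(snd \<circ> snd) q \<in> (\<lambda>b. b + (- a2 / 2)\<^sup>2 - a1\<^sup>2) ` B" using q \<open>x = a1\<close> by auto
        qed (use fin 3 in auto)
        moreover have "{q \<in> ?L. \<exists>t. q = (a1 + t * v1, a2 + t * v2, a3 + t * v3)} = ?L" by auto
        ultimately show ?thesis by simp
      qed
      also have "\<dots> \<le> card B" using fin by (intro card_image_le)
      finally show ?thesis using ck by simp
    qed
  qed
  define W where "W = {(q, r). q \<in> g ` I \<and> r \<in> h ` I \<and> planar q r}"
  \<comment> \<open>The exchange of variables: i = (x, y, b) and j = (x', y', b') go to the point
    from (y, x', b) and the plane from (x, y', b').\<close>
  define \<Theta> where "\<Theta> = (\<lambda>(i :: 'k \<times> 'k \<times> 'k, j :: 'k \<times> 'k \<times> 'k). (g (fst (snd i), fst j, snd (snd i)), h (fst i, fst (snd j), snd (snd j))))"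
  have "card E \<le> card W"
  proof (rule card_inj_on_le[of \<Theta>])
    show "inj_on \<Theta> E" using two by (auto simp: inj_on_def \<Theta>_def g_def h_def)
    show "\<Theta> ` E \<subseteq> W"
    proof
      fix z assume "z \<in> \<Theta> ` E"
      then obtain x y b x' y' b' where e: "((x, y, b), (x', y', b')) \<in> E" and z: "z = \<Theta> ((x, y, b), (x', y', b'))" by auto
      from e have I: "(y, x', b) \<in> I" "(x, y', b') \<in> I" and "f (x, y, b) = f (x', y', b')" by (auto simp: E_def I_def)
      then have "b + (x - y)\<^sup>2 = b' + (x' - y')\<^sup>2" by (simp add: f_def)
      then have "b + (x\<^sup>2 - 2 * x * y + y\<^sup>2) = b' + (x'\<^sup>2 - 2 * x' * y' + y'\<^sup>2)" unfolding power2_diff by (simp add: algebra_simps)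
      then have "planar (g (y, x', b)) (h (x, y', b'))" by (simp add: planar_def g_def h_def algebra_simps)
      moreover have "z = (g (y, x', b), h (x, y', b'))" by (simp add: z \<Theta>_def)
      ultimately show "z \<in> W" using I by (auto simp: W_def)
    qed
    show "finite W" unfolding W_def by (rule finite_subset[of _ "(g ` I) \<times> (h ` I)"]) (use finI in auto)
  qed
  moreover have "real (card W) \<le> 10 ^ 7 * incbound k (card (g ` I)) (card (h ` I))"
    unfolding W_def using inf char
  proof (rule point_plane_incidences)
    show "min (card (g ` I)) (card (h ` I)) \<le> P\<^sup>2" using img(1) sm(2) unfolding n_def m_def by linarith
  qed (use finI lineg lineh in auto)
  moreover have "10 ^ 7 * incbound k (card (g ` I)) (card (h ` I)) \<le> 10 ^ 7 * incbound k M M"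
    using img unfolding M_def by (intro mult_left_mono incbound_mono) (auto simp flip: of_nat_mult of_nat_power)
  ultimately have "real (card E) \<le> 10 ^ 7 * incbound k M M" by (meson of_nat_mono order_trans)
  also have "\<dots> \<le> 10 ^ 7 * (3 * (M * sqrt M))"
  proof -
    have sM: "sqrt M = real n * sqrt (real m)" by (simp add: M_def real_sqrt_mult)
    have "real n \<le> real n * sqrt (real m) \<or> m = 0"
      using mult_left_mono[of 1 "sqrt (real m)" "real n"] by (cases "m = 0") auto
    moreover have "real m \<le> real n * sqrt (real m)"
    proof -
      have "real m \<le> (real n)\<^sup>2" using sm(1) by (simp add: n_def m_def flip: of_nat_power)
      then have "sqrt (real m) \<le> real n" by (rule real_le_lsqrt[rotated]) simp
      then have "sqrt (real m) * sqrt (real m) \<le> real n * sqrt (real m)" by (rule mult_right_mono) simp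
      then show ?thesis by simp
    qed
    ultimately have "real k * M \<le> sqrt M * M"
    proof (cases "m = 0")
      case False
      then have "real k \<le> sqrt M" using \<open>real n \<le> _ \<or> m = 0\<close> \<open>real m \<le> _\<close> by (auto simp: k_def sM max_def)
      then show ?thesis by (rule mult_right_mono) (simp add: M_def)
    qed (simp add: M_def)
    then show ?thesis by (subst incbound_same) (auto simp: M_def mult.commute)
  qed
  finally have E: "real (card E) \<le> 3 * 10 ^ 7 * (M * sqrt M)" by simp
  have "(card I)\<^sup>2 \<le> card (f ` I) * card E" unfolding E_def by (rule card_squared_le_collisions[OF finI])
  then have "real ((card I)\<^sup>2) \<le> real (card (f ` I) * card E)" by (simp only: of_nat_le_iff)
  then have "M * M \<le> real (card (f ` I)) * real (card E)" unfolding cI M_def by (simp add: power2_eq_square)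
  also have "\<dots> \<le> real (card (f ` I)) * (3 * 10 ^ 7 * (M * sqrt M))" using E by (intro mult_left_mono) auto
  finally have main: "M * M \<le> real (card (f ` I)) * (3 * 10 ^ 7 * (M * sqrt M))" .
  have "sqrt M \<le> 3 * 10 ^ 7 * real (card (f ` I))"
  proof (cases "M = 0")
    case False
    then have "M > 0" by (simp add: M_def)
    then have pos: "0 < M * sqrt M" by simp
    have "sqrt M * (M * sqrt M) = M * M" using \<open>M > 0\<close> by simp
    also have "\<dots> \<le> (3 * 10 ^ 7 * real (card (f ` I))) * (M * sqrt M)" using main by (simp only: mult_ac)
    finally show ?thesis using pos by (rule mult_right_le_imp_le)
  qed simp
  moreover have "sqrt M = real (card A) * sqrt (real (card B))" by (simp add: M_def n_def m_def real_sqrt_mult)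
  ultimately show ?thesis unfolding f_def I_def by simp
qed

section \<open>Lines rich in points of a Cartesian square\<close>

text \<open>If the parameters (r, s) lie on one line, the lines y = r x + s pass through a common
  point or are parallel. Away from that point their sets in \<open>B \<times> B\<close> are
  disjoint, and each keeps at least \<rho> - 1 \<ge> \<rho>/2 elements.\<close>

lemma concurrent_lines_bound:
  fixes B :: "'k::field set"
  assumes B: "finite B" and \<Lambda>: "finite \<Lambda>" and \<rho>: "\<rho> \<ge> 2"
    and rich: "\<And>r s. (r, s) \<in> \<Lambda> \<Longrightarrow> \<rho> \<le> real (card {b \<in> B. r * b + s \<in> B})"
    and v: "(v1, v3) \<noteq> (0, 0)" and line: "\<And>r s. (r, s) \<in> \<Lambda> \<Longrightarrow> \<exists>t. r = a1 + t * v1 \<and> s = a3 + t * v3"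
  shows "real (card \<Lambda>) * \<rho> \<le> 2 * (real (card B))\<^sup>2"
proof -
  \<comment> \<open>The common point. For v1 = 0 the lines are parallel, division by zero yields
    some point, and its removal costs at most one element per line.\<close>
  define z where "z = (- v3 / v1, a1 * (- v3 / v1) + a3)"
  define G where "G = (\<lambda>(r, s). {(b, b'). b \<in> B \<and> b' \<in> B \<and> b' = r * b + s} - {z})"
  have GB: "G l \<subseteq> B \<times> B" for l by (cases l) (auto simp: G_def)
  have finG: "finite (G l)" for l using GB B finite_subset by blast
  have cG: "\<rho> / 2 \<le> real (card (G l))" if l: "l \<in> \<Lambda>" for l
  proof -
    obtain r s where rs: "l = (r, s)" by (cases l)
    let ?H = "{(b, b'). b \<in> B \<and> b' \<in> B \<and> b' = r * b + s}"
    have "?H = (\<lambda>b. (b, r * b + s)) ` {b \<in> B. r * b + s \<in> B}" by auto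
    then have "card ?H = card {b \<in> B. r * b + s \<in> B}" by (simp add: card_image inj_on_def)
    then have "\<rho> \<le> real (card ?H)" using rich l rs by auto
    moreover have "card ?H - 1 \<le> card (?H - {z})" using diff_card_le_card_Diff[of "{z}" ?H] by simp
    ultimately show ?thesis using \<rho> unfolding rs G_def prod.case by linarith
  qed
  have disj: "G l \<inter> G l' = {}" if h: "l \<in> \<Lambda>" "l' \<in> \<Lambda>" "l \<noteq> l'" for l l'
  proof (rule ccontr)
    assume "G l \<inter> G l' \<noteq> {}"
    obtain r s r' s' where rs: "l = (r, s)" "l' = (r', s')" by (cases l; cases l')
    obtain t where t: "r = a1 + t * v1" "s = a3 + t * v3" using line h(1) rs by blast
    obtain t' where t': "r' = a1 + t' * v1" "s' = a3 + t' * v3" using line h(2) rs by blast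
    from \<open>G l \<inter> G l' \<noteq> {}\<close> obtain b b' where "(b, b') \<in> G l" "(b, b') \<in> G l'" by auto
    then have b: "b' = r * b + s" "b' = r' * b + s'" "(b, b') \<noteq> z"
      unfolding G_def rs prod.case by blast+
    have "r * b + s = r' * b + s'" using b(1,2) by simp
    then have "(t - t') * (v1 * b + v3) = 0" unfolding t t' by (simp add: algebra_simps)
    moreover have "t \<noteq> t'" using h(3) rs t t' by auto
    ultimately have vb: "v1 * b + v3 = 0" by simp
    then have "v1 \<noteq> 0" using v by auto
    have "v1 * b = - v3" using vb by (simp add: eq_neg_iff_add_eq_0)
    then have "b = - v3 / v1" using nonzero_mult_div_cancel_left[OF \<open>v1 \<noteq> 0\<close>, of b] by simp
    moreover have "b' = a1 * b + a3 + t * (v1 * b + v3)" using b(1) unfolding t by (simp add: algebra_simps)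
    ultimately show False using b(3) vb by (simp add: z_def)
  qed
  have "real (card \<Lambda>) * (\<rho> / 2) = (\<Sum>l\<in>\<Lambda>. \<rho> / 2)" by simp
  also have "\<dots> \<le> (\<Sum>l\<in>\<Lambda>. real (card (G l)))" using cG by (intro sum_mono)
  also have "\<dots> = real (card (\<Union>l\<in>\<Lambda>. G l))"
    using \<Lambda> finG disj by (subst card_UN_disjoint) auto
  also have "\<dots> \<le> real (card (B \<times> B))" using GB B by (intro of_nat_mono card_mono) auto
  finally show ?thesis by (simp add: card_cartesian_product power2_eq_square)
qed

text \<open>Compare incidences on two lines with equal second coordinate: r b + s = r' b' + s' says
  that the point (r, b', s) lies on the plane (b, r', s'). Since the second coordinate takes at most
  |B| values, Cauchy-Schwarz bounds the square of the number of incidences by |B| times the number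
  of such pairs.\<close>

lemma rich_lines_bound_small:
  fixes B :: "'k::field_gcd set"
  assumes inf: "infinite (UNIV :: 'k set)"
    and char: "\<And>n. 0 < n \<Longrightarrow> n < P \<Longrightarrow> (of_nat n :: 'k) \<noteq> 0"
    and B: "finite B" and \<Lambda>: "finite \<Lambda>" and \<rho>: "\<rho> \<ge> 2"
    and rich: "\<And>r s. (r, s) \<in> \<Lambda> \<Longrightarrow> \<rho> \<le> real (card {b \<in> B. r * b + s \<in> B})"
    and sm: "card B * card \<Lambda> \<le> P\<^sup>2"
  shows "real (card \<Lambda>) * \<rho> ^ 4 \<le> 2 * 10 ^ 15 * real (card B) ^ 5"
proof (cases "\<Lambda> = {}")
  case False
  define N l where "N = real (card B)" and "l = real (card \<Lambda>)"
  have l1: "l \<ge> 1" using False \<Lambda> by (simp add: l_def Suc_le_eq card_gt_0_iff)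
  obtain r0 s0 where "(r0, s0) \<in> \<Lambda>" using False by auto
  then have "\<rho> \<le> real (card {b \<in> B. r0 * b + s0 \<in> B})" by (rule rich)
  also have "\<dots> \<le> N" unfolding N_def using B by (intro of_nat_mono card_mono) auto
  finally have \<rho>N: "\<rho> \<le> N" .
  \<comment> \<open>Collinear points here are either at most |B| many, or belong to lines with
    collinear parameters, counted by the bound for concurrent lines.\<close>
  define k where "k = nat \<lfloor>2 * N\<^sup>2 / \<rho>\<rfloor>"
  have kr: "real k \<le> 2 * N\<^sup>2 / \<rho>" unfolding k_def using \<rho> by simp
  have le_k: "c \<le> k" if "real c * \<rho> \<le> 2 * N\<^sup>2" for c
    unfolding k_def using that \<rho> by (intro le_nat_floor) (simp add: pos_le_divide_eq)
  have "real (card B) * \<rho> \<le> N * N" using \<rho>N \<rho> unfolding N_def by (intro mult_left_mono) auto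
  then have Nk: "card B \<le> k" using zero_le_square[of N] by (intro le_k) (simp add: power2_eq_square del: zero_le_square)
  define I where "I = {(lb :: ('k \<times> 'k) \<times> 'k). fst lb \<in> \<Lambda> \<and> snd lb \<in> B \<and> fst (fst lb) * snd lb + snd (fst lb) \<in> B}"
  define f where "f = (\<lambda>lb :: ('k \<times> 'k) \<times> 'k. fst (fst lb) * snd lb + snd (fst lb))"
  have IB: "I \<subseteq> \<Lambda> \<times> B" by (auto simp: I_def)
  have finI: "finite I" using IB \<Lambda> B finite_subset by blast
  have I: "\<rho> * l \<le> real (card I)"
  proof -
    have "I = (SIGMA q:\<Lambda>. {b \<in> B. fst q * b + snd q \<in> B})" by (auto simp: I_def)
    then have "card I = (\<Sum>q\<in>\<Lambda>. card {b \<in> B. fst q * b + snd q \<in> B})" using \<Lambda> B by simp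
    then have "real (card I) = (\<Sum>q\<in>\<Lambda>. real (card {b \<in> B. fst q * b + snd q \<in> B}))" by simp
    also have "\<dots> \<ge> (\<Sum>q\<in>\<Lambda>. \<rho>)" using rich by (intro sum_mono) auto
    finally show ?thesis by (simp add: l_def mult.commute)
  qed
  define E where "E = {(i, j). i \<in> I \<and> j \<in> I \<and> f i = f j}"
  define g h :: "('k \<times> 'k) \<times> 'k \<Rightarrow> 'k \<times> 'k \<times> 'k" where
    "g = (\<lambda>((c, d), a). (c, a, d))" and "h = (\<lambda>((c, d), a). (a, c, d))"
  define Q R where "Q = g ` (\<Lambda> \<times> B)" and "R = h ` (\<Lambda> \<times> B)"
  have finQR: "finite Q" "finite R" using \<Lambda> B by (auto simp: Q_def R_def)
  have "inj_on g (\<Lambda> \<times> B)" "inj_on h (\<Lambda> \<times> B)" by (auto simp: inj_on_def g_def h_def)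
  then have cQR: "card Q = card B * card \<Lambda>" "card R = card B * card \<Lambda>"
    unfolding Q_def R_def by (simp_all add: card_image card_cartesian_product)
  have conc: "card \<Lambda>' \<le> k" if "\<Lambda>' \<subseteq> \<Lambda>" "(v1, v3) \<noteq> (0, 0)" "\<And>r s. (r, s) \<in> \<Lambda>' \<Longrightarrow> \<exists>t. r = a1 + t * v1 \<and> s = a3 + t * v3"
    for \<Lambda>' and a1 a3 v1 v3 :: 'k
  proof (rule le_k)
    have "finite \<Lambda>'" using that(1) \<Lambda> finite_subset by blast
    from concurrent_lines_bound[OF B this \<rho> _ that(2,3)] rich that(1)
    show "real (card \<Lambda>') * \<rho> \<le> 2 * N\<^sup>2" unfolding N_def by blast
  qed
  have lineQ: "line_le k Q"
    unfolding line_le_def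
  proof (intro allI impI)
    fix a1 a2 a3 v1 v2 v3 :: 'k
    let ?L = "{q \<in> Q. \<exists>t. q = (a1 + t * v1, a2 + t * v2, a3 + t * v3)}"
    assume v: "(v1, v2, v3) \<noteq> (0, 0, 0)"
    show "card ?L \<le> k"
    proof (cases "v2 = 0")
      case False
      have "card ?L \<le> card B"
        by (rule card_line_le[where \<pi> = "fst \<circ> snd" and v = v2 and a = a2]) (use B False in \<open>auto simp: Q_def g_def\<close>)
      then show ?thesis using Nk by simp
    next
      case True
      define \<Lambda>' where "\<Lambda>' = {(c, d) \<in> \<Lambda>. \<exists>t. c = a1 + t * v1 \<and> d = a3 + t * v3}"
      have "?L \<subseteq> (\<lambda>(c, d). (c, a2, d)) ` \<Lambda>'"
        using True by (force simp: Q_def g_def \<Lambda>'_def)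
      moreover have "finite \<Lambda>'" using \<Lambda> by (rule finite_subset[rotated]) (auto simp: \<Lambda>'_def)
      ultimately have "card ?L \<le> card \<Lambda>'" by (meson card_image_le card_mono finite_imageI le_trans)
      also have "\<dots> \<le> k" by (rule conc[of \<Lambda>' v1 v3 a1 a3]) (use v True in \<open>auto simp: \<Lambda>'_def\<close>)
      finally show ?thesis .
    qed
  qed
  have lineR: "line_le k R"
    unfolding line_le_def
  proof (intro allI impI)
    fix a1 a2 a3 v1 v2 v3 :: 'k
    let ?L = "{q \<in> R. \<exists>t. q = (a1 + t * v1, a2 + t * v2, a3 + t * v3)}"
    assume v: "(v1, v2, v3) \<noteq> (0, 0, 0)"
    show "card ?L \<le> k"
    proof (cases "v1 = 0")
      case False
      have "card ?L \<le> card B"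
        by (rule card_line_le[where \<pi> = fst and v = v1 and a = a1]) (use B False in \<open>auto simp: R_def h_def\<close>)
      then show ?thesis using Nk by simp
    next
      case True
      define \<Lambda>' where "\<Lambda>' = {(c, d) \<in> \<Lambda>. \<exists>t. c = a2 + t * v2 \<and> d = a3 + t * v3}"
      have "?L \<subseteq> (\<lambda>(c, d). (a1, c, d)) ` \<Lambda>'"
        using True by (force simp: R_def h_def \<Lambda>'_def)
      moreover have "finite \<Lambda>'" using \<Lambda> by (rule finite_subset[rotated]) (auto simp: \<Lambda>'_def)
      ultimately have "card ?L \<le> card \<Lambda>'" by (meson card_image_le card_mono finite_imageI le_trans)
      also have "\<dots> \<le> k" by (rule conc[of \<Lambda>' v2 v3 a2 a3]) (use v True in \<open>auto simp: \<Lambda>'_def\<close>)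
      finally show ?thesis .
    qed
  qed
  define W where "W = {(q, r). q \<in> Q \<and> r \<in> R \<and> planar q r}"
  define \<Theta> :: "(('k \<times> 'k) \<times> 'k) \<times> (('k \<times> 'k) \<times> 'k) \<Rightarrow> _" where
    "\<Theta> = (\<lambda>(i, j). (g (fst i, snd j), h (fst j, snd i)))"
  have "card E \<le> card W"
  proof (rule card_inj_on_le[of \<Theta>])
    show "inj_on \<Theta> E" by (auto simp: inj_on_def \<Theta>_def g_def h_def split: prod.splits)
    show "\<Theta> ` E \<subseteq> W"
      unfolding E_def I_def W_def Q_def R_def
      by (auto simp: \<Theta>_def f_def g_def h_def planar_def image_iff split: prod.splits)
    show "finite W" unfolding W_def by (rule finite_subset[of _ "Q \<times> R"]) (use finQR in auto)
  qed
  moreover have "real (card W) \<le> 10 ^ 7 * incbound k (card Q) (card R)"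
    unfolding W_def using inf char finQR lineQ lineR
    by (rule point_plane_incidences) (use sm cQR in auto)
  moreover define M where "M = N * l"
  ultimately have E: "real (card E) \<le> 10 ^ 7 * incbound k M M"
    unfolding cQR M_def N_def l_def by simp
  have fI: "card (f ` I) \<le> card B" using B by (intro card_mono) (auto simp: f_def I_def)
  have "(card I)\<^sup>2 \<le> card (f ` I) * card E" unfolding E_def by (rule card_squared_le_collisions[OF finI])
  also have "\<dots> \<le> card B * card E" using fI by (rule mult_le_mono1)
  finally have "real ((card I)\<^sup>2) \<le> real (card B * card E)" by (simp only: of_nat_le_iff)
  then have CE: "(real (card I))\<^sup>2 \<le> N * real (card E)" by (simp add: N_def)
  have N0: "N \<ge> 2" using \<rho>N \<rho> by simp
  have M0: "M > 0" using N0 l1 by (simp add: M_def)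
  have "(\<rho> * l)\<^sup>2 \<le> (real (card I))\<^sup>2" using I \<rho> l1 by (intro power_mono) auto
  also have "\<dots> \<le> N * real (card E)" by (rule CE)
  also have "\<dots> \<le> N * (10 ^ 7 * (2 * (M * sqrt M) + real k * M))"
    using E N0 M0 by (intro mult_left_mono) (auto simp: incbound_same)
  finally have main: "(\<rho> * l)\<^sup>2 \<le> N * (10 ^ 7 * (2 * (M * sqrt M) + real k * M))" .
  \<comment> \<open>If M^(3/2) dominates, squaring gives the claim after cancelling l^3. If k M
    dominates, one obtains l \<rho>^3 \<le> 4 * 10^7 N^4, and \<rho> \<le> N supplies the last
    factor.\<close>
  have "l * \<rho> ^ 4 \<le> 2 * 10 ^ 15 * N ^ 5"
  proof (cases "real k * M \<le> 2 * (M * sqrt M)")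
    case True
    have "N * (10 ^ 7 * (2 * (M * sqrt M) + real k * M)) \<le> N * (10 ^ 7 * (4 * (M * sqrt M)))"
      using True N0 by (intro mult_left_mono) auto
    then have "(\<rho> * l)\<^sup>2 \<le> 4 * 10 ^ 7 * N * (M * sqrt M)" using main by simp
    then have "((\<rho> * l)\<^sup>2)\<^sup>2 \<le> (4 * 10 ^ 7 * N * (M * sqrt M))\<^sup>2" by (rule power_mono) simp
    also have "\<dots> = 16 * 10 ^ 14 * N\<^sup>2 * (M * M * (sqrt M * sqrt M))"
      by (simp add: power2_eq_square algebra_simps)
    also have "sqrt M * sqrt M = M" using M0 by simp
    finally have "l ^ 3 * (l * \<rho> ^ 4) \<le> l ^ 3 * (16 * 10 ^ 14 * N ^ 5)"
      by (simp add: M_def eval_nat_numeral algebra_simps)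
    then have "l * \<rho> ^ 4 \<le> 16 * 10 ^ 14 * N ^ 5" using l1 by (simp add: mult_le_cancel_left)
    also have "\<dots> \<le> 2 * 10 ^ 15 * N ^ 5" using N0 by (intro mult_right_mono) auto
    finally show ?thesis .
  next
    case False
    have "2 * (M * sqrt M) + real k * M \<le> 2 * (real k * M)" using False by linarith
    then have "N * (10 ^ 7 * (2 * (M * sqrt M) + real k * M)) \<le> N * (10 ^ 7 * (2 * (real k * M)))"
      using N0 by (intro mult_left_mono) auto
    with main have "(\<rho> * l)\<^sup>2 \<le> N * (10 ^ 7 * (2 * (real k * M)))" by (rule order_trans)
    also have "\<dots> = 2 * 10 ^ 7 * N * M * real k" by (simp add: mult_ac)
    finally have "(\<rho> * l)\<^sup>2 \<le> 2 * 10 ^ 7 * N * M * real k" .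
    also have "\<dots> \<le> 2 * 10 ^ 7 * N * M * (2 * N\<^sup>2 / \<rho>)" using kr N0 M0 by (intro mult_left_mono) auto
    finally have "\<rho> * (\<rho> * l)\<^sup>2 \<le> 4 * 10 ^ 7 * N * M * N\<^sup>2" using \<rho> by (simp add: field_simps)
    then have "l * (l * \<rho> ^ 3) \<le> l * (4 * 10 ^ 7 * N ^ 4)"
      by (simp add: M_def eval_nat_numeral algebra_simps)
    then have "l * \<rho> ^ 3 \<le> 4 * 10 ^ 7 * N ^ 4" using l1 by (simp add: mult_le_cancel_left)
    from mult_mono[OF this \<rho>N] have "(l * \<rho> ^ 3) * \<rho> \<le> (4 * 10 ^ 7 * N ^ 4) * N" using \<rho> N0 by simp
    then have "l * \<rho> ^ 4 \<le> 4 * 10 ^ 7 * N ^ 5" by (simp add: eval_nat_numeral algebra_simps)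
    also have "\<dots> \<le> 2 * 10 ^ 15 * N ^ 5" using N0 by (intro mult_right_mono) auto
    finally show ?thesis .
  qed
  then show ?thesis by (simp add: N_def l_def)
qed simp

text \<open>The size condition on the family of lines is removed by passing to a subfamily with just
  one line more than the claimed bound allows: the hypotheses make it small enough for the previous
  estimate, which it contradicts.\<close>

lemma rich_lines_bound:
  fixes B :: "'k::field_gcd set"
  assumes inf: "infinite (UNIV :: 'k set)"
    and char: "\<And>n. 0 < n \<Longrightarrow> n < P \<Longrightarrow> (of_nat n :: 'k) \<noteq> 0"
    and B: "finite B" and \<Lambda>: "finite \<Lambda>" and \<rho>: "\<rho> \<ge> 2"
    and rich: "\<And>r s. (r, s) \<in> \<Lambda> \<Longrightarrow> \<rho> \<le> real (card {b \<in> B. r * b + s \<in> B})"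
    and sm: "4 * 10 ^ 15 * real (card B) ^ 6 \<le> \<rho> ^ 4 * (real P)\<^sup>2" "2 * real (card B) \<le> (real P)\<^sup>2"
  shows "real (card \<Lambda>) \<le> 2 * 10 ^ 15 * real (card B) ^ 5 / \<rho> ^ 4"
proof (rule ccontr)
  define N c where "N = real (card B)" and "c = 2 * 10 ^ 15 * N ^ 5 / \<rho> ^ 4"
  assume "\<not> ?thesis"
  then have big: "c < real (card \<Lambda>)" by (simp add: c_def N_def)
  have c0: "c \<ge> 0" using \<rho> by (simp add: c_def N_def)
  define s where "s = nat \<lfloor>c\<rfloor> + 1"
  have s: "c < real s" "real s \<le> c + 1" using c0 unfolding s_def by linarith+
  have "s \<le> card \<Lambda>" using big c0 unfolding s_def by linarith
  then obtain \<Lambda>' where \<Lambda>': "\<Lambda>' \<subseteq> \<Lambda>" "card \<Lambda>' = s" "finite \<Lambda>'" by (rule obtain_subset_with_card_n)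
  have "N * real s \<le> N * c + N" using s(2) mult_left_mono[of "real s" "c + 1" N] by (simp add: N_def algebra_simps)
  also have "N * c = 2 * 10 ^ 15 * N ^ 6 / \<rho> ^ 4" by (simp add: c_def eval_nat_numeral)
  also have "\<dots> \<le> (real P)\<^sup>2 / 2" using sm(1) \<rho> by (simp add: N_def field_simps)
  also have "(real P)\<^sup>2 / 2 + N \<le> (real P)\<^sup>2" using sm(2) by (simp add: N_def)
  finally have "real (card B * card \<Lambda>') \<le> real (P\<^sup>2)" by (simp add: N_def \<Lambda>')
  then have "card B * card \<Lambda>' \<le> P\<^sup>2" by (simp only: of_nat_le_iff)
  from rich_lines_bound_small[OF inf char B \<Lambda>'(3) \<rho> rich this] \<Lambda>'
  have "real s * \<rho> ^ 4 \<le> 2 * 10 ^ 15 * N ^ 5" unfolding N_def by blast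
  then have "real s \<le> c" using \<rho> by (simp add: c_def pos_le_divide_eq)
  then show False using s(1) by simp
qed

text \<open>Sort by the dyadic level 2^j \<theta> of f. Each level contributes at most 4 K / (2^j
  \<theta>)^e, and for e \<ge> 1 these terms sum to at most twice the first.\<close>

lemma dyadic_sum_squares_le:
  fixes f :: "'a \<Rightarrow> real"
  assumes S: "finite S" and \<theta>: "\<theta> > 0" and f: "\<And>s. s \<in> S \<Longrightarrow> \<theta> \<le> f s" and e: "e \<ge> 1" and K: "K \<ge> 0"
    and lev: "\<And>x. \<theta> \<le> x \<Longrightarrow> real (card {s \<in> S. x \<le> f s}) \<le> K / x ^ (e + 2)"
  shows "(\<Sum>s\<in>S. (f s)\<^sup>2) \<le> 8 * K / \<theta> ^ e"
proof -
  define x where "x = (\<lambda>j::nat. 2 ^ j * \<theta>)"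
  have x: "\<theta> \<le> x j" "0 < x j" for j using \<theta> by (auto simp: x_def)
  obtain J where J: "\<And>s. s \<in> S \<Longrightarrow> f s < x J"
  proof -
    have "\<exists>J. (\<Sum>s\<in>S. f s) / \<theta> < 2 ^ J" using real_arch_pow[of 2 "(\<Sum>s\<in>S. f s) / \<theta>"] by simp
    then obtain J where "(\<Sum>s\<in>S. f s) / \<theta> < 2 ^ J" by blast
    then have "(\<Sum>s\<in>S. f s) < x J" using \<theta> by (simp add: x_def pos_divide_less_eq)
    moreover have "f s \<le> (\<Sum>s\<in>S. f s)" if "s \<in> S" for s
      using that S f \<theta> by (intro member_le_sum) (auto intro: order_trans[OF less_imp_le])
    ultimately have "f s < x J" if "s \<in> S" for s using that by (meson le_less_trans)
    then show ?thesis by (rule that)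
  qed
  have pt: "(f s)\<^sup>2 \<le> (\<Sum>j<J. if x j \<le> f s then 4 * (x j)\<^sup>2 else 0)" if s: "s \<in> S" for s
  proof -
    define j where "j = (LEAST j. f s < x (Suc j))"
    have "f s < x (Suc J)" using J[OF s] x(2)[of J] by (simp add: x_def)
    then have j1: "f s < x (Suc j)" unfolding j_def by (rule LeastI)
    have j2: "x j \<le> f s"
    proof (cases j)
      case 0
      then show ?thesis using f[OF s] by (simp add: x_def)
    next
      case (Suc i)
      then show ?thesis using not_less_Least[of i "\<lambda>j. f s < x (Suc j)"] j_def by auto
    qed
    have "j < J"
    proof (rule ccontr)
      assume "\<not> j < J"
      then have "x J \<le> x j" using \<theta> by (simp add: x_def)
      then show False using j2 J[OF s] by simp
    qed
    have "0 \<le> f s" using f[OF s] \<theta> by simp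
    then have "(f s)\<^sup>2 \<le> (x (Suc j))\<^sup>2" using j1 by (intro power_mono) auto
    also have "\<dots> = (if x j \<le> f s then 4 * (x j)\<^sup>2 else 0)" using j2 by (simp add: x_def power2_eq_square)
    also have "\<dots> \<le> (\<Sum>j<J. if x j \<le> f s then 4 * (x j)\<^sup>2 else 0)"
      using \<open>j < J\<close> by (intro member_le_sum) auto
    finally show ?thesis .
  qed
  have "(\<Sum>s\<in>S. (f s)\<^sup>2) \<le> (\<Sum>s\<in>S. \<Sum>j<J. if x j \<le> f s then 4 * (x j)\<^sup>2 else 0)" using pt by (rule sum_mono)
  also have "\<dots> = (\<Sum>j<J. \<Sum>s\<in>S. if x j \<le> f s then 4 * (x j)\<^sup>2 else 0)" by (rule sum.swap)
  also have "\<dots> = (\<Sum>j<J. real (card {s \<in> S. x j \<le> f s}) * (4 * (x j)\<^sup>2))"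
    using S by (simp add: sum.If_cases Int_def)
  also have "\<dots> \<le> (\<Sum>j<J. K / (x j) ^ (e + 2) * (4 * (x j)\<^sup>2))"
    using lev x by (intro sum_mono mult_right_mono) auto
  also have "\<dots> \<le> (\<Sum>j<J. (4 * K / \<theta> ^ e) * (1 / 2) ^ j)"
  proof (rule sum_mono)
    fix j
    have "K / (x j) ^ (e + 2) * (4 * (x j)\<^sup>2) = 4 * K / (x j) ^ e"
      using x(2)[of j] by (simp add: power_add power2_eq_square)
    also have "(x j) ^ e = (2 ^ j) ^ e * \<theta> ^ e" by (simp add: x_def power_mult_distrib)
    also have "4 * K / ((2 ^ j) ^ e * \<theta> ^ e) \<le> 4 * K / (2 ^ j * \<theta> ^ e)"
      using K \<theta> self_le_power[of "2 ^ j :: real" e] e by (intro divide_left_mono mult_right_mono mult_pos_pos) auto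
    also have "\<dots> = (4 * K / \<theta> ^ e) * (1 / 2) ^ j" by (simp add: field_simps power_divide)
    finally show "K / (x j) ^ (e + 2) * (4 * (x j)\<^sup>2) \<le> (4 * K / \<theta> ^ e) * (1 / 2) ^ j" .
  qed
  also have "\<dots> = (4 * K / \<theta> ^ e) * (\<Sum>j<J. (1 / 2) ^ j)" by (simp add: sum_distrib_left)
  also have "\<dots> \<le> (4 * K / \<theta> ^ e) * 2"
    using K \<theta> by (intro mult_left_mono) (auto simp: sum_gp_strict)
  finally show ?thesis by simp
qed

section \<open>Products of sums in the prime subfield\<close>

text \<open>\<open>U\<close> plays the role of F_p inside the infinite field. A collision (a + b)(c
  + d) = (a' + b')(c' + d') yields one ratio r for two equations a + b = r (a' + b') and c' + d' = r
  (c + d). The solutions of each are at most G(r), the additive energy of \<open>B\<close> and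
  \<open>r B\<close>, so the collisions number at most the sum of G(r)^2. This is at most 5 N^8/q,
  of the order of its average-case value.\<close>

theorem product_of_sumsets:
  fixes B U :: "'k::field_gcd set"
  assumes inf: "infinite (UNIV :: 'k set)"
    and char: "\<And>n. 0 < n \<Longrightarrow> n < p \<Longrightarrow> (of_nat n :: 'k) \<noteq> 0" and p: "p \<ge> 2"
    and U: "finite U" "card U = p" "0 \<in> U"
      "\<And>a b. a \<in> U \<Longrightarrow> b \<in> U \<Longrightarrow> a - b \<in> U" "\<And>a b. a \<in> U \<Longrightarrow> b \<in> U \<Longrightarrow> a * b \<in> U"
      "\<And>a b. a \<in> U \<Longrightarrow> b \<in> U \<Longrightarrow> a / b \<in> U"
    and B: "B \<subseteq> U" "10 ^ 19 * real p ^ 3 \<le> real (card B) ^ 5"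
  shows "real p / 80 \<le> real (card ((\<lambda>((a, b), (c, d)). (a + b) * (c + d)) ` ((B \<times> B) \<times> (B \<times> B))))"
proof -
  define N q where "N = real (card B)" and "q = real p"
  have finB: "finite B" using B(1) U(1) finite_subset by blast
  have q2: "q \<ge> 2" using p by (simp add: q_def)
  have big: "10 ^ 19 * q ^ 3 \<le> N ^ 5" using B(2) by (simp add: N_def q_def)
  have Nq: "N \<le> q" using card_mono[OF U(1) B(1)] U(2) by (simp add: N_def q_def)
  have N2: "N \<ge> 2"
  proof (rule ccontr)
    assume "\<not> N \<ge> 2"
    then have "N ^ 5 \<le> 2 ^ 5" by (intro power_mono) (auto simp: N_def)
    moreover have "(10::real) ^ 19 * 1 \<le> 10 ^ 19 * q ^ 3" using q2 by (intro mult_left_mono) auto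
    ultimately show False using big by simp
  qed
  define \<rho> where "\<rho> = (\<lambda>r s. card {b \<in> B. r * b + s \<in> B})"
  define L where "L = (\<lambda>r s. {(b, b'). b \<in> B \<and> b' \<in> B \<and> b - r * b' = s})"
  have finL: "finite (L r s)" for r s by (rule finite_subset[of _ "B \<times> B"]) (use finB in \<open>auto simp: L_def\<close>)
  define G where "G = (\<lambda>r. \<Sum>s\<in>U. (real (\<rho> r s))\<^sup>2)"
  have Uneg: "- a \<in> U" if "a \<in> U" for a using U(4)[OF U(3) that] by simp
  have Uadd: "a + b \<in> U" if "a \<in> U" "b \<in> U" for a b using U(4)[OF that(1) Uneg[OF that(2)]] by simp
  have Uin: "b - r * b' \<in> U" if "r \<in> U" "b \<in> B" "b' \<in> B" for r b b'
    using that B(1) by (intro U(4) U(5)) auto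
  have \<rho>_pairs: "\<rho> r s = card (L r s)" for r s
  proof -
    have "L r s = (\<lambda>b'. (r * b' + s, b')) ` {b \<in> B. r * b + s \<in> B}"
      by (auto simp: L_def image_iff algebra_simps)
    then show ?thesis by (simp add: \<rho>_def card_image inj_on_def)
  qed
  have L_disj: "L r s \<inter> L r s' = {}" if "s \<noteq> s'" for r s s' using that by (auto simp: L_def)
  have sum_\<rho>: "(\<Sum>s\<in>U. real (\<rho> r s)) = N\<^sup>2" if r: "r \<in> U" for r
  proof -
    have "B \<times> B = (\<Union>s\<in>U. L r s)" using Uin r by (auto simp: L_def)
    also have "card \<dots> = (\<Sum>s\<in>U. card (L r s))"
      using U(1) finL L_disj by (intro card_UN_disjoint) auto
    finally have "real (card (B \<times> B)) = (\<Sum>s\<in>U. real (\<rho> r s))" by (simp only: \<rho>_pairs of_nat_sum)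
    then show ?thesis by (simp add: N_def card_cartesian_product power2_eq_square)
  qed
  have G_low: "N ^ 4 / q \<le> G r" if r: "r \<in> U" for r
  proof -
    have "(\<Sum>s\<in>U. real (\<rho> r s))\<^sup>2 \<le> G r * q"
      unfolding G_def q_def U(2)[symmetric] by (rule sum_squared_le_sum_of_squares)
    then show ?thesis unfolding sum_\<rho>[OF r] using q2 by (simp add: pos_divide_le_eq)
  qed
  \<comment> \<open>Two equal pairs solve the equation for every r, which gives q N^2; two different
    pairs determine r, which gives at most N^4.\<close>
  have sumG: "(\<Sum>r\<in>U. G r) \<le> q * N\<^sup>2 + N ^ 4"
  proof -
    define Z where "Z = {(r, (b, b'), (c, c')). r \<in> U \<and> b \<in> B \<and> b' \<in> B \<and> c \<in> B \<and> c' \<in> B \<and> b - r * b' = c - r * c'}"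
    have ZS: "Z \<subseteq> U \<times> (B \<times> B) \<times> (B \<times> B)" by (auto simp: Z_def)
    have "Z = (SIGMA r:U. \<Union>s\<in>U. L r s \<times> L r s)"
      using Uin by (auto simp: Z_def L_def)
    also have "card \<dots> = (\<Sum>r\<in>U. card (\<Union>s\<in>U. L r s \<times> L r s))"
      using U(1) finL by (intro card_SigmaI) auto
    also have "\<dots> = (\<Sum>r\<in>U. \<Sum>s\<in>U. card (L r s \<times> L r s))"
    proof (rule sum.cong[OF refl])
      fix r
      have "(L r s \<times> L r s) \<inter> (L r s' \<times> L r s') = {}" if "s \<noteq> s'" for s s' using L_disj[OF that, of r] by auto
      then show "card (\<Union>s\<in>U. L r s \<times> L r s) = (\<Sum>s\<in>U. card (L r s \<times> L r s))"
        using U(1) finL by (intro card_UN_disjoint) auto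
    qed
    finally have cZ: "real (card Z) = (\<Sum>r\<in>U. G r)"
      by (simp only: G_def \<rho>_pairs card_cartesian_product power2_eq_square of_nat_sum of_nat_mult)
    define Z1 where "Z1 = (\<lambda>(r, b, b'). (r, (b, b'), (b, b'))) ` (U \<times> B \<times> B)"
    define Z2 where "Z2 = (\<lambda>((b, b'), (c, c')). ((b - c) / (b' - c'), (b, b'), (c, c'))) ` ((B \<times> B) \<times> (B \<times> B))"
    have "Z \<subseteq> Z1 \<union> Z2"
    proof
      fix z assume "z \<in> Z"
      then obtain r b b' c c' where z: "z = (r, (b, b'), (c, c'))" and h: "r \<in> U" "b \<in> B" "b' \<in> B" "c \<in> B" "c' \<in> B" "b - r * b' = c - r * c'"
        by (auto simp: Z_def)
      have eq: "b - c = r * (b' - c')" using h(6) by (simp add: algebra_simps)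
      show "z \<in> Z1 \<union> Z2"
      proof (cases "b' = c'")
        case True
        then show ?thesis using eq h z by (auto simp: Z1_def image_iff)
      next
        case False
        then have "r = (b - c) / (b' - c')" using eq by (simp add: nonzero_eq_divide_eq)
        then show ?thesis using h z unfolding Z2_def by (intro UnI2 image_eqI[of _ _ "((b, b'), (c, c'))"]) auto
      qed
    qed
    then have "card Z \<le> card (Z1 \<union> Z2)" using U(1) finB by (intro card_mono) (auto simp: Z1_def Z2_def)
    also have "\<dots> \<le> card Z1 + card Z2" by (rule card_Un_le)
    also have "\<dots> \<le> card (U \<times> B \<times> B) + card ((B \<times> B) \<times> (B \<times> B))"
      unfolding Z1_def Z2_def using U(1) finB by (intro add_mono card_image_le) auto
    finally have "real (card Z) \<le> real (card (U \<times> B \<times> B) + card ((B \<times> B) \<times> (B \<times> B)))" by (simp only: of_nat_le_iff)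
    then show ?thesis unfolding cZ by (simp add: card_cartesian_product U(2) N_def q_def eval_nat_numeral)
  qed
  \<comment> \<open>The cut between typical and exceptional ratios, chosen so that \<tau> q N^2 =
    N^8/q: the excess of typical energies over the mean then costs no more than the main
    term.\<close>
  define \<tau> where "\<tau> = N ^ 6 / q\<^sup>2"
  have \<tau>0: "\<tau> > 0" using N2 q2 by (simp add: \<tau>_def)
  define C where "C = (2 * 10 ^ 15 :: real)"
  have levG: "real (card {r \<in> U. E \<le> G r}) \<le> 64 * C * N ^ 9 / E ^ 3" if E: "\<tau> \<le> E" for E
  proof -
    have E0: "E > 0" using E \<tau>0 by simp
    \<comment> \<open>Lines of slope r with fewer than \<rho>0 points contribute at most \<rho>0 N^2
      = E/2 to G(r), so the richer ones carry at least half of the energy.\<close>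
    define \<rho>0 where "\<rho>0 = E / (2 * N\<^sup>2)"
    define R where "R = {r \<in> U. E \<le> G r}"
    define \<Lambda> where "\<Lambda> = {(r, s). r \<in> U \<and> s \<in> U \<and> \<rho>0 \<le> real (\<rho> r s)}"
    have fin\<Lambda>: "finite \<Lambda>" by (rule finite_subset[of _ "U \<times> U"]) (use U in \<open>auto simp: \<Lambda>_def\<close>)
    have \<rho>0pos: "\<rho>0 > 0" using E0 N2 by (simp add: \<rho>0_def)
    \<comment> \<open>With this lower bound for \<rho>0, the size condition for rich lines reduces
      to N^10 \<ge> 64 * 10^15 q^6, which follows from the hypothesis on |B|.\<close>
    have "N ^ 4 / (2 * q\<^sup>2) \<le> \<rho>0"
    proof -
      have "N ^ 4 / (2 * q\<^sup>2) = \<tau> / (2 * N\<^sup>2)" using N2 by (simp add: \<tau>_def eval_nat_numeral field_simps)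
      also have "\<dots> \<le> \<rho>0" unfolding \<rho>0_def using E N2 by (intro divide_right_mono) auto
      finally show ?thesis .
    qed
    then have "(N ^ 4 / (2 * q\<^sup>2)) ^ 4 \<le> \<rho>0 ^ 4" using N2 q2 by (intro power_mono) auto
    then have "N ^ 16 / (16 * q ^ 8) * q\<^sup>2 \<le> \<rho>0 ^ 4 * q\<^sup>2"
      using q2 by (intro mult_right_mono) (auto simp: power_divide power_mult_distrib simp flip: power_mult)
    moreover have "4 * 10 ^ 15 * N ^ 6 \<le> N ^ 16 / (16 * q ^ 8) * q\<^sup>2"
    proof -
      have "(10 ^ 19 * q ^ 3)\<^sup>2 \<le> (N ^ 5)\<^sup>2" using big q2 by (intro power_mono) auto
      then have "10 ^ 38 * q ^ 6 \<le> N ^ 10" by (simp add: power_mult_distrib flip: power_mult)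
      moreover have "64 * 10 ^ 15 * q ^ 6 \<le> 10 ^ 38 * q ^ 6" using q2 by (intro mult_right_mono) auto
      ultimately have "64 * 10 ^ 15 * q ^ 6 \<le> N ^ 10" by (rule order_trans[rotated])
      from mult_right_mono[OF this, of "N ^ 6"] have "(64 * 10 ^ 15 * q ^ 6) * N ^ 6 \<le> N ^ 10 * N ^ 6" using N2 by simp
      then have "64 * 10 ^ 15 * N ^ 6 * q ^ 6 \<le> N ^ 16" by (simp add: mult_ac flip: power_add)
      then have "4 * 10 ^ 15 * N ^ 6 \<le> N ^ 16 / (16 * q ^ 6)" using q2 by (simp add: pos_le_divide_eq)
      also have "\<dots> = N ^ 16 / (16 * q ^ 8) * q\<^sup>2" using q2 by (simp add: eval_nat_numeral)
      finally show ?thesis .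
    qed
    ultimately have \<rho>0big: "4 * 10 ^ 15 * N ^ 6 \<le> \<rho>0 ^ 4 * q\<^sup>2" by linarith
    have \<rho>02: "\<rho>0 \<ge> 2"
    proof (rule ccontr)
      assume "\<not> \<rho>0 \<ge> 2"
      then have "\<rho>0 ^ 4 \<le> 2 ^ 4" using \<rho>0pos by (intro power_mono) auto
      then have "\<rho>0 ^ 4 * q\<^sup>2 \<le> 16 * q\<^sup>2" by (intro mult_right_mono) auto
      also have "q\<^sup>2 \<le> q ^ 3" using q2 by (intro power_increasing) auto
      also have "16 * q ^ 3 \<le> 10 ^ 19 * q ^ 3" using q2 by (intro mult_right_mono) auto
      also have "\<dots> \<le> N ^ 5" by (rule big)
      also have "N ^ 5 \<le> N ^ 6" using N2 by (intro power_increasing) auto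
      also have "N ^ 6 < 4 * 10 ^ 15 * N ^ 6" using N2 by simp
      finally show False using \<rho>0big by simp
    qed
    have lev: "real (card {l \<in> \<Lambda>. x \<le> real (\<rho> (fst l) (snd l))}) \<le> C * N ^ 5 / x ^ (2 + 2)" if x: "\<rho>0 \<le> x" for x
    proof -
      have "real (card {l \<in> \<Lambda>. x \<le> real (\<rho> (fst l) (snd l))}) \<le> 2 * 10 ^ 15 * real (card B) ^ 5 / x ^ 4"
        using inf char finB
      proof (rule rich_lines_bound)
        show "finite {l \<in> \<Lambda>. x \<le> real (\<rho> (fst l) (snd l))}" using fin\<Lambda> by simp
        show "2 \<le> x" using x \<rho>02 by simp
        show "x \<le> real (card {b \<in> B. r * b + s \<in> B})" if "(r, s) \<in> {l \<in> \<Lambda>. x \<le> real (\<rho> (fst l) (snd l))}" for r s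
          using that by (simp add: \<rho>_def)
        have "\<rho>0 ^ 4 * q\<^sup>2 \<le> x ^ 4 * q\<^sup>2" using x \<rho>0pos by (intro mult_right_mono power_mono) auto
        then show "4 * 10 ^ 15 * real (card B) ^ 6 \<le> x ^ 4 * (real p)\<^sup>2" using \<rho>0big unfolding N_def q_def by linarith
        have "2 * N \<le> q * q" using Nq q2 N2 by (intro mult_mono) auto
        then show "2 * real (card B) \<le> (real p)\<^sup>2" by (simp add: N_def q_def power2_eq_square)
      qed
      then show ?thesis by (simp add: C_def N_def)
    qed
    have "(\<Sum>l\<in>\<Lambda>. (real (\<rho> (fst l) (snd l)))\<^sup>2) \<le> 8 * (C * N ^ 5) / \<rho>0 ^ 2"
      by (rule dyadic_sum_squares_le[OF fin\<Lambda> \<rho>0pos _ _ _ lev]) (use N2 in \<open>auto simp: \<Lambda>_def C_def\<close>)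
    moreover have "real (card R) * (E / 2) \<le> (\<Sum>l\<in>\<Lambda>. (real (\<rho> (fst l) (snd l)))\<^sup>2)"
    proof -
      have finR: "finite R" using U(1) by (simp add: R_def)
      have "E / 2 \<le> (\<Sum>s\<in>{s \<in> U. \<rho>0 \<le> real (\<rho> r s)}. (real (\<rho> r s))\<^sup>2)" if r: "r \<in> R" for r
      proof -
        have rU: "r \<in> U" using r by (simp add: R_def)
        have "E \<le> G r" using r by (simp add: R_def)
        also have "G r = (\<Sum>s\<in>{s \<in> U. \<rho>0 \<le> real (\<rho> r s)}. (real (\<rho> r s))\<^sup>2) + (\<Sum>s\<in>{s \<in> U. \<not> \<rho>0 \<le> real (\<rho> r s)}. (real (\<rho> r s))\<^sup>2)"
          unfolding G_def using U(1) by (subst sum.union_disjoint[symmetric]) (auto intro: sum.cong)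
        also have "(\<Sum>s\<in>{s \<in> U. \<not> \<rho>0 \<le> real (\<rho> r s)}. (real (\<rho> r s))\<^sup>2) \<le> (\<Sum>s\<in>{s \<in> U. \<not> \<rho>0 \<le> real (\<rho> r s)}. \<rho>0 * real (\<rho> r s))"
          unfolding power2_eq_square by (intro sum_mono mult_right_mono) auto
        also have "\<dots> \<le> (\<Sum>s\<in>U. \<rho>0 * real (\<rho> r s))" using U(1) \<rho>0pos by (intro sum_mono2) auto
        also have "\<dots> = \<rho>0 * N\<^sup>2" using sum_\<rho>[OF rU] by (simp flip: sum_distrib_left)
        also have "\<dots> = E / 2" using N2 by (simp add: \<rho>0_def)
        finally show ?thesis by simp
      qed
      then have "(\<Sum>r\<in>R. E / 2) \<le> (\<Sum>r\<in>R. \<Sum>s\<in>{s \<in> U. \<rho>0 \<le> real (\<rho> r s)}. (real (\<rho> r s))\<^sup>2)" by (rule sum_mono)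
      also have "\<dots> = (\<Sum>(r, s)\<in>(SIGMA r:R. {s \<in> U. \<rho>0 \<le> real (\<rho> r s)}). (real (\<rho> r s))\<^sup>2)"
        using finR U(1) by (intro sum.Sigma) auto
      also have "\<dots> \<le> (\<Sum>l\<in>\<Lambda>. (real (\<rho> (fst l) (snd l)))\<^sup>2)"
        unfolding case_prod_beta using fin\<Lambda> by (intro sum_mono2) (auto simp: \<Lambda>_def R_def)
      finally show ?thesis by simp
    qed
    ultimately have "real (card R) * (E / 2) \<le> 8 * (C * N ^ 5) / \<rho>0\<^sup>2" by linarith
    also have "\<dots> = (64 * C * N ^ 9 / E ^ 3) * (E / 2)"
      using E0 N2 by (simp add: \<rho>0_def field_simps eval_nat_numeral)
    finally have "real (card R) \<le> 64 * C * N ^ 9 / E ^ 3" by (rule mult_right_le_imp_le) (use E0 in simp)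
    then show ?thesis by (simp only: R_def)
  qed
  have sumG2: "(\<Sum>r\<in>U. (G r)\<^sup>2) \<le> 5 * N ^ 8 / q"
  proof -
    define V where "V = {r \<in> U. \<tau> \<le> G r}"
    have "(\<Sum>r\<in>V. (G r)\<^sup>2) \<le> 8 * (64 * C * N ^ 9) / \<tau> ^ 1"
    proof (rule dyadic_sum_squares_le)
      fix x assume x: "\<tau> \<le> x"
      have "{s \<in> V. x \<le> G s} = {r \<in> U. x \<le> G r}" using x by (auto simp: V_def)
      then show "real (card {s \<in> V. x \<le> G s}) \<le> 64 * C * N ^ 9 / x ^ (1 + 2)"
        using levG[OF x] by (simp add: eval_nat_numeral)
    qed (use U(1) \<tau>0 N2 in \<open>auto simp: V_def C_def\<close>)
    also have "\<dots> = 512 * C * (N ^ 3 * q\<^sup>2)" using N2 q2 by (simp add: \<tau>_def field_simps eval_nat_numeral)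
    also have "\<dots> \<le> N ^ 8 / q"
    proof -
      have "512 * C * (N ^ 3 * q\<^sup>2) * q = 512 * C * q ^ 3 * N ^ 3" by (simp add: eval_nat_numeral)
      also have "\<dots> \<le> 10 ^ 19 * q ^ 3 * N ^ 3" unfolding C_def using q2 N2 by (intro mult_right_mono) auto
      also have "\<dots> \<le> N ^ 5 * N ^ 3" using big N2 by (intro mult_right_mono) auto
      also have "\<dots> = N ^ 8" by (simp flip: power_add)
      finally show ?thesis using q2 by (simp add: pos_le_divide_eq)
    qed
    finally have V: "(\<Sum>r\<in>V. (G r)\<^sup>2) \<le> N ^ 8 / q" .
    define D where "D = N ^ 4 / q"
    \<comment> \<open>All energies are at least D = N^4/q, and their total excess over D is at most
      q N^2. Below \<tau> the square of the excess is at most \<tau> times the excess.\<close>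
    have "(\<Sum>r\<in>U - V. (G r)\<^sup>2) \<le> (\<Sum>r\<in>U - V. 2 * D\<^sup>2 + 2 * (\<tau> * (G r - D)))"
    proof (rule sum_mono)
      fix r assume r: "r \<in> U - V"
      have d: "0 \<le> G r - D" using G_low r by (simp add: D_def)
      have "0 \<le> D" using N2 q2 by (simp add: D_def)
      then have "(G r - D)\<^sup>2 \<le> \<tau> * (G r - D)"
        unfolding power2_eq_square using r d by (intro mult_right_mono) (auto simp: V_def)
      moreover have "(G r)\<^sup>2 \<le> 2 * D\<^sup>2 + 2 * (G r - D)\<^sup>2"
        using zero_le_power2[of "G r - 2 * D"] by (simp add: power2_eq_square algebra_simps)
      ultimately show "(G r)\<^sup>2 \<le> 2 * D\<^sup>2 + 2 * (\<tau> * (G r - D))" by linarith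
    qed
    also have "\<dots> \<le> (\<Sum>r\<in>U. 2 * D\<^sup>2 + 2 * (\<tau> * (G r - D)))"
      using U(1) \<tau>0 G_low by (intro sum_mono2) (auto simp: D_def intro!: add_nonneg_nonneg)
    also have "\<dots> = q * (2 * D\<^sup>2) + 2 * (\<tau> * ((\<Sum>r\<in>U. G r) - q * D))"
      by (simp add: sum.distrib sum_subtractf U(2) q_def flip: sum_distrib_left)
    also have "\<dots> \<le> q * (2 * D\<^sup>2) + 2 * (\<tau> * (q * N\<^sup>2))"
      using sumG \<tau>0 q2 by (intro add_left_mono mult_left_mono) (auto simp: D_def)
    also have "\<dots> = 4 * N ^ 8 / q" using q2 by (simp add: D_def \<tau>_def field_simps eval_nat_numeral)
    finally have "(\<Sum>r\<in>U - V. (G r)\<^sup>2) \<le> 4 * N ^ 8 / q" .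
    moreover have "(\<Sum>r\<in>U. (G r)\<^sup>2) = (\<Sum>r\<in>U - V. (G r)\<^sup>2) + (\<Sum>r\<in>V. (G r)\<^sup>2)"
      by (rule sum.subset_diff) (use U(1) in \<open>auto simp: V_def\<close>)
    ultimately show ?thesis using V by simp
  qed
  \<comment> \<open>Only nonzero sums are kept, so that the ratios make sense; this retains at least
    half of the pairs.\<close>
  define Z where "Z = {(a, b). a \<in> B \<and> b \<in> B \<and> a + b \<noteq> 0}"
  have finZ: "finite Z" by (rule finite_subset[of _ "B \<times> B"]) (use finB in \<open>auto simp: Z_def\<close>)
  have cZ: "N\<^sup>2 / 2 \<le> real (card Z)"
  proof -
    define Z0 where "Z0 = {(a, b). a \<in> B \<and> b \<in> B \<and> a + b = 0}"
    have "B \<times> B = Z \<union> Z0" by (auto simp: Z_def Z0_def)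
    then have "card (B \<times> B) = card (Z \<union> Z0)" by (simp only:)
    also have "\<dots> \<le> card Z + card Z0" by (rule card_Un_le)
    also have "card Z0 \<le> card B"
      by (rule card_inj_on_le[of fst]) (use finB in \<open>auto simp: Z0_def inj_on_def add_eq_0_iff\<close>)
    finally have "real (card (B \<times> B)) \<le> real (card Z + card B)" by (simp only: of_nat_le_iff)
    then have "N * N \<le> real (card Z) + N" by (simp add: card_cartesian_product N_def)
    moreover have "2 * N \<le> N * N" using N2 by (intro mult_right_mono) auto
    ultimately show ?thesis by (simp add: power2_eq_square)
  qed
  define H where "H = (\<lambda>r. {((a, b), (c, d)). (a, b) \<in> Z \<and> (c, d) \<in> Z \<and> a + b = r * (c + d)})"
  have finH: "finite (H r)" for r by (rule finite_subset[of _ "Z \<times> Z"]) (use finZ in \<open>auto simp: H_def\<close>)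
  have HG: "real (card (H r)) \<le> G r" if r: "r \<in> U" for r
  proof -
    have "card (H r) \<le> card (SIGMA s:U. L r s \<times> L r (- s))"
    proof (rule card_inj_on_le[of "\<lambda>((a, b), (c, d)). (a - r * c, (a, c), (b, d))"])
      \<comment> \<open>From a + b = r (c + d) follows a - r c = -(b - r d), so solutions pair
        representations of s with representations of -s.\<close>
      show "inj_on (\<lambda>((a, b), (c, d)). (a - r * c, (a, c), (b, d))) (H r)" by (auto simp: inj_on_def)
      show "(\<lambda>((a, b), (c, d)). (a - r * c, (a, c), (b, d))) ` H r \<subseteq> (SIGMA s:U. L r s \<times> L r (- s))"
        using Uin[OF r] by (auto simp: H_def Z_def L_def algebra_simps)
      show "finite (SIGMA s:U. L r s \<times> L r (- s))" using U(1) finL by auto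
    qed
    also have "\<dots> = (\<Sum>s\<in>U. card (L r s \<times> L r (- s)))" using U(1) finL by (intro card_SigmaI) auto
    finally have "real (card (H r)) \<le> (\<Sum>s\<in>U. real (\<rho> r s) * real (\<rho> r (- s)))"
      by (simp only: card_cartesian_product \<rho>_pairs of_nat_mult[symmetric] of_nat_sum[symmetric] of_nat_le_iff)
    also have "\<dots> \<le> (\<Sum>s\<in>U. ((real (\<rho> r s))\<^sup>2 + (real (\<rho> r (- s)))\<^sup>2) / 2)"
    proof (rule sum_mono)
      fix s
      show "real (\<rho> r s) * real (\<rho> r (- s)) \<le> ((real (\<rho> r s))\<^sup>2 + (real (\<rho> r (- s)))\<^sup>2) / 2"
        using sum_squares_bound[of "real (\<rho> r s)" "real (\<rho> r (- s))"] by simp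
    qed
    also have "\<dots> = (G r + (\<Sum>s\<in>U. (real (\<rho> r (- s)))\<^sup>2)) / 2"
      by (simp add: G_def sum.distrib add_divide_distrib sum_divide_distrib)
    also have "(\<Sum>s\<in>U. (real (\<rho> r (- s)))\<^sup>2) = G r"
      unfolding G_def by (rule sum.reindex_bij_witness[of _ uminus uminus]) (auto intro: Uneg)
    finally show ?thesis by simp
  qed
  define I where "I = Z \<times> Z"
  define f :: "('k \<times> 'k) \<times> ('k \<times> 'k) \<Rightarrow> 'k" where "f = (\<lambda>((a, b), (c, d)). (a + b) * (c + d))"
  define J where "J = {(i, j). i \<in> I \<and> j \<in> I \<and> f i = f j}"
  have finI: "finite I" using finZ by (simp add: I_def)
  have "card J \<le> card (SIGMA r:U. H r \<times> H r)"
  proof (rule card_inj_on_le[of "\<lambda>((x, y), (x', y')). ((fst x + snd x) / (fst x' + snd x'), ((x, x'), (y', y)))"])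
    show "inj_on (\<lambda>((x, y), (x', y')). ((fst x + snd x) / (fst x' + snd x'), ((x, x'), (y', y)))) J"
      by (auto simp: inj_on_def)
    show "(\<lambda>((x, y), (x', y')). ((fst x + snd x) / (fst x' + snd x'), ((x, x'), (y', y)))) ` J \<subseteq> (SIGMA r:U. H r \<times> H r)"
    proof
      fix w assume "w \<in> (\<lambda>((x, y), (x', y')). ((fst x + snd x) / (fst x' + snd x'), ((x, x'), (y', y)))) ` J"
      then obtain a b c d a' b' c' d' where w: "w = ((a + b) / (a' + b'), (((a, b), (a', b')), ((c', d'), (c, d))))"
        and h: "(((a, b), (c, d)), ((a', b'), (c', d'))) \<in> J" by auto
      from h have Z4: "(a, b) \<in> Z" "(c, d) \<in> Z" "(a', b') \<in> Z" "(c', d') \<in> Z" and eq: "(a + b) * (c + d) = (a' + b') * (c' + d')"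
        by (auto simp: J_def I_def f_def)
      have nz: "a' + b' \<noteq> 0" "c + d \<noteq> 0" using Z4 by (auto simp: Z_def)
      have "(a + b) / (a' + b') \<in> U" using Z4 Uadd B(1) by (intro U(6)) (auto simp: Z_def)
      moreover have "a + b = (a + b) / (a' + b') * (a' + b')" using nz by simp
      moreover have "c' + d' = (a + b) / (a' + b') * (c + d)" using eq nz by (simp add: field_simps)
      ultimately show "w \<in> (SIGMA r:U. H r \<times> H r)" using Z4 by (simp add: w H_def)
    qed
    show "finite (SIGMA r:U. H r \<times> H r)" using U(1) finH by auto
  qed
  also have "\<dots> = (\<Sum>r\<in>U. card (H r \<times> H r))" using U(1) finH by (intro card_SigmaI) auto
  finally have "real (card J) \<le> real (\<Sum>r\<in>U. card (H r \<times> H r))" by (simp only: of_nat_le_iff)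
  also have "\<dots> = (\<Sum>r\<in>U. (real (card (H r)))\<^sup>2)" by (simp add: card_cartesian_product power2_eq_square)
  also have "\<dots> \<le> (\<Sum>r\<in>U. (G r)\<^sup>2)" using HG by (intro sum_mono power_mono) auto
  also have "\<dots> \<le> 5 * N ^ 8 / q" by (rule sumG2)
  finally have J: "real (card J) \<le> 5 * N ^ 8 / q" .
  have "(card I)\<^sup>2 \<le> card (f ` I) * card J" unfolding J_def by (rule card_squared_le_collisions[OF finI])
  then have "real ((card I)\<^sup>2) \<le> real (card (f ` I) * card J)" by (simp only: of_nat_le_iff)
  then have "(real (card Z) * real (card Z))\<^sup>2 \<le> real (card (f ` I)) * real (card J)"
    by (simp add: I_def card_cartesian_product)
  also have "\<dots> \<le> real (card (f ` I)) * (5 * N ^ 8 / q)" using J by (intro mult_left_mono) auto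
  finally have up: "(real (card Z) * real (card Z))\<^sup>2 \<le> real (card (f ` I)) * (5 * N ^ 8 / q)" .
  \<comment> \<open>The constant: (N^4/4)^2 divided by 5 N^8/q is q/80.\<close>
  have "(N\<^sup>2 / 2 * (N\<^sup>2 / 2))\<^sup>2 \<le> (real (card Z) * real (card Z))\<^sup>2" using cZ by (intro power_mono mult_mono) auto
  also have "(N\<^sup>2 / 2 * (N\<^sup>2 / 2))\<^sup>2 = q / 80 * (5 * N ^ 8 / q)" using q2 by (simp add: power2_eq_square eval_nat_numeral)
  finally have "q / 80 * (5 * N ^ 8 / q) \<le> real (card (f ` I)) * (5 * N ^ 8 / q)" using up by linarith
  then have "q / 80 \<le> real (card (f ` I))" by (rule mult_right_le_imp_le) (use N2 q2 in simp)
  also have "card (f ` I) \<le> card (f ` ((B \<times> B) \<times> (B \<times> B)))"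
    using finB by (intro card_mono) (auto simp: I_def Z_def)
  finally show ?thesis by (simp add: f_def q_def)
qed

section \<open>Distance sets of cubes over the prime field\<close>

definition growth_at :: "nat \<Rightarrow> bool" where
  "growth_at p \<longleftrightarrow>
     (\<forall>A B. A \<subseteq> {0..<int p} \<and> B \<subseteq> {0..<int p} \<and> card B \<le> (card A)\<^sup>2 \<and> (card A)\<^sup>2 * card B \<le> p\<^sup>2 \<longrightarrow>
        real (card A) * sqrt (card B) \<le>
          3 * 10 ^ 7 * real (card ((\<lambda>(x, y, b). (b + (x - y)\<^sup>2) mod int p) ` (A \<times> A \<times> B)))) \<and>
     (\<forall>B. B \<subseteq> {0..<int p} \<and> 10 ^ 19 * real p ^ 3 \<le> real (card B) ^ 5 \<longrightarrow>
        real p / 80 \<le> real (card ((\<lambda>((a, b), (c, d)). ((a + b) * (c + d)) mod int p) ` ((B \<times> B) \<times> (B \<times> B)))))"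

text \<open>
  A type cannot depend on the prime \<open>p\<close> of the theorem. But \<open>growth_at\<close> is a closed predicate, so it suffices
  to treat one prime: a counterexample to it, if there is any.
\<close>

definition critical_prime :: nat where
  "critical_prime = (if \<exists>p. prime p \<and> odd p \<and> \<not> growth_at p then SOME p. prime p \<and> odd p \<and> \<not> growth_at p else 3)"

text \<open>A counterexample anywhere makes the chosen prime one, so establishing the predicate
  there settles all odd primes. The default 3 merely keeps the number an odd prime when no
  counterexample exists.\<close>

lemma prime_critical_prime: "prime critical_prime" "odd critical_prime"
  and growth_at_critical_prime: "growth_at critical_prime \<Longrightarrow> prime p \<Longrightarrow> odd p \<Longrightarrow> growth_at p"
proof -
  have *: "prime critical_prime \<and> odd critical_prime \<and> (growth_at critical_prime \<longrightarrow> (\<forall>p. prime p \<and> odd p \<longrightarrow> growth_at p))"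
  proof (cases "\<exists>p. prime p \<and> odd p \<and> \<not> growth_at p")
    case True
    then show ?thesis unfolding critical_prime_def using someI_ex[OF True] by auto
  next
    case False
    then show ?thesis unfolding critical_prime_def by auto
  qed
  show "prime critical_prime" "odd critical_prime" using * by auto
  show "growth_at critical_prime \<Longrightarrow> prime p \<Longrightarrow> odd p \<Longrightarrow> growth_at p" using * by auto
qed

section \<open>An infinite field containing the prime field\<close>

typedef critical_index = "{0..<critical_prime}"
  using prime_gt_0_nat[OF prime_critical_prime(1)] by auto

lemma card_critical_index: "CARD(critical_index) = critical_prime"
  using type_definition.card[OF type_definition_critical_index] by simp

instance critical_index :: prime_card
  by standard (unfold card_critical_index, rule prime_critical_prime(1))

text \<open>Rational functions in one variable over the prime field: the characteristic is kept,
  while there is room for generic choices.\<close>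

type_synonym crit_field = "critical_index mod_ring poly fract"

lemma CHAR_crit_field: "CHAR(crit_field) = critical_prime"
proof -
  have of_nat: "(of_nat n :: crit_field) = to_fract [:of_nat n:]" for n
  proof (induction n)
    case (Suc n)
    have "[:of_nat (Suc n):] = 1 + [:of_nat n :: critical_index mod_ring:]"
      by (simp only: of_nat_Suc one_pCons add_pCons add_0_right)
    then show ?case using Suc by (simp only: to_fract_add to_fract_1 of_nat_Suc)
  qed simp
  have iff: "(of_nat n :: crit_field) = 0 \<longleftrightarrow> critical_prime dvd n" for n
  proof -
    have "(of_nat n :: crit_field) = 0 \<longleftrightarrow> (of_nat n :: critical_index mod_ring) = 0"
      unfolding of_nat by simp
    also have "\<dots> \<longleftrightarrow> critical_prime dvd n"
      by (simp add: of_nat_eq_0_iff_char_dvd card_critical_index)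
    finally show ?thesis .
  qed
  show ?thesis by (rule CHAR_eqI) (simp_all add: iff)
qed

lemma infinite_crit_field: "infinite (UNIV :: crit_field set)"
proof -
  have "inj (\<lambda>n. to_fract (monom 1 n) :: crit_field)"
    by (rule injI) (simp add: monom_eq_iff')
  then show ?thesis using range_inj_infinite infinite_super subset_UNIV by blast
qed

lemma crit_field_eq_iff: "(of_int a :: crit_field) = of_int b \<longleftrightarrow> a mod int critical_prime = b mod int critical_prime"
  using of_int_eq_iff_cong_CHAR[where 'a = crit_field, of a b] by (simp add: CHAR_crit_field cong_def)

lemma crit_field_of_nat: "0 < n \<Longrightarrow> n < critical_prime \<Longrightarrow> (of_nat n :: crit_field) \<noteq> 0"
  by (auto simp: of_nat_eq_0_iff_char_dvd CHAR_crit_field dest: dvd_imp_le)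

lemma crit_field_inj: "inj_on (of_int :: int \<Rightarrow> crit_field) {0..<int critical_prime}"
  by (rule inj_onI) (auto simp: crit_field_eq_iff)

lemma crit_field_mod: "(of_int (a mod int critical_prime) :: crit_field) = of_int a"
  by (simp add: crit_field_eq_iff)

lemma crit_prime_field:
  defines "U \<equiv> range (of_int :: int \<Rightarrow> crit_field)"
  shows "finite U" "card U = critical_prime" "a \<in> U \<Longrightarrow> b \<in> U \<Longrightarrow> a / b \<in> U"
proof -
  have U: "U = of_int ` {0..<int critical_prime}"
  proof -
    have "of_int a \<in> (of_int ` {0..<int critical_prime} :: crit_field set)" for a
      using prime_gt_0_nat[OF prime_critical_prime(1)]
      by (intro image_eqI[of _ _ "a mod int critical_prime"]) (auto simp: crit_field_mod)
    then show ?thesis by (auto simp: U_def)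
  qed
  show "finite U" "card U = critical_prime" unfolding U by (simp_all add: card_image[OF crit_field_inj])
  assume "a \<in> U" "b \<in> U"
  then obtain i j where ij: "a = of_int i" "b = of_int j" by (auto simp: U_def)
  show "a / b \<in> U"
  proof (cases "b = 0")
    case True
    then show ?thesis by (auto simp: U_def intro: range_eqI[of _ _ 0])
  next
    case False
    then have "\<not> int critical_prime dvd j" using ij crit_field_eq_iff[of j 0] by (auto simp: dvd_eq_mod_eq_0)
    then have "algebraic_semidom_class.coprime j (int critical_prime)"
      using prime_imp_coprime_int[of "int critical_prime" j] prime_critical_prime(1) 
      by (simp add: algebraic_semidom_class.coprime_commute[of j])
    then obtain x where "[j * x = 1] (mod int critical_prime)" using cong_solve_coprime_int by blast
    then have "(of_int (j * x) :: crit_field) = of_int 1" by (simp only: crit_field_eq_iff cong_def)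
    then have "b * of_int x = 1" using ij by simp
    then have "a / b = of_int (i * x)" using False ij by (simp add: field_simps)
    then show ?thesis unfolding U_def by (rule range_eqI)
  qed
qed

lemma growth_at_critical: "growth_at critical_prime"
  unfolding growth_at_def
proof (intro conjI allI impI; elim conjE)
  let ?p = critical_prime and ?\<phi> = "of_int :: int \<Rightarrow> crit_field"
  note inj = inj_on_subset[OF crit_field_inj]
  have p3: "?p > 2" using prime_ge_2_nat[OF prime_critical_prime(1)] prime_critical_prime(2) by (cases "?p = 2") auto
  fix A B assume A: "A \<subseteq> {0..<int ?p}" and B: "B \<subseteq> {0..<int ?p}"
    and sm: "card B \<le> (card A)\<^sup>2" "(card A)\<^sup>2 * card B \<le> ?p\<^sup>2"
  have fin: "finite A" "finite B" using A B finite_subset by blast+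
  have c: "card (?\<phi> ` A) = card A" "card (?\<phi> ` B) = card B" using card_image[OF inj] A B by blast+
  have "real (card (?\<phi> ` A)) * sqrt (card (?\<phi> ` B)) \<le> 3 * 10 ^ 7 * real (card ((\<lambda>(x, y, b). b + (x - y)\<^sup>2) ` (?\<phi> ` A \<times> ?\<phi> ` A \<times> ?\<phi> ` B)))"
    by (rule sumset_with_squared_differences[OF infinite_crit_field crit_field_of_nat p3]) (use fin sm c in auto)
  also have "(\<lambda>(x, y, b). b + (x - y)\<^sup>2) ` (?\<phi> ` A \<times> ?\<phi> ` A \<times> ?\<phi> ` B) = ?\<phi> ` ((\<lambda>(x, y, b). (b + (x - y)\<^sup>2) mod int ?p) ` (A \<times> A \<times> B))"
  proof -
    have *: "of_int b + (of_int x - of_int y)\<^sup>2 = ?\<phi> ((b + (x - y)\<^sup>2) mod int ?p)" for x y b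
      by (simp add: crit_field_mod)
    have "?\<phi> ` A \<times> ?\<phi> ` A \<times> ?\<phi> ` B = (\<lambda>(x, y, b). (?\<phi> x, ?\<phi> y, ?\<phi> b)) ` (A \<times> A \<times> B)"
      by (intro equalityI subsetI) (auto intro: image_eqI[of _ _ "(_, _, _)"])
    then show ?thesis unfolding image_image by (auto simp: * image_image intro!: image_cong)
  qed
  also have "3 * 10 ^ 7 * real (card (?\<phi> ` ((\<lambda>(x, y, b). (b + (x - y)\<^sup>2) mod int ?p) ` (A \<times> A \<times> B))))
     \<le> 3 * 10 ^ 7 * real (card ((\<lambda>(x, y, b). (b + (x - y)\<^sup>2) mod int ?p) ` (A \<times> A \<times> B)))"
    using fin by (intro mult_left_mono of_nat_mono card_image_le) auto
  finally show "real (card A) * sqrt (card B) \<le> 3 * 10 ^ 7 * real (card ((\<lambda>(x, y, b). (b + (x - y)\<^sup>2) mod int ?p) ` (A \<times> A \<times> B)))"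
    by (simp add: c)
next
  let ?p = critical_prime and ?\<phi> = "of_int :: int \<Rightarrow> crit_field"
  fix B assume B: "B \<subseteq> {0..<int ?p}" and big: "10 ^ 19 * real ?p ^ 3 \<le> real (card B) ^ 5"
  have fin: "finite B" using B finite_subset by blast
  have c: "card (?\<phi> ` B) = card B" using card_image[OF inj_on_subset[OF crit_field_inj]] B by blast
  have "real ?p / 80 \<le> real (card ((\<lambda>((a, b), (c, d)). (a + b) * (c + d)) ` ((?\<phi> ` B \<times> ?\<phi> ` B) \<times> (?\<phi> ` B \<times> ?\<phi> ` B))))"
  proof (rule product_of_sumsets[OF infinite_crit_field crit_field_of_nat, where U = "range ?\<phi>"])
    show "2 \<le> ?p" using prime_ge_2_nat[OF prime_critical_prime(1)] .
    show "finite (range ?\<phi>)" "card (range ?\<phi>) = ?p" using crit_prime_field(1,2) .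
    show "a / b \<in> range ?\<phi>" if "a \<in> range ?\<phi>" "b \<in> range ?\<phi>" for a b using crit_prime_field(3) that .
    show "a - b \<in> range ?\<phi>" if "a \<in> range ?\<phi>" "b \<in> range ?\<phi>" for a b
      using that by (elim rangeE) (simp only: of_int_diff[symmetric] rangeI)
    show "a * b \<in> range ?\<phi>" if "a \<in> range ?\<phi>" "b \<in> range ?\<phi>" for a b
      using that by (elim rangeE) (simp only: of_int_mult[symmetric] rangeI)
    show "0 \<in> range ?\<phi>" by (rule range_eqI[of _ _ 0]) simp
  qed (use big c in auto)
  also have "(\<lambda>((a, b), (c, d)). (a + b) * (c + d)) ` ((?\<phi> ` B \<times> ?\<phi> ` B) \<times> (?\<phi> ` B \<times> ?\<phi> ` B))
     = ?\<phi> ` ((\<lambda>((a, b), (c, d)). ((a + b) * (c + d)) mod int ?p) ` ((B \<times> B) \<times> (B \<times> B)))"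
  proof -
    have *: "(of_int a + of_int b) * (of_int c + of_int d) = ?\<phi> (((a + b) * (c + d)) mod int ?p)" for a b c d
      by (simp add: crit_field_mod)
    have "(?\<phi> ` B \<times> ?\<phi> ` B) \<times> (?\<phi> ` B \<times> ?\<phi> ` B) = (\<lambda>((a, b), (c, d)). ((?\<phi> a, ?\<phi> b), (?\<phi> c, ?\<phi> d))) ` ((B \<times> B) \<times> (B \<times> B))"
      by (intro equalityI subsetI) (auto intro: image_eqI[of _ _ "((_, _), (_, _))"])
    then show ?thesis unfolding image_image by (auto simp: * image_image intro!: image_cong)
  qed
  also have "real (card (?\<phi> ` ((\<lambda>((a, b), (c, d)). ((a + b) * (c + d)) mod int ?p) ` ((B \<times> B) \<times> (B \<times> B)))))
     \<le> real (card ((\<lambda>((a, b), (c, d)). ((a + b) * (c + d)) mod int ?p) ` ((B \<times> B) \<times> (B \<times> B))))"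
    using fin by (intro of_nat_mono card_image_le) auto
  finally show "real ?p / 80 \<le> real (card ((\<lambda>((a, b), (c, d)). ((a + b) * (c + d)) mod int ?p) ` ((B \<times> B) \<times> (B \<times> B))))" .
qed

lemmas growth_at_prime = growth_at_critical_prime[OF growth_at_critical]

section \<open>Distance sets of cubes and their growth\<close>

lemma distance_set_cube_0: "distance_set p 0 (cube 0 A) = {0}"
  by (auto simp: distance_set_def cube_def dist_Fp_def)

lemma distance_set_cube_Suc:
  "distance_set p (Suc d) (cube (Suc d) A) = (\<lambda>(x, y, b). (b + (x - y)\<^sup>2) mod p) ` (A \<times> A \<times> distance_set p d (cube d A))"
proof (intro equalityI subsetI)
  fix v assume "v \<in> distance_set p (Suc d) (cube (Suc d) A)"
  then obtain x y where v: "v = dist_Fp p (Suc d) x y" and xy: "x \<in> cube (Suc d) A" "y \<in> cube (Suc d) A"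
    by (auto simp: distance_set_def)
  \<comment> \<open>The coordinate d is reset to 0 because a point of the smaller cube must vanish
    from index d on.\<close>
  define x' y' where "x' = x(d := 0)" and "y' = y(d := 0)"
  have "x' \<in> cube d A" "y' \<in> cube d A" using xy by (auto simp: cube_def x'_def y'_def le_Suc_eq Suc_le_eq)
  then have "dist_Fp p d x' y' \<in> distance_set p d (cube d A)" by (auto simp: distance_set_def)
  moreover have "v = (dist_Fp p d x' y' + (x d - y d)\<^sup>2) mod p"
    unfolding v dist_Fp_def x'_def y'_def by (simp add: mod_simps)
  moreover have "x d \<in> A" "y d \<in> A" using xy by (auto simp: cube_def)
  ultimately show "v \<in> (\<lambda>(x, y, b). (b + (x - y)\<^sup>2) mod p) ` (A \<times> A \<times> distance_set p d (cube d A))"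
    by (intro image_eqI[of _ _ "(x d, y d, dist_Fp p d x' y')"]) auto
next
  fix v assume "v \<in> (\<lambda>(x, y, b). (b + (x - y)\<^sup>2) mod p) ` (A \<times> A \<times> distance_set p d (cube d A))"
  then obtain a b x y where v: "v = (dist_Fp p d x y + (a - b)\<^sup>2) mod p" and h: "a \<in> A" "b \<in> A" "x \<in> cube d A" "y \<in> cube d A"
    by (auto simp: distance_set_def)
  have "v = dist_Fp p (Suc d) (x(d := a)) (y(d := b))" unfolding v dist_Fp_def by (simp add: mod_simps)
  moreover have "x(d := a) \<in> cube (Suc d) A" "y(d := b) \<in> cube (Suc d) A" using h by (auto simp: cube_def less_Suc_eq)
  ultimately show "v \<in> distance_set p (Suc d) (cube (Suc d) A)" by (auto simp: distance_set_def)
qed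

lemma distance_set_subset: "p > 0 \<Longrightarrow> distance_set p d E \<subseteq> {0..<p}"
  by (auto simp: distance_set_def dist_Fp_def)

text \<open>Points of A^i and A^j can be concatenated; the induction moves the squared differences
  over one coordinate at a time.\<close>

lemma distance_set_add:
  assumes "a \<in> distance_set p i (cube i A)" "b \<in> distance_set p j (cube j A)"
  shows "(a + b) mod p \<in> distance_set p (i + j) (cube (i + j) A)"
  using assms(2)
proof (induction j arbitrary: b)
  case 0
  have "a mod p = a" using assms(1) by (auto simp: distance_set_def dist_Fp_def)
  then show ?case using 0 assms(1) by (simp add: distance_set_cube_0)
next
  case (Suc j)
  then obtain x y b' where b: "b = (b' + (x - y)\<^sup>2) mod p" "x \<in> A" "y \<in> A" "b' \<in> distance_set p j (cube j A)"
    unfolding distance_set_cube_Suc by auto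
  have "(a + b) mod p = ((a + b') mod p + (x - y)\<^sup>2) mod p" unfolding b(1) by (simp add: mod_simps add.assoc)
  then show ?case using Suc.IH[OF b(4)] b(2,3) unfolding add_Suc_right distance_set_cube_Suc
    by (intro image_eqI[of _ _ "(x, y, (a + b') mod p)"]) auto
qed

lemma distance_set_Suc_mono:
  assumes "A \<noteq> {}" shows "distance_set p d (cube d A) \<subseteq> distance_set p (Suc d) (cube (Suc d) A)"
proof
  fix v assume v: "v \<in> distance_set p d (cube d A)"
  obtain a where "a \<in> A" using assms by auto
  have "v mod p = v" using v by (auto simp: distance_set_def dist_Fp_def)
  then show "v \<in> distance_set p (Suc d) (cube (Suc d) A)"
    unfolding distance_set_cube_Suc using v \<open>a \<in> A\<close> by (intro image_eqI[of _ _ "(a, a, v)"]) auto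
qed

lemma card_cube_le:
  assumes "finite A" shows "card (cube d A) \<le> card A ^ d"
proof -
  have "card (cube d A) \<le> card (PiE {..<d} (\<lambda>_. A))"
  proof (rule card_inj_on_le[of "\<lambda>x. restrict x {..<d}"])
    show "inj_on (\<lambda>x. restrict x {..<d}) (cube d A)"
    proof (rule inj_onI)
      fix x y assume h: "x \<in> cube d A" "y \<in> cube d A" "restrict x {..<d} = restrict y {..<d}"
      show "x = y"
      proof
        fix i
        show "x i = y i" using h(1,2) fun_cong[OF h(3), of i] by (cases "i < d") (auto simp: cube_def)
      qed
    qed
  qed (use assms in \<open>auto simp: cube_def intro: finite_PiE split: if_splits\<close>)
  also have "\<dots> = card A ^ d" by (simp add: card_PiE)
  finally show ?thesis .
qed

text \<open>One more coordinate turns the exponent e into 1 + e/2; starting from 0 this gives 2 -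
  2/2^j. The constant 9 * 10^14 is the square of 3 * 10^7 and hence is reproduced by the
  recursion.\<close>

lemma distance_set_growth:
  fixes p :: int
  assumes p: "prime p" "odd p" and A: "A \<subseteq> {0..<p}" "A \<noteq> {}" and sm: "(card A)\<^sup>2 \<le> nat p"
  shows "real (card A) powr (2 - 2 / 2 ^ j) / (9 * 10 ^ 14) \<le> real (card (distance_set p j (cube j A)))"
proof (induction j)
  case 0
  show ?case using A by (simp add: distance_set_cube_0)
next
  case (Suc j)
  let ?S = "distance_set p j (cube j A)"
  have p0: "p > 0" using p prime_gt_0_int by blast
  define n x where "n = real (card A)" and "x = n powr (2 - 2 / 2 ^ j) / (9 * 10 ^ 14)"
  have finA: "finite A" using A(1) finite_subset by blast
  have n1: "n \<ge> 1" using finA A(2) by (simp add: n_def Suc_le_eq card_gt_0_iff)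
  have x0: "x > 0" using n1 by (simp add: x_def)
  define m where "m = nat \<lceil>x\<rceil>"
  have mx: "x \<le> real m" unfolding m_def by linarith
  \<comment> \<open>The growth estimate has upper bounds on its second set, so the distance set is
    cut down to exactly the guaranteed size. It is at most |A|^2, and |A|^2 \<le> p gives the other
    size condition.\<close>
  have "m \<le> card ?S" using Suc.IH unfolding m_def x_def n_def by linarith
  then obtain B where B: "B \<subseteq> ?S" "card B = m" "finite B" by (rule obtain_subset_with_card_n)
  have "x \<le> real ((card A)\<^sup>2)"
  proof -
    have "x \<le> n powr (2 - 2 / 2 ^ j) / 1" unfolding x_def by (rule divide_left_mono) auto
    also have "\<dots> \<le> n powr 2" unfolding div_by_1 using n1 by (intro powr_mono) auto
    also have "\<dots> = real ((card A)\<^sup>2)" using n1 by (simp add: n_def)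
    finally show ?thesis .
  qed
  then have m2: "m \<le> (card A)\<^sup>2" unfolding m_def by linarith
  have "(card A)\<^sup>2 * card B \<le> nat p * nat p" unfolding B(2) using sm m2 by (intro mult_le_mono) auto
  then have m3: "(card A)\<^sup>2 * card B \<le> (nat p)\<^sup>2" by (simp add: power2_eq_square)
  have "prime (nat p)" "odd (nat p)" using p p0 by (auto simp: even_nat_iff)
  then have "growth_at (nat p)" by (rule growth_at_prime)
  moreover have "A \<subseteq> {0..<int (nat p)}" using A p0 by simp
  moreover have "B \<subseteq> {0..<int (nat p)}" using B(1) distance_set_subset[OF p0, of j "cube j A"] p0 by simp
  ultimately have "real (card A) * sqrt (card B) \<le> 3 * 10 ^ 7 * real (card ((\<lambda>(x, y, b). (b + (x - y)\<^sup>2) mod int (nat p)) ` (A \<times> A \<times> B)))"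
    using m2 m3 B(2) unfolding growth_at_def by blast
  also have "int (nat p) = p" using p0 by simp
  also have "3 * 10 ^ 7 * real (card ((\<lambda>(x, y, b). (b + (x - y)\<^sup>2) mod p) ` (A \<times> A \<times> B))) \<le> 3 * 10 ^ 7 * real (card (distance_set p (Suc j) (cube (Suc j) A)))"
  proof (intro mult_left_mono of_nat_mono card_mono)
    show "finite (distance_set p (Suc j) (cube (Suc j) A))"
      by (rule finite_subset[OF distance_set_subset[OF p0]]) simp
    show "(\<lambda>(x, y, b). (b + (x - y)\<^sup>2) mod p) ` (A \<times> A \<times> B) \<subseteq> distance_set p (Suc j) (cube (Suc j) A)"
      unfolding distance_set_cube_Suc using B(1) by (intro image_mono Sigma_mono) auto
  qed simp
  finally have low: "n * sqrt (real m) \<le> 3 * 10 ^ 7 * real (card (distance_set p (Suc j) (cube (Suc j) A)))"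
    by (simp add: n_def B(2))
  have "n powr (2 - 2 / 2 ^ Suc j) / (3 * 10 ^ 7) = n * sqrt x"
  proof -
    have "sqrt x = sqrt (n powr (2 - 2 / 2 ^ j)) / sqrt ((3 * 10 ^ 7)\<^sup>2)" by (simp add: x_def real_sqrt_divide)
    also have "sqrt ((3 * 10 ^ 7)\<^sup>2 :: real) = 3 * 10 ^ 7" by (rule real_sqrt_unique) auto
    also have "sqrt (n powr (2 - 2 / 2 ^ j)) = n powr ((2 - 2 / 2 ^ j) / 2)"
      using n1 by (simp add: powr_half_sqrt[symmetric] powr_powr)
    finally have "n * sqrt x = n powr 1 * n powr ((2 - 2 / 2 ^ j) / 2) / (3 * 10 ^ 7)" using n1 by simp
    also have "n powr 1 * n powr ((2 - 2 / 2 ^ j) / 2) = n powr (1 + (2 - 2 / 2 ^ j) / 2)" by (simp only: powr_add)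
    also have "1 + (2 - 2 / 2 ^ j) / 2 = (2 - 2 / 2 ^ Suc j :: real)" by (simp add: field_simps)
    finally show ?thesis by simp
  qed
  also have "\<dots> \<le> n * sqrt (real m)" using mx n1 by (intro mult_left_mono) auto
  also have "\<dots> \<le> 3 * 10 ^ 7 * real (card (distance_set p (Suc j) (cube (Suc j) A)))" by (rule low)
  finally show ?case by (simp add: n_def field_simps)
qed

text \<open>A subset A' of size about p^\<alpha> has |\<Delta>_k(A')| at least 10^4 p^(3/5), by
  \<alpha> (2 - 2/2^k) = 3/5. Two blocks of k coordinates provide the sums of this set with itself.
  The factor 10^19 in the size of A outweighs the loss 9 * 10^14 and leaves the 10^4.\<close>

lemma product_of_distance_sets:
  fixes p :: int
  assumes p: "prime p" "odd p" and k: "k \<ge> 2" and A: "A \<subseteq> {0..<p}"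
    and big: "10 ^ 19 * real_of_int p powr (3 * 2 ^ k / (10 * (2 ^ k - 1))) \<le> real (card A)"
    and p_large: "(10 ^ 19 + 1) ^ 10 \<le> real_of_int p"
  shows "real_of_int p / 80 \<le> real (card (prod_set_Fp p (distance_set p (2 * k + 1) (cube (2 * k + 1) A))))"
proof -
  define q \<alpha> K where "q = real_of_int p" and "\<alpha> = (3 * 2 ^ k / (10 * (2 ^ k - 1)) :: real)" and "K = (10 ^ 19 :: real)"
  have q1: "q \<ge> 1" using p_large unfolding q_def by (rule order_trans[rotated]) simp
  have p0: "p > 0" using q1 by (simp add: q_def)
  have k4: "(2::real) ^ k \<ge> 4" using power_increasing[OF k, of "2::real"] by simp
  have \<alpha>: "0 \<le> \<alpha>" "\<alpha> \<le> 2 / 5" using k4 by (auto simp: \<alpha>_def field_simps)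
  define n where "n = nat \<lceil>K * q powr \<alpha>\<rceil>"
  have "0 \<le> K * q powr \<alpha>" by (simp add: K_def)
  then have n: "K * q powr \<alpha> \<le> real n" "real n \<le> K * q powr \<alpha> + 1" unfolding n_def by linarith+
  have "n \<le> card A" using big unfolding n_def K_def \<alpha>_def q_def by linarith
  then obtain A' where A': "A' \<subseteq> A" "card A' = n" "finite A'" by (rule obtain_subset_with_card_n)
  have qa1: "1 \<le> q powr \<alpha>" using q1 \<alpha> by (simp add: ge_one_powr_ge_zero)
  have nK: "K \<le> real n" using n(1) qa1 mult_left_mono[of 1 "q powr \<alpha>" K] by (simp add: K_def)
  then have "n > 0" by (cases n) (auto simp: K_def)
  then have ne: "A' \<noteq> {}" using A' by auto
  have sm: "(card A')\<^sup>2 \<le> nat p"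
  proof -
    have "real n \<le> (K + 1) * q powr \<alpha>" using n(2) qa1 by (simp add: algebra_simps)
    also have "\<dots> \<le> (K + 1) * q powr (2 / 5)" using \<alpha> q1 by (intro mult_left_mono powr_mono) (auto simp: K_def)
    \<comment> \<open>For k \<ge> 2 the exponent \<alpha> is at most 2/5, which leaves p^(1/10) to
      absorb the constant before the square root of p is reached. This is the source of the bound
      (10^19 + 1)^10.\<close>
    also have "\<dots> \<le> q powr (1 / 10) * q powr (2 / 5)"
    proof (rule mult_right_mono)
      have root: "a = (a ^ 10) powr (1 / 10)" if "a > 0" for a :: real
      proof -
        have "(a ^ 10) powr (1 / 10) = a powr (real 10 * (1 / 10))"
          by (simp only: powr_realpow[OF that, symmetric] powr_powr)
        then show ?thesis using that by simp
      qed
      have K0: "K + 1 > 0" by (simp add: K_def)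
      have pl: "(K + 1) ^ 10 \<le> q" using p_large unfolding q_def K_def .
      have "K + 1 = ((K + 1) ^ 10) powr (1 / 10)" by (rule root[OF K0])
      also have "\<dots> \<le> q powr (1 / 10)"
        by (rule powr_mono2[OF _ _ pl]) (use K0 in \<open>simp_all only: zero_le_power less_imp_le zero_le_divide_1_iff zero_le_numeral\<close>)
      finally show "K + 1 \<le> q powr (1 / 10)" .
    qed simp
    also have "\<dots> = q powr (1 / 2)" by (simp flip: powr_add)
    also have "\<dots> = sqrt q" using q1 by (simp add: powr_half_sqrt)
    finally have "(real n)\<^sup>2 \<le> (sqrt q)\<^sup>2" by (rule power_mono) simp
    then have "real (n\<^sup>2) \<le> real (nat p)" using q1 p0 by (simp add: q_def)
    then show ?thesis by (simp only: A'(2) of_nat_le_iff)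
  qed
  define B where "B = distance_set p k (cube k A')"
  have BF: "B \<subseteq> {0..<p}" unfolding B_def by (rule distance_set_subset[OF p0])
  define e where "e = (2 - 2 / 2 ^ k :: real)"
  have e1: "e \<ge> 1" using k4 by (simp add: e_def field_simps)
  have "real n powr e / (9 * 10 ^ 14) \<le> real (card B)"
    using distance_set_growth[OF p _ ne sm, of k] A A'(1,2) unfolding B_def e_def by auto
  moreover have "10 ^ 4 * q powr (3 / 5) \<le> real n powr e / (9 * 10 ^ 14)"
  proof -
    have ae: "\<alpha> * e = 3 / 5" using k4 by (simp add: \<alpha>_def e_def field_simps)
    have "9 * 10 ^ 18 * q powr (3 / 5) \<le> K powr 1 * q powr (3 / 5)" by (intro mult_right_mono) (auto simp: K_def)
    also have "\<dots> \<le> K powr e * q powr (3 / 5)" using e1 by (intro mult_right_mono powr_mono) (auto simp: K_def)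
    also have "\<dots> = (K * q powr \<alpha>) powr e" unfolding ae[symmetric] by (simp add: powr_mult powr_powr K_def)
    also have "\<dots> \<le> real n powr e" using n(1) e1 by (intro powr_mono2) (auto simp: K_def)
    finally show ?thesis by simp
  qed
  ultimately have "10 ^ 4 * q powr (3 / 5) \<le> real (card B)" by linarith
  then have "(10 ^ 4 * q powr (3 / 5)) ^ 5 \<le> real (card B) ^ 5" by (rule power_mono) simp
  also have "(10 ^ 4 * q powr (3 / 5)) ^ 5 = 10 ^ 20 * q ^ 3"
  proof -
    have "(q powr (3 / 5)) ^ 5 = q powr (3 / 5 * real 5)" using q1 by (subst powr_power) auto
    also have "\<dots> = q ^ 3" using q1 by simp
    finally show ?thesis by (simp add: power_mult_distrib)
  qed
  finally have "10 ^ 20 * q ^ 3 \<le> real (card B) ^ 5" .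
  moreover have "(10 :: real) ^ 19 * q ^ 3 \<le> 10 ^ 20 * q ^ 3" using q1 by (intro mult_right_mono) auto
  ultimately have "10 ^ 19 * q ^ 3 \<le> real (card B) ^ 5" by (rule order_trans[rotated])
  moreover have "q = real (nat p)" using p0 by (simp add: q_def)
  moreover have "prime (nat p)" "odd (nat p)" using p p0 by (auto simp: even_nat_iff)
  then have "growth_at (nat p)" by (rule growth_at_prime)
  ultimately have "q / 80 \<le> real (card ((\<lambda>((a, b), (c, d)). ((a + b) * (c + d)) mod int (nat p)) ` ((B \<times> B) \<times> (B \<times> B))))"
    using BF p0 unfolding growth_at_def by auto
  also have "\<dots> \<le> real (card (prod_set_Fp p (distance_set p (2 * k + 1) (cube (2 * k + 1) A))))"
  proof (intro of_nat_mono card_mono subsetI)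
    show "finite (prod_set_Fp p (distance_set p (2 * k + 1) (cube (2 * k + 1) A)))"
      by (rule finite_subset[of _ "{0..<p}"]) (use p0 in \<open>auto simp: prod_set_Fp_def\<close>)
    fix v assume "v \<in> (\<lambda>((a, b), (c, d)). ((a + b) * (c + d)) mod int (nat p)) ` ((B \<times> B) \<times> (B \<times> B))"
    then obtain a b c d where v: "v = ((a + b) * (c + d)) mod p" and h: "a \<in> B" "b \<in> B" "c \<in> B" "d \<in> B" using p0 by auto
    have mono: "distance_set p m (cube m A') \<subseteq> distance_set p m (cube m A)" for m
    proof -
      have "cube m A' \<subseteq> cube m A" using A'(1) by (auto simp: cube_def)
      then show ?thesis by (auto simp: distance_set_def)
    qed
    have in2: "(x + y) mod p \<in> distance_set p (2 * k + 1) (cube (2 * k + 1) A)" if "x \<in> B" "y \<in> B" for x y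
    proof -
      have "(x + y) mod p \<in> distance_set p (2 * k) (cube (2 * k) A')"
        using distance_set_add[of x p k A' y k] that unfolding B_def by (simp add: mult_2)
      \<comment> \<open>The last of the 2 k + 1 coordinates is given the same value in both points
        and contributes 0.\<close>
      then show ?thesis using distance_set_Suc_mono[OF ne, of p "2 * k"] mono[of "Suc (2 * k)"] by auto
    qed
    have "v = ((a + b) mod p * ((c + d) mod p)) mod p" unfolding v by (simp add: mod_mult_eq)
    then show "v \<in> prod_set_Fp p (distance_set p (2 * k + 1) (cube (2 * k + 1) A))"
      unfolding prod_set_Fp_def using in2 h by blast
  qed
  finally show ?thesis by (simp add: q_def)
qed

theorem theorem1p6:
  fixes k :: nat
  assumes "k \<ge> 2"
  shows "\<exists>C c :: real. C > 0 \<and> c > 0 \<and>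
    (\<forall>(p::int) A. prime p \<and> odd p \<and> A \<subseteq> Fp p \<and>
       real (card (cube (2*k+1) A)) \<ge> C * real_of_int p powr
          (real (2*k+1) / 2 - real (2*k+1) * (2^(k+1) - 5) / (10 * (2^k - 1)))
     \<longrightarrow> real (card (prod_set_Fp p (distance_set p (2*k+1) (cube (2*k+1) A)))) \<ge> c * real_of_int p)"
proof -
  define d where "d = 2 * k + 1"
  define \<alpha> where "\<alpha> = (3 * 2 ^ k / (10 * (2 ^ k - 1)) :: real)"
  define M where "M = ((10 ^ 19 + 1) ^ 10 :: real)"
  have M80: "M \<ge> 80" by (simp add: M_def)
  have k4: "(2::real) ^ k \<ge> 4" using power_increasing[OF assms, of "2::real"] by simp
  \<comment> \<open>Divided by d, the exponent is 1/2 - (2^(k+1) - 5) / (10 (2^k - 1)), that is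
    \<alpha>; the bound on |A^d| becomes one on |A| by taking d-th roots.\<close>
  have expo: "real d / 2 - real d * (2 ^ (k + 1) - 5) / (10 * (2 ^ k - 1)) = \<alpha> * real d"
    using k4 by (simp add: \<alpha>_def field_simps)
  have main: "1 / M * real_of_int p \<le> real (card (prod_set_Fp p (distance_set p d (cube d A))))"
    if p: "prime p" "odd p" and A: "A \<subseteq> Fp p"
      and big: "(10 ^ 19) ^ d * real_of_int p powr (\<alpha> * real d) \<le> real (card (cube d A))" for p :: int and A
  proof -
    have p0: "p > 0" using p prime_gt_0_int by blast
    have finA: "finite A" using A by (rule finite_subset) (simp add: Fp_def)
    have "(10 ^ 19 * real_of_int p powr \<alpha>) ^ d \<le> real (card A) ^ d"
    proof -
      have "(10 ^ 19 * real_of_int p powr \<alpha>) ^ d = (10 ^ 19) ^ d * real_of_int p powr (\<alpha> * real d)"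
        using p0 by (simp only: power_mult_distrib) (simp add: powr_power mult.commute)
      also have "\<dots> \<le> real (card (cube d A))" by (rule big)
      also have "\<dots> \<le> real (card A ^ d)" using card_cube_le[OF finA] by (intro of_nat_mono)
      finally show ?thesis by simp
    qed
    then have "(10 ^ 19 * real_of_int p powr \<alpha>) ^ Suc (2 * k) \<le> real (card A) ^ Suc (2 * k)"
      by (simp only: d_def Suc_eq_plus1)
    then have n: "10 ^ 19 * real_of_int p powr \<alpha> \<le> real (card A)" by (rule power_le_imp_le_base) simp
    show ?thesis
    proof (cases "M \<le> real_of_int p")
      case True
      have "1 / M * real_of_int p \<le> real_of_int p / 80" using M80 p0 by (simp add: field_simps)
      also have "\<dots> \<le> real (card (prod_set_Fp p (distance_set p d (cube d A))))"
        unfolding d_def using p assms A n True unfolding \<alpha>_def M_def Fp_def by (rule product_of_distance_sets)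
      finally show ?thesis .
    next
      \<comment> \<open>Small primes are absorbed by the constant: the product set is nonempty, and
        p/M is below 1.\<close>
      case False
      have "0 < real (card A)" using n p0 by (intro less_le_trans[OF _ n]) simp
      then obtain a where a: "a \<in> A" by (cases "A = {}") auto
      define x where "x = (\<lambda>i. if i < d then a else 0)"
      have "x \<in> cube d A" using a by (auto simp: cube_def x_def)
      then have "dist_Fp p d x x \<in> distance_set p d (cube d A)" by (auto simp: distance_set_def)
      then have "prod_set_Fp p (distance_set p d (cube d A)) \<noteq> {}" by (auto simp: prod_set_Fp_def)
      moreover have "finite (prod_set_Fp p (distance_set p d (cube d A)))"
        by (rule finite_subset[of _ "{0..<p}"]) (use p0 in \<open>auto simp: prod_set_Fp_def\<close>)
      ultimately have "1 \<le> card (prod_set_Fp p (distance_set p d (cube d A)))" by (simp add: Suc_le_eq card_gt_0_iff)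
      moreover have "1 / M * real_of_int p \<le> 1" using False M80 by simp
      ultimately show ?thesis by linarith
    qed
  qed
  show ?thesis
    unfolding d_def[symmetric] expo
    by (intro exI[of _ "(10 ^ 19) ^ d"] exI[of _ "1 / M"]) (use main M80 in auto)
qed

end
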